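(* Let $A$ be an associative algebra over $\mathbb{C}$ equipped with a symmetric invariant bilinear form $\langle\cdot,\cdot\rangle$ (that is, $\langle ab,c\rangle=\langle a,bc\rangle$) and let $q$ be a nonzero complex number which is not a root of unity. Let $\hat A_q$ be the quantum torus Lie algebra $$\hat A_q=A\otimes\mathbb{C}_q[t_0^{\pm1},t_1^{\pm1}]\oplus\mathbb{C}c_0\oplus\mathbb{C}c_1,$$ where $c_0,c_1$ are central and, for $a,b\in A$, $m,n,r,s\in\mathbb{Z}$, $$[a\otimes t_0^mt_1^n,b\otimes t_0^rt_1^s]=q^{nr}(ab\otimes t_0^{m+r}t_1^{n+s})-q^{ms}(ba\otimes t_0^{m+r}t_1^{n+s})+\langle a,b\rangle q^{nr}\delta_{m+r,0}\delta_{n+s,0}(mc_0+nc_1).$$ Let $A_*=A\otimes\mathbb{C}_*[t_0^{\pm1},t_1^{\pm1}]$ be the Lie algebra (with commutator bracket) equipped with its symmetric invariant bilinear form, as defined in the context. Let $W$ be any restricted $\hat A_q$-module of level $\ell\in\mathbb{C}$ on which the central element $c_1$ acts as zero. Then there exists a unique quasi $V_{\widehat{A_*}}(\ell,0)$-module structure on $W$ with $Y_W(a\otimes t_0^mt_1^n,x)=\bar X(a,m,n,x)$ (acting on $W$) for $a\in A$, $m,n\in\mathbb{Z}$.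
   Context: $x,x_0,x_1,x_2$ are commuting formal variables; $\delta(z)=\sum_{n\in\mathbb{Z}}z^n$; integer powers of a binomial are expanded in nonnegative powers of the second-written term. $\mathbb{C}_q[t_0^{\pm1},t_1^{\pm1}]$ is the space $\mathbb{C}[t_0^{\pm1},t_1^{\pm1}]$ with product $(t_0^mt_1^n)(t_0^rt_1^s)=q^{nr}t_0^{m+r}t_1^{n+s}$. For $a\in A$, $n\in\mathbb{Z}$: $X(a,n,x)=\sum_{m\in\mathbb{Z}}(a\otimes t_0^mt_1^n)x^{-m-1}$, and for $m,n\in\mathbb{Z}$: $\bar X(a,m,n,x)=q^nX(a,m,q^nx)$. An $\hat A_q$-module has level $\ell$ if $c_0$ acts as the scalar $\ell$; it is restricted if $X(a,n,x)w\in W((x))$ for all $a\in A$, $n\in\mathbb{Z}$, $w\in W$. $\mathbb{C}_*[t_0^{\pm1},t_1^{\pm1}]$ is the space $\mathbb{C}[t_0^{\pm1},t_1^{\pm1}]$ with the (associative) multiplication $(t_0^nt_1^m)(t_0^st_1^r)=\delta_{n+m,r}t_0^{n+s}t_1^m$ and the symmetric associative bilinear form $\langle t_0^nt_1^m,t_0^st_1^r\rangle=\delta_{n+s,0}\delta_{m+n,r}$. $A_*=A\otimes\mathbb{C}_*[t_0^{\pm1},t_1^{\pm1}]$ is the tensor product associative algebra with the tensor product form, viewed as a Lie algebra under commutator. For a Lie algebra $\mathfrak g$ with a symmetric invariant bilinear form, the affine Lie algebra is $\hat{\mathfrak g}=\mathfrak g\otimes\mathbb{C}[t,t^{-1}]\oplus\mathbb{C}\mathbf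 k$ with $\mathbf k$ central and $[a\otimes t^m,b\otimes t^n]=[a,b]\otimes t^{m+n}+m\langle a,b\rangle\delta_{m+n,0}\mathbf k$. $V_{\hat{\mathfrak g}}(\ell,0)=U(\hat{\mathfrak g})\otimes_{U(\mathfrak g\otimes\mathbb{C}[t]\oplus\mathbb{C}\mathbf k)}\mathbb{C}_\ell$, where $\mathbb{C}_\ell=\mathbb{C}$ with $\mathfrak g\otimes\mathbb{C}[t]$ acting trivially and $\mathbf k$ acting as $\ell$; $\mathbf 1=1\otimes1$; $\mathfrak g$ is identified with a subspace via $a\mapsto(a\otimes t^{-1})\mathbf 1$. It is known that $V_{\hat{\mathfrak g}}(\ell,0)$ has a unique vertex algebra structure with vacuum $\mathbf 1$ and $Y(a,x)=\sum_{n\in\mathbb{Z}}(a\otimes t^n)x^{-n-1}$ for $a\in\mathfrak g$, and that $\mathfrak g$ generates it. Quasi module: for a vertex algebra $(V,Y,\mathbf 1)$, a quasi $V$-module is a vector space $W$ with a linear map $Y_W:V\to\operatorname{Hom}(W,W((x)))$ such that $Y_W(\mathbf 1,x)=1_W$ and for any $u,v\in V$ there is a nonzero polynomial $f(x_1,x_2)$ with $$x_0^{-1}\delta\left(\tfrac{x_1-x_2}{x_0}\right)f(x_1,x_2)Y_W(u,x_1)Y_W(v,x_2)-x_0^{-1}\delta\left(\tfrac{x_2-x_1}{-x_0}\right)f(x_1,x_2)Y_W(v,x_2)Y_W(u,x_1)=x_2^{-1}\delta\left(\tfrac{x_1-x_0}{x_2}\right)f(x_1,x_2)Y_W(Y(u,x_0)v,x_2).$$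 *)

theory Defs
  imports Complex_Main "HOL-Library.Poly_Mapping" "HOL-Library.Product_Plus"
begin

text \<open>Associative algebras over the complex numbers are not assumed to be unital.\<close>

definition assoc_algebra :: "(complex \<Rightarrow> 'a::ring \<Rightarrow> 'a) \<Rightarrow> bool" where
  "assoc_algebra sc \<longleftrightarrow> vector_space sc \<and>
     (\<forall>c a b. sc c (a * b) = sc c a * b) \<and> (\<forall>c a b. sc c (a * b) = a * sc c b)"

definition symmetric_invariant_form ::
    "(complex \<Rightarrow> 'a::ring \<Rightarrow> 'a) \<Rightarrow> ('a \<Rightarrow> 'a \<Rightarrow> complex) \<Rightarrow> bool" where
  "symmetric_invariant_form sc form \<longleftrightarrow>
     (\<forall>b. Vector_Spaces.linear sc (*) (\<lambda>a. form a b)) \<and>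
     (\<forall>a. Vector_Spaces.linear sc (*) (form a)) \<and>
     (\<forall>a b. form a b = form b a) \<and>
     (\<forall>a b c. form (a * b) c = form a (b * c))"

text \<open>A finitely supported function \<open>p :: 'i \<Rightarrow>\<^sub>0 'a\<close> stands for the element
  \<open>\<Sum>i. lookup p i \<otimes> e i\<close> of the tensor product of \<open>'a\<close> with the space with basis \<open>(e i)\<close>.
  For \<open>'i = int\<close> this gives Laurent polynomials in \<open>t\<close> with coefficients in \<open>'a\<close>, and for
  \<open>'i = int \<times> int\<close> the index \<open>(m, n)\<close> is the monomial \<open>t\<^sub>0^m t\<^sub>1^n\<close>. So
  \<open>Poly_Mapping.single (m, n) a\<close> is \<open>a \<otimes> t\<^sub>0^m t\<^sub>1^n\<close>.\<close>

definition pm_scale :: "(complex \<Rightarrow> 'a::zero \<Rightarrow> 'a) \<Rightarrow> complex \<Rightarrow> ('i \<Rightarrow>\<^sub>0 'a) \<Rightarrow> ('i \<Rightarrow>\<^sub>0 'a)" where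
  "pm_scale sc c p = Poly_Mapping.map (sc c) p"

text \<open>The biadditive map sending \<open>(a \<otimes> e i, b \<otimes> e j)\<close> to \<open>h i a j b\<close>, for \<open>h\<close> biadditive in
  \<open>a\<close> and \<open>b\<close>.\<close>

definition bilin_ext ::
    "('i \<Rightarrow> 'a::zero \<Rightarrow> 'j \<Rightarrow> 'b::zero \<Rightarrow> 'c::comm_monoid_add) \<Rightarrow> ('i \<Rightarrow>\<^sub>0 'a) \<Rightarrow> ('j \<Rightarrow>\<^sub>0 'b) \<Rightarrow> 'c" where
  "bilin_ext h p r =
     (\<Sum>i\<in>Poly_Mapping.keys p. \<Sum>j\<in>Poly_Mapping.keys r.
        h i (Poly_Mapping.lookup p i) j (Poly_Mapping.lookup r j))"

lemma bilin_ext_single: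
  assumes "\<And>b. h i 0 j b = 0" and "\<And>a. h i a j 0 = 0"
  shows "bilin_ext h (Poly_Mapping.single i a) (Poly_Mapping.single j b) = h i a j b"
  using assms by (cases "a = 0"; cases "b = 0") (simp_all add: bilin_ext_def)

text \<open>The triple \<open>(p, \<alpha>, \<beta>)\<close> is \<open>p + \<alpha> c\<^sub>0 + \<beta> c\<^sub>1\<close>.\<close>

type_synonym 'a qtorus = "(int \<times> int \<Rightarrow>\<^sub>0 'a) \<times> complex \<times> complex"

definition qtorus_scale :: "(complex \<Rightarrow> 'a::zero \<Rightarrow> 'a) \<Rightarrow> complex \<Rightarrow> 'a qtorus \<Rightarrow> 'a qtorus" where
  "qtorus_scale sc c = (\<lambda>(p, \<alpha>, \<beta>). (pm_scale sc c p, c * \<alpha>, c * \<beta>))"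

definition qtorus_bracket ::
    "(complex \<Rightarrow> 'a::ring \<Rightarrow> 'a) \<Rightarrow> ('a \<Rightarrow> 'a \<Rightarrow> complex) \<Rightarrow> complex \<Rightarrow> 'a qtorus \<Rightarrow> 'a qtorus \<Rightarrow> 'a qtorus" where
  "qtorus_bracket sc form q = (\<lambda>(p, _, _) (p', _, _).
     bilin_ext (\<lambda>(m, n) a (r, s) b.
       (Poly_Mapping.single (m + r, n + s) (sc (q powi (n * r)) (a * b))
          - Poly_Mapping.single (m + r, n + s) (sc (q powi (m * s)) (b * a)),
        if m + r = 0 \<and> n + s = 0 then form a b * q powi (n * r) * of_int m else 0,
        if m + r = 0 \<and> n + s = 0 then form a b * q powi (n * r) * of_int n else 0)) p p')"

definition qtorus_mono :: "'a::zero \<Rightarrow> int \<Rightarrow> int \<Rightarrow> 'a qtorus" where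
  "qtorus_mono a m n = (Poly_Mapping.single (m, n) a, 0, 0)"

definition qtorus_c0 :: "'a::zero qtorus" where "qtorus_c0 = (0, 1, 0)"

definition qtorus_c1 :: "'a::zero qtorus" where "qtorus_c1 = (0, 0, 1)"

definition star_mult ::
    "(int \<times> int \<Rightarrow>\<^sub>0 'a::ring) \<Rightarrow> (int \<times> int \<Rightarrow>\<^sub>0 'a) \<Rightarrow> (int \<times> int \<Rightarrow>\<^sub>0 'a)" where
  "star_mult = bilin_ext (\<lambda>(n, m) a (s, r) b.
     if n + m = r then Poly_Mapping.single (n + s, m) (a * b) else 0)"

definition star_form ::
    "('a::ring \<Rightarrow> 'a \<Rightarrow> complex) \<Rightarrow> (int \<times> int \<Rightarrow>\<^sub>0 'a) \<Rightarrow> (int \<times> int \<Rightarrow>\<^sub>0 'a) \<Rightarrow> complex" where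
  "star_form form = bilin_ext (\<lambda>(n, m) a (s, r) b.
     if n + s = 0 \<and> m + n = r then form a b else 0)"

definition star_bracket ::
    "(int \<times> int \<Rightarrow>\<^sub>0 'a::ring) \<Rightarrow> (int \<times> int \<Rightarrow>\<^sub>0 'a) \<Rightarrow> (int \<times> int \<Rightarrow>\<^sub>0 'a)" where
  "star_bracket p r = star_mult p r - star_mult r p"

text \<open>The pair \<open>(p, \<alpha>)\<close> is \<open>p + \<alpha> k\<close>.\<close>

type_synonym 'g affine = "(int \<Rightarrow>\<^sub>0 'g) \<times> complex"

definition affine_scale :: "(complex \<Rightarrow> 'g::zero \<Rightarrow> 'g) \<Rightarrow> complex \<Rightarrow> 'g affine \<Rightarrow> 'g affine" where
  "affine_scale sc c = (\<lambda>(p, \<alpha>). (pm_scale sc c p, c * \<alpha>))"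

definition affine_bracket ::
    "('g::ab_group_add \<Rightarrow> 'g \<Rightarrow> 'g) \<Rightarrow> ('g \<Rightarrow> 'g \<Rightarrow> complex) \<Rightarrow> 'g affine \<Rightarrow> 'g affine \<Rightarrow> 'g affine" where
  "affine_bracket br form = (\<lambda>(p, _) (p', _).
     bilin_ext (\<lambda>m a n b.
       (Poly_Mapping.single (m + n) (br a b),
        if m + n = 0 then of_int m * form a b else 0)) p p')"

definition affine_mono :: "'g::zero \<Rightarrow> int \<Rightarrow> 'g affine" where
  "affine_mono a n = (Poly_Mapping.single n a, 0)"

text \<open>The subalgebra \<open>\<gg> \<otimes> \<complex>[t] \<oplus> \<complex>k\<close> and its action on \<open>\<complex>\<^sub>\<l>\<close>.\<close>

definition affine_nonneg :: "'g::zero affine set" where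
  "affine_nonneg = {(p, \<alpha>) | p \<alpha>. Poly_Mapping.keys p \<subseteq> {0..}}"

definition level_action :: "complex \<Rightarrow> 'g affine \<Rightarrow> complex \<Rightarrow> complex" where
  "level_action l = (\<lambda>(p, \<alpha>) z. \<alpha> * l * z)"

definition lie_module ::
    "(complex \<Rightarrow> 'l::ab_group_add \<Rightarrow> 'l) \<Rightarrow> ('l \<Rightarrow> 'l \<Rightarrow> 'l) \<Rightarrow>
     (complex \<Rightarrow> 'w::ab_group_add \<Rightarrow> 'w) \<Rightarrow> ('l \<Rightarrow> 'w \<Rightarrow> 'w) \<Rightarrow> bool" where
  "lie_module scL br scW act \<longleftrightarrow>
     (\<forall>w. Vector_Spaces.linear scL scW (\<lambda>x. act x w)) \<and>
     (\<forall>x. Vector_Spaces.linear scW scW (act x)) \<and>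
     (\<forall>x y w. act (br x y) w = act x (act y w) - act y (act x w))"

text \<open>For a subalgebra \<open>B\<close> of a Lie algebra \<open>L\<close> and a \<open>B\<close>-module \<open>M\<close>, the space
  \<open>U(L) \<otimes>\<^bsub>U(B)\<^esub> M\<close> is the quotient of the vector space with basis the symbols
  \<open>x\<^sub>1 \<cdots> x\<^sub>n \<otimes> m\<close> (words in \<open>L\<close>, elements of \<open>M\<close>) by the subspace \<open>induced_relations\<close>. Its
  generators express, in this order: multilinearity of words, the relation \<open>x y - y x = [x, y]\<close>
  of \<open>U(L)\<close> inside any word, linearity in \<open>m\<close>, and balancedness over \<open>U(B)\<close>, which is spanned
  by the words in \<open>B\<close>.\<close>

definition word_tensor :: "'l list \<Rightarrow> 'm \<Rightarrow> ('l list \<times> 'm) \<Rightarrow>\<^sub>0 complex" where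
  "word_tensor xs m = Poly_Mapping.single (xs, m) 1"

definition induced_relations ::
    "(complex \<Rightarrow> 'l::ab_group_add \<Rightarrow> 'l) \<Rightarrow> ('l \<Rightarrow> 'l \<Rightarrow> 'l) \<Rightarrow> 'l set \<Rightarrow>
     (complex \<Rightarrow> 'm::ab_group_add \<Rightarrow> 'm) \<Rightarrow> ('l \<Rightarrow> 'm \<Rightarrow> 'm) \<Rightarrow> (('l list \<times> 'm) \<Rightarrow>\<^sub>0 complex) set" where
  "induced_relations scL br B scM actM = module.span (pm_scale (*))
     ({word_tensor (xs @ (x + y) # ys) m - word_tensor (xs @ x # ys) m - word_tensor (xs @ y # ys) m
         | xs x y ys m. True}
      \<union> {word_tensor (xs @ scL c x # ys) m - pm_scale (*) c (word_tensor (xs @ x # ys) m)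
         | xs c x ys m. True}
      \<union> {word_tensor (xs @ x # y # ys) m - word_tensor (xs @ y # x # ys) m
           - word_tensor (xs @ br x y # ys) m
         | xs x y ys m. True}
      \<union> {word_tensor xs (m + m') - word_tensor xs m - word_tensor xs m' | xs m m'. True}
      \<union> {word_tensor xs (scM c m) - pm_scale (*) c (word_tensor xs m) | xs c m. True}
      \<union> {word_tensor (xs @ bs) m - word_tensor xs (foldr actM bs m) | xs bs m. set bs \<subseteq> B})"

text \<open>For an \<open>L\<close>-module \<open>V\<close> and a map \<open>j\<close> from \<open>M\<close> to \<open>V\<close>, the linear map sending
  \<open>x\<^sub>1 \<cdots> x\<^sub>n \<otimes> m\<close> to \<open>x\<^sub>1 \<cdots> x\<^sub>n (j m)\<close>.\<close>

definition induced_map ::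
    "(complex \<Rightarrow> 'v::ab_group_add \<Rightarrow> 'v) \<Rightarrow> ('l \<Rightarrow> 'v \<Rightarrow> 'v) \<Rightarrow> ('m \<Rightarrow> 'v) \<Rightarrow>
     (('l list \<times> 'm) \<Rightarrow>\<^sub>0 complex) \<Rightarrow> 'v" where
  "induced_map scV act j p =
     (\<Sum>(xs, m)\<in>Poly_Mapping.keys p. scV (Poly_Mapping.lookup p (xs, m)) (foldr act xs (j m)))"

text \<open>The \<open>L\<close>-module \<open>V\<close> is \<open>U(L) \<otimes>\<^bsub>U(B)\<^esub> M\<close>, with \<open>1 \<otimes> m = j m\<close>: the quotient space described
  above is mapped bijectively onto \<open>V\<close>. The space is not realised on one fixed type since it
  depends on term parameters (the bracket, the action on \<open>M\<close>).\<close>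

definition is_induced_module ::
    "(complex \<Rightarrow> 'l::ab_group_add \<Rightarrow> 'l) \<Rightarrow> ('l \<Rightarrow> 'l \<Rightarrow> 'l) \<Rightarrow> 'l set \<Rightarrow>
     (complex \<Rightarrow> 'm::ab_group_add \<Rightarrow> 'm) \<Rightarrow> ('l \<Rightarrow> 'm \<Rightarrow> 'm) \<Rightarrow>
     (complex \<Rightarrow> 'v::ab_group_add \<Rightarrow> 'v) \<Rightarrow> ('l \<Rightarrow> 'v \<Rightarrow> 'v) \<Rightarrow> ('m \<Rightarrow> 'v) \<Rightarrow> bool" where
  "is_induced_module scL br B scM actM scV act j \<longleftrightarrow>
     lie_module scL br scV act \<and>
     range (induced_map scV act j) = UNIV \<and>
     {p. induced_map scV act j p = 0} = induced_relations scL br B scM actM"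

text \<open>A formal series in \<open>x\<close> is its coefficient function: \<open>F k\<close> is the coefficient of \<open>x^k\<close> (so
  the mode \<open>u\<^sub>n\<close> of a vertex operator is the coefficient of index \<open>- n - 1\<close>). For series in
  \<open>x\<^sub>0, x\<^sub>1, x\<^sub>2\<close>, \<open>F i j k\<close> is the coefficient of \<open>x\<^sub>0^i x\<^sub>1^j x\<^sub>2^k\<close>.\<close>

type_synonym 'w series1 = "int \<Rightarrow> 'w"
type_synonym 'w series3 = "int \<Rightarrow> int \<Rightarrow> int \<Rightarrow> 'w"

definition lower_truncated :: "'w::zero series1 \<Rightarrow> bool" where
  "lower_truncated F \<longleftrightarrow> (\<exists>N. \<forall>k<N. F k = 0)"

text \<open>Product of a scalar series with a vector-valued one. In each product below, every
  coefficient is a finite sum; \<open>Sum_any\<close> would return 0 for an infinite one.\<close>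

definition series_mult ::
    "(complex \<Rightarrow> 'w::comm_monoid_add \<Rightarrow> 'w) \<Rightarrow> complex series3 \<Rightarrow> 'w series3 \<Rightarrow> 'w series3" where
  "series_mult sc D F i j k =
     Sum_any (\<lambda>(a, b, c). sc (D a b c) (F (i - a) (j - b) (k - c)))"

text \<open>The coefficient of \<open>y^i z^j\<close> in \<open>(y - z)^n\<close>, expanded in nonnegative powers of \<open>z\<close>.\<close>

definition binom_coeff :: "int \<Rightarrow> int \<Rightarrow> int \<Rightarrow> complex" where
  "binom_coeff n i j =
     (if j \<ge> 0 \<and> i + j = n then (-1) ^ nat j * (of_int n gchoose nat j) else 0)"

text \<open>The series \<open>x\<^sub>0^(-1) \<delta>((x\<^sub>1 - x\<^sub>2)/x\<^sub>0)\<close>, \<open>x\<^sub>0^(-1) \<delta>((x\<^sub>2 - x\<^sub>1)/(-x\<^sub>0))\<close> and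
  \<open>x\<^sub>2^(-1) \<delta>((x\<^sub>1 - x\<^sub>0)/x\<^sub>2)\<close>. The \<open>n\<close>-th summand of \<open>\<delta>\<close> contributes \<open>x\<^sub>0^(-n-1)\<close> to the
  first two and \<open>x\<^sub>2^(-n-1)\<close> to the third.\<close>

definition delta_12_0 :: "complex series3" where
  "delta_12_0 i j k = binom_coeff (- i - 1) j k"

definition delta_21_0 :: "complex series3" where
  "delta_21_0 i j k = (-1) powi (- i - 1) * binom_coeff (- i - 1) k j"

definition delta_10_2 :: "complex series3" where
  "delta_10_2 i j k = binom_coeff (- k - 1) j i"

text \<open>Polynomials in \<open>x\<^sub>1, x\<^sub>2\<close>, the index \<open>(a, b)\<close> being the monomial \<open>x\<^sub>1^a x\<^sub>2^b\<close>.\<close>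

definition poly_series :: "(nat \<times> nat \<Rightarrow>\<^sub>0 complex) \<Rightarrow> complex series3" where
  "poly_series f i j k =
     (if i = 0 \<and> j \<ge> 0 \<and> k \<ge> 0 then Poly_Mapping.lookup f (nat j, nat k) else 0)"

text \<open>\<open>Y u k w\<close> is the coefficient of \<open>x^k\<close> in \<open>Y(u, x) w\<close>. \<open>linear_field_map\<close> says that \<open>YW\<close> is a
  linear map from \<open>V\<close> to \<open>Hom(W, W((x)))\<close>.\<close>

definition linear_field_map ::
    "(complex \<Rightarrow> 'v::ab_group_add \<Rightarrow> 'v) \<Rightarrow> (complex \<Rightarrow> 'w::ab_group_add \<Rightarrow> 'w) \<Rightarrow>
     ('v \<Rightarrow> int \<Rightarrow> 'w \<Rightarrow> 'w) \<Rightarrow> bool" where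
  "linear_field_map scV scW YW \<longleftrightarrow>
     (\<forall>k w. Vector_Spaces.linear scV scW (\<lambda>v. YW v k w)) \<and>
     (\<forall>v k. Vector_Spaces.linear scW scW (YW v k)) \<and>
     (\<forall>v w. lower_truncated (\<lambda>k. YW v k w))"

text \<open>The Jacobi identity for \<open>u, v\<close> on \<open>W\<close> multiplied by \<open>f(x\<^sub>1, x\<^sub>2)\<close>, applied to each
  vector \<open>w\<close>. The three inner series are those of \<open>YW(u,x\<^sub>1) YW(v,x\<^sub>2) w\<close>,
  \<open>YW(v,x\<^sub>2) YW(u,x\<^sub>1) w\<close> and \<open>YW(Y(u,x\<^sub>0) v, x\<^sub>2) w\<close>.\<close>

definition jacobi_identity ::
    "(complex \<Rightarrow> 'w::ab_group_add \<Rightarrow> 'w) \<Rightarrow> ('v \<Rightarrow> int \<Rightarrow> 'v \<Rightarrow> 'v) \<Rightarrow> ('v \<Rightarrow> int \<Rightarrow> 'w \<Rightarrow> 'w) \<Rightarrow>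
     (nat \<times> nat \<Rightarrow>\<^sub>0 complex) \<Rightarrow> 'v \<Rightarrow> 'v \<Rightarrow> bool" where
  "jacobi_identity scW Y YW f u v \<longleftrightarrow> (\<forall>w i j k.
     series_mult scW delta_12_0 (series_mult scW (poly_series f)
         (\<lambda>i j k. if i = 0 then YW u j (YW v k w) else 0)) i j k
     - series_mult scW delta_21_0 (series_mult scW (poly_series f)
         (\<lambda>i j k. if i = 0 then YW v k (YW u j w) else 0)) i j k
     = series_mult scW delta_10_2 (series_mult scW (poly_series f)
         (\<lambda>i j k. if j = 0 then YW (Y u i v) k w else 0)) i j k)"

definition vertex_algebra ::
    "(complex \<Rightarrow> 'v::ab_group_add \<Rightarrow> 'v) \<Rightarrow> ('v \<Rightarrow> int \<Rightarrow> 'v \<Rightarrow> 'v) \<Rightarrow> 'v \<Rightarrow> bool" where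
  "vertex_algebra scV Y vac \<longleftrightarrow>
     linear_field_map scV scV Y \<and>
     (\<forall>v k. Y vac k v = (if k = 0 then v else 0)) \<and>
     (\<forall>v. (\<forall>k<0. Y v k vac = 0) \<and> Y v 0 vac = v) \<and>
     (\<forall>u v. jacobi_identity scV Y Y 1 u v)"

definition quasi_module ::
    "(complex \<Rightarrow> 'v::ab_group_add \<Rightarrow> 'v) \<Rightarrow> ('v \<Rightarrow> int \<Rightarrow> 'v \<Rightarrow> 'v) \<Rightarrow> 'v \<Rightarrow>
     (complex \<Rightarrow> 'w::ab_group_add \<Rightarrow> 'w) \<Rightarrow> ('v \<Rightarrow> int \<Rightarrow> 'w \<Rightarrow> 'w) \<Rightarrow> bool" where
  "quasi_module scV Y vac scW YW \<longleftrightarrow>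
     linear_field_map scV scW YW \<and>
     (\<forall>w k. YW vac k w = (if k = 0 then w else 0)) \<and>
     (\<forall>u v. \<exists>f. f \<noteq> 0 \<and> jacobi_identity scW Y YW f u v)"

text \<open>The vertex algebra \<open>V(\<l>, 0)\<close> of the affine Lie algebra of \<open>\<gg>\<close>: the induced module, with
  \<open>1 \<otimes> z = z vac\<close>, carrying the vertex algebra structure determined by
  \<open>Y(a, x) = \<Sum>n. (a \<otimes> t^n) x^(-n-1)\<close>, where \<open>a\<close> is identified with \<open>(a \<otimes> t^(-1)) vac\<close>.\<close>

definition affine_vertex_algebra ::
    "(complex \<Rightarrow> 'g::ab_group_add \<Rightarrow> 'g) \<Rightarrow> ('g \<Rightarrow> 'g \<Rightarrow> 'g) \<Rightarrow> ('g \<Rightarrow> 'g \<Rightarrow> complex) \<Rightarrow> complex \<Rightarrow>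
     (complex \<Rightarrow> 'v::ab_group_add \<Rightarrow> 'v) \<Rightarrow> ('g affine \<Rightarrow> 'v \<Rightarrow> 'v) \<Rightarrow> ('v \<Rightarrow> int \<Rightarrow> 'v \<Rightarrow> 'v) \<Rightarrow> 'v \<Rightarrow> bool" where
  "affine_vertex_algebra sc br form l scV act Y vac \<longleftrightarrow>
     is_induced_module (affine_scale sc) (affine_bracket br form) affine_nonneg
       (*) (level_action l) scV act (\<lambda>z. scV z vac) \<and>
     vertex_algebra scV Y vac \<and>
     (\<forall>a k v. Y (act (affine_mono a (-1)) vac) k v = act (affine_mono a (- k - 1)) v)"

text \<open>The coefficient of \<open>x^k\<close> in \<open>X(a, n, x) w\<close>, and in \<open>q^n X(a, m, q^n x) w\<close>; in both, the last
  integer argument is the exponent \<open>k\<close>.\<close>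

definition X_series :: "('a::zero qtorus \<Rightarrow> 'w \<Rightarrow> 'w) \<Rightarrow> 'a \<Rightarrow> int \<Rightarrow> int \<Rightarrow> 'w \<Rightarrow> 'w" where
  "X_series act a n k w = act (qtorus_mono a (- k - 1) n) w"

definition Xbar_series ::
    "(complex \<Rightarrow> 'w \<Rightarrow> 'w) \<Rightarrow> complex \<Rightarrow> ('a::zero qtorus \<Rightarrow> 'w \<Rightarrow> 'w) \<Rightarrow> 'a \<Rightarrow> int \<Rightarrow> int \<Rightarrow> int \<Rightarrow> 'w \<Rightarrow> 'w" where
  "Xbar_series scW q act a m n k w = scW (q powi n * (q powi n) powi k) (X_series act a m k w)"

definition restricted_module :: "('a::zero qtorus \<Rightarrow> 'w::zero \<Rightarrow> 'w) \<Rightarrow> bool" where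
  "restricted_module act \<longleftrightarrow> (\<forall>a n w. lower_truncated (\<lambda>k. X_series act a n k w))"

end

theory Submission
  imports Defs "HOL-Computational_Algebra.Formal_Power_Series"
begin

text \<open>For two fields \<open>a, b\<close> on \<open>W\<close>, a vector \<open>w\<close> and a total degree, the products
  \<open>a(x\<^sub>1) b(x\<^sub>2) w\<close> and \<open>b(x\<^sub>2) a(x\<^sub>1) w\<close> are the expansions at \<open>z = \<infinity>\<close> and \<open>z = 0\<close> of one
  \<open>W\<close>-valued rational function of \<open>z = x\<^sub>1/x\<^sub>2\<close>. Its expansion at \<open>z = 1\<close>, with
  \<open>z = 1 + x\<^sub>0/x\<^sub>2\<close>, defines the product \<open>Y(a, x\<^sub>0) b\<close> of fields; the Jacobi identity, multiplied by
  a polynomial that clears the poles, compares the three expansions. Three fields give a rational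
  function of two variables; expanding it in different orders yields Dong's lemma and the Jacobi
  identity for the product of fields.

  For the fields \<open>X\<close>-bar of two elements of \<open>A\<^sub>*\<close> the poles lie at powers of \<open>q\<close>. Since \<open>q\<close> is not a
  root of unity, the pole at \<open>z = 1\<close> occurs exactly in the cases singled out by the Kronecker deltas of
  \<open>A\<^sub>*\<close>, and its singular part is given by the bracket and the form. Hence the fields generated from the
  identity form a module of level \<open>l\<close> for the affine Lie algebra, the universal property of the induced
  module maps \<open>V\<close> to it, and the Jacobi identities on both sides show that this map preserves products.

  For uniqueness, suppose that two structures agree on \<open>u\<close> and \<open>v\<close>. The difference \<open>D(x\<^sub>0, x\<^sub>2)\<close> of
  their series for \<open>Y(u, x\<^sub>0) v\<close> is killed by \<open>f(x\<^sub>0 + x\<^sub>2, x\<^sub>2)\<close> for a nonzero polynomial \<open>f\<close>, so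
  it vanishes.\<close>

section \<open>Expansions of rational functions\<close>

text \<open>In the existence part every denominator is a product of linear forms x_1 - r x_2. Being
  homogeneous, these never mix total degrees, so statements about two fields reduce to statements
  about vector-valued sequences in the single variable z.

  The fields attached to A_* have poles at powers of q, so on W a Jacobi identity can be expected
  only after multiplication by a polynomial. The products of such fields nevertheless satisfy an
  exact one: near the point where three arguments coincide, a factor such as z_1 - r becomes (1 - r)
  + y_1, a unit unless r = 1. The obstacle is that the iterated expansions lie in different spaces,
  W((y_1))((y_2)) and W((y_2))((y_1)). They are comparable only once all denominators are cleared,
  and a unit can be cancelled only inside one such space.

  The vertex algebra is not constructed but given through a presentation of its module, so the map
  to fields is obtained by checking relations. The polynomial of a quasi module is arbitrary, which
  is why uniqueness cannot rely on homogeneity.\<close>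

definition upper_truncated :: "(int \<Rightarrow> 'w::zero) \<Rightarrow> bool" where
  "upper_truncated F \<longleftrightarrow> (\<exists>N. \<forall>k>N. F k = 0)"

section \<open>Generalized binomial coefficients with integer arguments\<close>

definition ibinom :: "int \<Rightarrow> int \<Rightarrow> complex" where
  "ibinom m i = (if i < 0 then 0 else of_int m gchoose nat i)"

lemma ibinom_neg [simp]: "i < 0 \<Longrightarrow> ibinom m i = 0"
  by (simp add: ibinom_def)

lemma ibinom_0 [simp]: "ibinom m 0 = 1"
  by (simp add: ibinom_def)

lemma ibinom_Pascal: "ibinom (m + 1) i = ibinom m i + ibinom m (i - 1)"
proof (cases "i \<le> 0")
  case True
  then show ?thesis by (cases "i = 0") (auto simp: ibinom_def)
next
  case False
  define k where "k = nat (i - 1)"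
  have i: "nat i = Suc k" and "nat (i - 1) = k" using False by (auto simp: k_def)
  then show ?thesis
    using False gbinomial_Suc_Suc[of "of_int m :: complex" k] by (simp add: ibinom_def)
qed

lemma ibinom_of_nat: "ibinom (int m) (int i) = of_nat (m choose i)"
  by (simp add: ibinom_def binomial_gbinomial)

lemma ibinom_eq_0: "0 \<le> m \<Longrightarrow> m < i \<Longrightarrow> ibinom m i = 0"
  using ibinom_of_nat[of "nat m" "nat i"] by simp

lemma ibinom_zero_left: "ibinom 0 i = (if i = 0 then 1 else 0)"
  by (cases "i > 0") (auto simp: ibinom_eq_0)

lemma ibinom_symmetric: "0 \<le> m \<Longrightarrow> ibinom m i = ibinom m (m - i)"
proof (cases "0 \<le> i \<and> i \<le> m")
  case True
  then obtain k n where k: "i = int k" "m = int n" "k \<le> n"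
    by (metis nat_0_le nat_mono order_trans)
  have "ibinom m (m - i) = of_nat (n choose (n - k))"
    using k ibinom_of_nat[of n "n - k"] by (simp add: of_nat_diff)
  also have "\<dots> = of_nat (n choose k)"
    using binomial_symmetric[OF k(3)] by simp
  finally show ?thesis using k ibinom_of_nat by simp
next
  case False
  assume "0 \<le> m"
  then show ?thesis using False by (cases "i < 0") (auto simp: ibinom_eq_0)
qed

lemma minus_one_powi_Suc: "(-1 :: complex) powi (a + 1) = - ((-1) powi a)"
  by (simp add: power_int_add)

lemma ibinom_minus: "ibinom m i = (-1) powi i * ibinom (i - m - 1) i"
proof (cases "i < 0")
  case False
  then show ?thesis
    using gbinomial_negated_upper[of "of_int m :: complex" "nat i"]
    by (simp add: ibinom_def power_int_def algebra_simps)
qed simp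

text \<open>Terms outside {0..i} have a negative lower index and vanish; allowing any finite
  superset lets the identity apply to larger summation windows.\<close>

lemma ibinom_Vandermonde:
  assumes "finite A" and "{0..i} \<subseteq> A"
  shows "(\<Sum>n\<in>A. ibinom a (i - n) * ibinom b n) = ibinom (a + b) i"
proof (cases "i < 0")
  case True
  have "(\<Sum>n\<in>A. ibinom a (i - n) * ibinom b n) = 0"
    by (rule sum.neutral) (use True in \<open>auto simp: ibinom_def\<close>)
  then show ?thesis using True by simp
next
  case False
  have "(\<Sum>n\<in>A. ibinom a (i - n) * ibinom b n) = (\<Sum>n\<in>{0..i}. ibinom a (i - n) * ibinom b n)"
    using assms by (intro sum.mono_neutral_right) (auto simp: ibinom_def)
  also have "\<dots> = (\<Sum>k\<in>{0..nat i}. ibinom a (i - int k) * ibinom b (int k))"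
    by (rule sum.reindex_bij_witness[of _ int nat]) (use False in auto)
  also have "\<dots> = (\<Sum>k\<in>{0..nat i}. (of_int b gchoose k) * (of_int a gchoose (nat i - k)))"
    by (rule sum.cong) (use False in \<open>auto simp: ibinom_def nat_diff_distrib mult.commute\<close>)
  also have "\<dots> = ibinom (a + b) i"
    using False gbinomial_Vandermonde[of "of_int b :: complex" "of_int a" "nat i"]
    by (simp add: ibinom_def add.commute)
  finally show ?thesis .
qed

section \<open>Truncated sequences and finiteness of sums\<close>

lemma upper_truncated_Un:
  assumes "upper_truncated F" and "upper_truncated G"
  shows "\<exists>N. \<forall>k>N. F k = 0 \<and> G k = 0"
proof -
  obtain M N where "\<forall>k>M. F k = 0" "\<forall>k>N. G k = 0"
    using assms by (auto simp: upper_truncated_def)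
  then have "\<forall>k>max M N. F k = 0 \<and> G k = 0" by simp
  then show ?thesis ..
qed

lemma lower_truncated_Un:
  assumes "lower_truncated F" and "lower_truncated G"
  shows "\<exists>N. \<forall>k<N. F k = 0 \<and> G k = 0"
proof -
  obtain M N where "\<forall>k<M. F k = 0" "\<forall>k<N. G k = 0"
    using assms by (auto simp: lower_truncated_def)
  then have "\<forall>k<min M N. F k = 0 \<and> G k = 0" by simp
  then show ?thesis ..
qed

lemma int_set_subset_interval: "finite (A :: int set) \<Longrightarrow> \<exists>M N. A \<subseteq> {N..M}"
proof (induction A rule: finite_induct)
  case (insert x A)
  then obtain M N where "A \<subseteq> {N..M}" by blast
  then have "insert x A \<subseteq> {min N x..max M x}" by fastforce
  then show ?case by blast
qed simp

lemma finite_support_iff: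
  "finite {k::int. F k \<noteq> 0} \<longleftrightarrow> upper_truncated F \<and> lower_truncated F"
proof
  assume fin: "finite {k. F k \<noteq> 0}"
  then obtain M N where "{k. F k \<noteq> 0} \<subseteq> {N..M}"
    using int_set_subset_interval by blast
  then have "\<forall>k>M. F k = 0" "\<forall>k<N. F k = 0" by force+
  then show "upper_truncated F \<and> lower_truncated F"
    by (auto simp: upper_truncated_def lower_truncated_def)
next
  assume "upper_truncated F \<and> lower_truncated F"
  then obtain M N where "\<forall>k>M. F k = 0" "\<forall>k<N. F k = 0"
    by (auto simp: upper_truncated_def lower_truncated_def)
  then have "{k. F k \<noteq> 0} \<subseteq> {N..M}" by (auto simp: not_less[symmetric])
  then show "finite {k. F k \<noteq> 0}" by (rule finite_subset) simp
qed

lemma finite_product_support: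
  assumes "(lower_truncated k \<and> upper_truncated F) \<or> (upper_truncated k \<and> lower_truncated F)
     \<or> (upper_truncated F \<and> lower_truncated F)"
  shows "finite {m. (k::int \<Rightarrow> 'b::zero) m \<noteq> 0 \<and> F m \<noteq> 0}"
proof -
  have "\<exists>M N. \<forall>m. k m \<noteq> 0 \<and> F m \<noteq> 0 \<longrightarrow> N \<le> m \<and> m \<le> M"
    using assms unfolding lower_truncated_def upper_truncated_def
    by (elim disjE conjE exE) (meson not_less)+
  then obtain M N where "\<forall>m. k m \<noteq> 0 \<and> F m \<noteq> 0 \<longrightarrow> N \<le> m \<and> m \<le> M" by blast
  then have "{m. k m \<noteq> 0 \<and> F m \<noteq> 0} \<subseteq> {N..M}" by auto
  then show ?thesis by (rule finite_subset) simp
qed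

lemma upper_truncated_shift: "upper_truncated (\<lambda>i. F (i + c)) \<longleftrightarrow> upper_truncated F"
proof -
  have "upper_truncated (\<lambda>i. F (i + c))" if "upper_truncated F" for F :: "int \<Rightarrow> 'a" and c
  proof -
    from that obtain N where "\<forall>k>N. F k = 0" by (auto simp: upper_truncated_def)
    then have "\<forall>k>N - c. F (k + c) = 0" by auto
    then show ?thesis unfolding upper_truncated_def by blast
  qed
  from this[of F c] this[of "\<lambda>i. F (i + c)" "- c"] show ?thesis by auto
qed

lemma lower_truncated_shift: "lower_truncated (\<lambda>i. F (i + c)) \<longleftrightarrow> lower_truncated F"
proof -
  have "lower_truncated (\<lambda>i. F (i + c))" if "lower_truncated F" for F :: "int \<Rightarrow> 'a" and c
  proof -
    from that obtain N where "\<forall>k<N. F k = 0" by (auto simp: lower_truncated_def)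
    then have "\<forall>k<N - c. F (k + c) = 0" by auto
    then show ?thesis unfolding lower_truncated_def by blast
  qed
  from this[of F c] this[of "\<lambda>i. F (i + c)" "- c"] show ?thesis by auto
qed

lemma truncated_reflect:
  "upper_truncated (\<lambda>i. F (c - i)) \<longleftrightarrow> lower_truncated F"
  "lower_truncated (\<lambda>i. F (c - i)) \<longleftrightarrow> upper_truncated F"
proof -
  have A: "upper_truncated (\<lambda>i. F (c - i))" if "lower_truncated F" for F :: "int \<Rightarrow> 'a"
  proof -
    from that obtain N where "\<forall>k<N. F k = 0" by (auto simp: lower_truncated_def)
    then have "\<forall>k>c - N. F (c - k) = 0" by auto
    then show ?thesis unfolding upper_truncated_def by blast
  qed
  have B: "lower_truncated (\<lambda>i. F (c - i))" if "upper_truncated F" for F :: "int \<Rightarrow> 'a"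
  proof -
    from that obtain N where "\<forall>k>N. F k = 0" by (auto simp: upper_truncated_def)
    then have "\<forall>k<c - N. F (c - k) = 0" by auto
    then show ?thesis unfolding lower_truncated_def by blast
  qed
  show "upper_truncated (\<lambda>i. F (c - i)) \<longleftrightarrow> lower_truncated F"
    using A[of F] B[of "\<lambda>i. F (c - i)"] by auto
  show "lower_truncated (\<lambda>i. F (c - i)) \<longleftrightarrow> upper_truncated F"
    using B[of F] A[of "\<lambda>i. F (c - i)"] by auto
qed

lemma Sum_any_shift:
  fixes g :: "int \<Rightarrow> 'b::comm_monoid_add"
  shows "Sum_any (\<lambda>m. g (m + c)) = Sum_any g"
proof -
  have "bij (\<lambda>m::int. m + c)"
    by (rule bij_betw_byWitness[where f' = "\<lambda>m. m - c"]) auto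
  then show ?thesis by (rule Sum_any.reindex_cong[symmetric]) auto
qed

text \<open>The kernels by which the three sides of the Jacobi identity act on coefficient sequences: \<open>m\<close> is the
  exponent of \<open>x\<^sub>1\<close> (in \<open>jker3\<close>, of \<open>x\<^sub>0\<close>) in the inner series, of fixed total degree, and the
  result is the coefficient of \<open>x\<^sub>0^i x\<^sub>1^j\<close>.\<close>

definition jker1 :: "int \<Rightarrow> int \<Rightarrow> int \<Rightarrow> complex" where
  "jker1 i j m = (-1) powi (m - j - i - 1) * ibinom (- i - 1) (m - j - i - 1)"

definition jker2 :: "int \<Rightarrow> int \<Rightarrow> int \<Rightarrow> complex" where
  "jker2 i j m = (-1) powi (m - j - i - 1) * ibinom (- i - 1) (j - m)"

definition jker3 :: "int \<Rightarrow> int \<Rightarrow> int \<Rightarrow> complex" where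
  "jker3 i j m = ibinom (- j - 1) (i - m)"

lemma jker_truncated:
  "lower_truncated (jker1 i j)" "upper_truncated (jker2 i j)" "upper_truncated (jker3 i j)"
  unfolding lower_truncated_def upper_truncated_def jker1_def jker2_def jker3_def
  by (rule exI[of _ "j + i"] exI[of _ "j"] exI[of _ "i"]; auto)+

text \<open>Moving the summation index is multiplication of the inner series by z, which in the
  result lowers j. In \<open>jker3\<close> the variable is y = z - 1, so multiplication by z is the
  shift plus the identity.\<close>

lemma jker1_shift: "jker1 i j (m + 1) = jker1 i (j - 1) m"
  by (simp add: jker1_def algebra_simps)

lemma jker2_shift: "jker2 i j (m + 1) = jker2 i (j - 1) m"
  by (simp add: jker2_def algebra_simps)

lemma jker3_shift: "jker3 i j (m + 1) + jker3 i j m = jker3 i (j - 1) m"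
  using ibinom_Pascal[of "- j - 1" "i - m"] by (simp add: jker3_def algebra_simps)

text \<open>Each delta series satisfies x_1 - x_2 = x_0 on its support. Hence the factor z - 1
  lowers i and leaves j alone; for \<open>jker3\<close>, whose variable stands for x_0/x_2, this is
  a mere shift.\<close>

lemma jker1_diff: "jker1 i j (m + 1) - jker1 i j m = jker1 (i - 1) j m"
proof -
  define c where "c = m - j - i - 1"
  have "jker1 i j (m + 1) - jker1 i j m
      = (-1) powi (c + 1) * (ibinom (- i - 1) (c + 1) + ibinom (- i - 1) c)"
  proof -
    have "m + 1 - j - i - 1 = c + 1" by (simp add: c_def)
    then show ?thesis
      by (simp only: jker1_def c_def[symmetric] minus_one_powi_Suc) (simp add: algebra_simps)
  qed
  also have "ibinom (- i - 1) (c + 1) + ibinom (- i - 1) c = ibinom (- i) (c + 1)"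
    using ibinom_Pascal[of "- i - 1" "c + 1"] by simp
  finally show ?thesis by (simp add: jker1_def c_def algebra_simps)
qed

lemma jker2_diff: "jker2 i j (m + 1) - jker2 i j m = jker2 (i - 1) j m"
proof -
  define c where "c = m - j - i - 1"
  have "jker2 i j (m + 1) - jker2 i j m
      = (-1) powi (c + 1) * (ibinom (- i - 1) (j - m - 1) + ibinom (- i - 1) (j - m))"
  proof -
    have "m + 1 - j - i - 1 = c + 1" "j - (m + 1) = j - m - 1" by (auto simp: c_def)
    then show ?thesis
      by (simp only: jker2_def c_def[symmetric] minus_one_powi_Suc) (simp add: algebra_simps)
  qed
  also have "ibinom (- i - 1) (j - m - 1) + ibinom (- i - 1) (j - m) = ibinom (- i) (j - m)"
    using ibinom_Pascal[of "- i - 1" "j - m"] by simp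
  finally show ?thesis by (simp add: jker2_def c_def algebra_simps)
qed

lemma jker3_diff: "jker3 i j (m + 1) = jker3 (i - 1) j m"
  by (simp add: jker3_def algebra_simps)

text \<open>This is the three-term identity of delta functions tested on the monomial z^m. For i >=
  0 at most one of the two kernels contributes, according to the sign of \<open>t\<close>. For i < 0
  the exponent of x_1 - x_2 is nonnegative, so both expansions agree and the right-hand side is
  0.\<close>

lemma jker_delta: "jker1 i j m - jker2 i j m = ibinom (m - j - 1) i"
proof -
  define t where "t = m - j - 1"
  have c: "m - j - i - 1 = t - i" "j - m = - 1 - t" by (auto simp: t_def)
  have eq: "jker1 i j m - jker2 i j m
      = (-1) powi (t - i) * (ibinom (- i - 1) (t - i) - ibinom (- i - 1) (- 1 - t))"
    by (simp only: jker1_def jker2_def c right_diff_distrib)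
  show ?thesis
  proof (cases "i \<ge> 0")
    case True
    show ?thesis
    proof (cases "t \<ge> 0")
      case t: True
      have "ibinom t (t - i) = (-1) powi (t - i) * ibinom (- i - 1) (t - i)"
        using ibinom_minus[of t "t - i"] by simp
      then show ?thesis using t eq ibinom_symmetric[of t i] by (simp add: t_def)
    next
      case t: False
      have "ibinom (- i - 1) (- 1 - t) = (-1) powi (- 1 - t) * ibinom (i - 1 - t) (- 1 - t)"
        using ibinom_minus[of "- i - 1" "- 1 - t"] by (simp add: algebra_simps)
      also have "ibinom (i - 1 - t) (- 1 - t) = ibinom (i - 1 - t) i"
        using ibinom_symmetric[of "i - 1 - t" i] t True by simp
      also have "ibinom (i - 1 - t) i = (-1) powi i * ibinom t i"
        using ibinom_minus[of "i - 1 - t" i] by (simp add: algebra_simps)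
      finally have *: "ibinom (- i - 1) (- 1 - t) = (-1) powi (- 1 - t) * ((-1) powi i * ibinom t i)" .
      have "(-1 :: complex) powi (t - i) * ((-1) powi (- 1 - t) * (-1) powi i) = -1"
        by (simp add: power_int_add[symmetric])
      then have "(-1) powi (t - i) * ibinom (- i - 1) (- 1 - t) = - ibinom t i"
        unfolding * by (metis mult.assoc mult_minus1)
      moreover have "ibinom (- i - 1) (t - i) = 0" using t True by simp
      ultimately show ?thesis using eq by (simp add: t_def right_diff_distrib)
    qed
  next
    case False
    have "ibinom (- i - 1) (t - i) = ibinom (- i - 1) (- 1 - t)"
      using ibinom_symmetric[of "- i - 1" "t - i"] False by simp
    then show ?thesis using eq False by simp
  qed
qed

section \<open>Multiplication by linear factors in one variable\<close>

locale cspace = vector_space scale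
  for scale :: "complex \<Rightarrow> 'w::ab_group_add \<Rightarrow> 'w"  (infixr "*s" 75)
begin

definition pairing :: "(int \<Rightarrow> complex) \<Rightarrow> (int \<Rightarrow> 'w) \<Rightarrow> 'w" where
  "pairing k F = Sum_any (\<lambda>m. k m *s F m)"

text \<open>Three reasons for the sum in \<open>pairing\<close> to be finite: kernel and sequence
  are truncated on opposite sides (two cases), or the sequence itself has finite support.\<close>

definition compat :: "(int \<Rightarrow> complex) \<Rightarrow> (int \<Rightarrow> 'w) \<Rightarrow> bool" where
  "compat k F \<longleftrightarrow> (lower_truncated k \<and> upper_truncated F) \<or> (upper_truncated k \<and> lower_truncated F)
     \<or> (upper_truncated F \<and> lower_truncated F)"

lemma compat_finite: "compat k F \<Longrightarrow> finite {m. k m *s F m \<noteq> 0}"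
proof -
  assume "compat k F"
  then have "finite {m. k m \<noteq> 0 \<and> F m \<noteq> 0}"
    unfolding compat_def by (rule finite_product_support)
  then show ?thesis by (rule rev_finite_subset) auto
qed

lemma pairing_eq_sum: "finite A \<Longrightarrow> {m. k m \<noteq> 0 \<and> F m \<noteq> 0} \<subseteq> A \<Longrightarrow> pairing k F = (\<Sum>m\<in>A. k m *s F m)"
  unfolding pairing_def by (rule Sum_any.expand_superset) auto

lemma pairing_add: "compat k F \<Longrightarrow> compat k G \<Longrightarrow> pairing k (\<lambda>m. F m + G m) = pairing k F + pairing k G"
  unfolding pairing_def scale_right_distrib by (intro Sum_any.distrib compat_finite)

lemma pairing_scale: "compat k F \<Longrightarrow> pairing k (\<lambda>m. c *s F m) = c *s pairing k F"
proof -
  assume "compat k F"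
  then have fin: "finite {m. k m \<noteq> 0 \<and> F m \<noteq> 0}"
    unfolding compat_def by (rule finite_product_support)
  have "pairing k (\<lambda>m. c *s F m) = (\<Sum>m\<in>{m. k m \<noteq> 0 \<and> F m \<noteq> 0}. k m *s c *s F m)"
    by (rule pairing_eq_sum[OF fin]) auto
  also have "\<dots> = c *s pairing k F"
    using pairing_eq_sum[OF fin order_refl] by (simp add: scale_sum_right mult.commute)
  finally show ?thesis .
qed

lemma upper_truncated_add: "upper_truncated F \<Longrightarrow> upper_truncated G \<Longrightarrow> upper_truncated (\<lambda>m. a *s F m + b *s G m)"
  using upper_truncated_Un[of F G] unfolding upper_truncated_def by fastforce

lemma lower_truncated_add: "lower_truncated F \<Longrightarrow> lower_truncated G \<Longrightarrow> lower_truncated (\<lambda>m. a *s F m + b *s G m)"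
  using lower_truncated_Un[of F G] unfolding lower_truncated_def by fastforce

lemma compat_scale: "compat k F \<Longrightarrow> compat k (\<lambda>m. c *s F m)"
  using upper_truncated_add[of F F c 0] lower_truncated_add[of F F c 0] by (auto simp: compat_def)

text \<open>Multiplication by \<open>z - r\<close>. After the substitution \<open>z = 1 + y\<close> it becomes \<open>lin (r - 1)\<close>.\<close>

definition lin :: "complex \<Rightarrow> (int \<Rightarrow> 'w) \<Rightarrow> int \<Rightarrow> 'w" where
  "lin r F = (\<lambda>i. F (i - 1) - r *s F i)"

definition lins :: "complex list \<Rightarrow> (int \<Rightarrow> 'w) \<Rightarrow> int \<Rightarrow> 'w" where
  "lins rs F = foldr lin rs F"

lemma lins_Nil [simp]: "lins [] F = F"
  and lins_Cons: "lins (r # rs) F = lin r (lins rs F)"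
  and lins_append: "lins (rs @ ss) F = lins rs (lins ss F)"
  by (simp_all add: lins_def)

lemma lin_commute: "lin r (lin s F) = lin s (lin r F)"
  by (rule ext) (simp add: lin_def algebra_simps)

lemma lins_lin: "lins rs (lin r F) = lin r (lins rs F)"
  by (induction rs) (simp_all add: lins_Cons lin_commute)

lemma lins_commute: "lins rs (lins ss F) = lins ss (lins rs F)"
  by (induction rs arbitrary: F) (simp_all add: lins_Cons lins_lin)

lemma lin_comb: "lin r (\<lambda>i. a *s F i + b *s G i) = (\<lambda>i. a *s lin r F i + b *s lin r G i)"
  by (rule ext) (simp add: lin_def algebra_simps)

lemma lins_comb: "lins rs (\<lambda>i. a *s F i + b *s G i) = (\<lambda>i. a *s lins rs F i + b *s lins rs G i)"
  by (induction rs) (simp_all add: lins_Cons lin_comb)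

lemma lins_diff: "lins rs (\<lambda>i. F i - G i) = (\<lambda>i. lins rs F i - lins rs G i)"
  using lins_comb[of rs 1 F "-1" G] by simp

lemma lins_zero [simp]: "lins rs (\<lambda>i. 0) = (\<lambda>i. 0)"
  using lins_comb[of rs 0 "\<lambda>_. 0" 0 "\<lambda>_. 0"] by simp

lemma upper_truncated_lin: "upper_truncated F \<Longrightarrow> upper_truncated (lin r F)"
  using upper_truncated_add[of "\<lambda>i. F (i - 1)" F 1 "- r"] upper_truncated_shift[of F "- 1"]
  by (simp add: lin_def)

lemma lower_truncated_lin: "lower_truncated F \<Longrightarrow> lower_truncated (lin r F)"
  using lower_truncated_add[of "\<lambda>i. F (i - 1)" F 1 "- r"] lower_truncated_shift[of F "- 1"]
  by (simp add: lin_def)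

lemma upper_truncated_lins: "upper_truncated F \<Longrightarrow> upper_truncated (lins rs F)"
  by (induction rs) (simp_all add: lins_Cons upper_truncated_lin)

lemma lower_truncated_lins: "lower_truncated F \<Longrightarrow> lower_truncated (lins rs F)"
  by (induction rs) (simp_all add: lins_Cons lower_truncated_lin)

lemma compat_shift: "compat k F \<Longrightarrow> compat (\<lambda>m. k (m + 1)) F \<and> compat k (\<lambda>m. F (m - 1))"
proof -
  have "upper_truncated (\<lambda>m. F (m - 1)) = upper_truncated F"
    "lower_truncated (\<lambda>m. F (m - 1)) = lower_truncated F"
    using upper_truncated_shift[of F "-1"] lower_truncated_shift[of F "-1"] by simp_all
  then show "compat k F \<Longrightarrow> ?thesis"
    by (simp add: compat_def upper_truncated_shift lower_truncated_shift)
qed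

lemma pairing_lin:
  assumes "compat k F"
  shows "pairing k (lin r F) = pairing (\<lambda>m. k (m + 1)) F - r *s pairing k F"
proof -
  have c: "compat k (\<lambda>m. F (m - 1))" "compat k (\<lambda>m. - r *s F m)"
    using compat_shift[OF assms] compat_scale[OF assms, of "- r"] by simp_all
  have "pairing k (lin r F) = pairing k (\<lambda>m. F (m - 1) + (- r) *s F m)"
    by (simp add: lin_def)
  also have "\<dots> = pairing k (\<lambda>m. F (m - 1)) + (- r) *s pairing k F"
    using pairing_add[OF c] pairing_scale[OF assms, of "- r"] by simp
  also have "pairing k (\<lambda>m. F (m - 1)) = pairing (\<lambda>m. k (m + 1)) F"
    unfolding pairing_def using Sum_any_shift[of "\<lambda>m. k m *s F (m - 1)" 1] by simp
  finally show ?thesis by simp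
qed

lemma lin_upper_eq_0:
  assumes "upper_truncated F" and "lin r F = (\<lambda>_. 0)"
  shows "F = (\<lambda>_. 0)"
proof -
  obtain N where N: "\<forall>k>N. F k = 0" using assms by (auto simp: upper_truncated_def)
  have rec: "F (i - 1) = r *s F i" for i
    using fun_cong[OF assms(2), of i] by (simp add: lin_def)
  have "F (N - int n) = 0 \<and> F (N + 1 - int n) = 0" for n
  proof (induction n)
    case 0
    then show ?case using N rec[of "N + 1"] by simp
  next
    case (Suc n)
    then show ?case using rec[of "N - int n"] by (simp add: algebra_simps)
  qed
  then have "F (N - int (nat (N - i))) = 0" for i by blast
  then have "F i = 0" for i
    using N by (cases "i > N") (auto split: if_splits, smt (verit))
  then show ?thesis by auto
qed

text \<open>For r /= 0 the factor z - r is a unit among power series in z and preserves the order of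
  vanishing; for r = 0 it is z and raises the order by one. Iterated, this bounds pole
  orders.\<close>

lemma lin_eq_0_below:
  assumes "lower_truncated F" and "\<And>i. i < M \<Longrightarrow> lin r F i = 0"
  shows "\<And>i. i < M - 1 \<Longrightarrow> F i = 0" and "\<And>i. r \<noteq> 0 \<Longrightarrow> i < M \<Longrightarrow> F i = 0"
proof -
  obtain N where N: "\<forall>k<N. F k = 0" using assms by (auto simp: lower_truncated_def)
  show *: "F i = 0" if "r \<noteq> 0" "i < M" for i
  proof -
    have "F (N - 1 + int n) = 0" if "N - 1 + int n < M" for n using that
    proof (induction n)
      case (Suc n)
      have "F (N + int n - 1) = 0" using Suc by (simp add: algebra_simps)
      then show ?case using Suc assms(2)[of "N + int n"] \<open>r \<noteq> 0\<close> by (simp add: lin_def)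
    qed (use N in simp)
    from this[of "nat (i - N + 1)"] show ?thesis using that N
      by (cases "i < N") auto
  qed
  show "F i = 0" if "i < M - 1" for i
    using * that assms(2)[of "i + 1"] by (cases "r = 0") (auto simp: lin_def)
qed

lemma lin_lower_eq_0:
  assumes "lower_truncated F" and "lin r F = (\<lambda>_. 0)"
  shows "F = (\<lambda>_. 0)"
proof (rule ext)
  fix i show "F i = 0" using lin_eq_0_below(1)[OF assms(1), of "i + 2" r i] assms(2) by simp
qed

lemma lins_upper_eq_0: "upper_truncated F \<Longrightarrow> lins rs F = (\<lambda>_. 0) \<Longrightarrow> F = (\<lambda>_. 0)"
  by (induction rs) (auto simp: lins_Cons intro: lin_upper_eq_0 upper_truncated_lins)

lemma lins_lower_eq_0: "lower_truncated F \<Longrightarrow> lins rs F = (\<lambda>_. 0) \<Longrightarrow> F = (\<lambda>_. 0)"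
  by (induction rs) (auto simp: lins_Cons intro: lin_lower_eq_0 lower_truncated_lins)

lemma upper_truncated_diff: "upper_truncated (F :: int \<Rightarrow> 'w) \<Longrightarrow> upper_truncated G \<Longrightarrow> upper_truncated (\<lambda>m. F m - G m)"
  using upper_truncated_add[of F G 1 "-1"] by simp

lemma lower_truncated_diff: "lower_truncated (F :: int \<Rightarrow> 'w) \<Longrightarrow> lower_truncated G \<Longrightarrow> lower_truncated (\<lambda>m. F m - G m)"
  using lower_truncated_add[of F G 1 "-1"] by simp

lemma lins_lower_cancel:
  "lower_truncated F \<Longrightarrow> lower_truncated G \<Longrightarrow> lins rs F = lins rs G \<Longrightarrow> F = G"
  using lins_lower_eq_0[of "\<lambda>i. F i - G i" rs] by (auto simp: lins_diff lower_truncated_diff fun_eq_iff)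

lemma lins_eq_0_below:
  assumes "lower_truncated F" and "\<And>i. i < M \<Longrightarrow> lins rs F i = 0"
  shows "i < M - int (length rs) \<Longrightarrow> F i = 0" and "0 \<notin> set rs \<Longrightarrow> i < M \<Longrightarrow> F i = 0"
proof -
  have "(\<forall>i. i < M - int (length rs) \<longrightarrow> F i = 0) \<and> (0 \<notin> set rs \<longrightarrow> (\<forall>i. i < M \<longrightarrow> F i = 0))"
    using assms
  proof (induction rs arbitrary: M)
    case (Cons r rs)
    have "lower_truncated (lins rs F)" by (simp add: Cons.prems lower_truncated_lins)
    note * = lin_eq_0_below[OF this, of M r]
    have 1: "lins rs F i = 0" if "i < M - 1" for i
      using *(1)[OF _ that] Cons.prems(2) by (simp add: lins_Cons)
    have 2: "r \<noteq> 0 \<Longrightarrow> lins rs F i = 0" if "i < M" for i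
      using *(2)[OF _ _ that] Cons.prems(2) by (simp add: lins_Cons)
    show ?case
    proof (intro conjI allI impI)
      fix i assume "i < M - int (length (r # rs))"
      then show "F i = 0"
        using conjunct1[OF Cons.IH[OF Cons.prems(1), of "M - 1"]] 1 by simp
    next
      fix i assume "0 \<notin> set (r # rs)" "i < M"
      then show "F i = 0"
        using conjunct2[OF Cons.IH[OF Cons.prems(1), of M]] 2 by simp
    qed
  qed simp
  then show "i < M - int (length rs) \<Longrightarrow> F i = 0" and "0 \<notin> set rs \<Longrightarrow> i < M \<Longrightarrow> F i = 0" by auto
qed

lemma lin_solve_lower:
  assumes "lower_truncated E"
  shows "\<exists>F. lower_truncated F \<and> lin r F = E"
proof (cases "r = 0")
  case True
  have "lower_truncated (\<lambda>i. E (i + 1))" using assms by (simp add: lower_truncated_shift)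
  then show ?thesis using True by (intro exI[of _ "\<lambda>i. E (i + 1)"]) (simp add: lin_def)
next
  case False
  obtain M where M: "\<forall>k<M. E k = 0" using assms by (auto simp: lower_truncated_def)
  \<comment> \<open>\<open>g n\<close> will be the coefficient of index M - 1 + n: the equation F (i
    - 1) - r F i = E i is solved upwards for F i, starting from 0 below M.\<close>
  define g where "g = rec_nat (0::'w) (\<lambda>n x. (1/r) *s (x - E (M + int n)))"
  define F where "F i = (if i < M then 0 else g (nat (i - M + 1)))" for i
  have g: "g 0 = 0" "g (Suc n) = (1/r) *s (g n - E (M + int n))" for n
    by (simp_all add: g_def)
  have "lin r F i = E i" for i
  proof (cases "i < M")
    case True
    then show ?thesis using M by (simp add: lin_def F_def)
  next
    case i: False
    then obtain n where n: "i = M + int n" by (metis linorder_not_less zle_iff_zadd)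
    have a: "nat (i - M + 1) = Suc n" using n by simp
    have b: "F (i - 1) = g n"
    proof -
      have "nat (i - 1 - M + 1) = n" "i - 1 < M \<longleftrightarrow> n = 0" using n by auto
      then show ?thesis using g(1) by (simp only: F_def split: if_split) auto
    qed
    have c: "F i = g (Suc n)" using i a by (simp add: F_def)
    have "lin r F i = g n - r *s g (Suc n)" by (simp only: lin_def b c)
    then show ?thesis using False by (simp add: g(2) n)
  qed
  moreover have "lower_truncated F" by (auto simp: lower_truncated_def F_def)
  ultimately show ?thesis by blast
qed

lemma lins_solve_lower: "lower_truncated E \<Longrightarrow> \<exists>F. lower_truncated F \<and> lins rs F = E"
proof (induction rs arbitrary: E)
  case (Cons r rs)
  obtain G where "lower_truncated G" "lin r G = E" using lin_solve_lower[OF Cons.prems] by blast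
  moreover obtain F where "lower_truncated F" "lins rs F = G" using Cons.IH[OF \<open>lower_truncated G\<close>] by blast
  ultimately show ?case by (auto simp: lins_Cons)
qed auto

text \<open>The Taylor expansion at \<open>z = 1\<close> of a Laurent polynomial.\<close>

definition tay :: "(int \<Rightarrow> 'w) \<Rightarrow> int \<Rightarrow> 'w" where
  "tay H i = pairing (\<lambda>m. ibinom m i) H"

lemma compat_fin: "upper_truncated H \<Longrightarrow> lower_truncated H \<Longrightarrow> compat k H"
  by (simp add: compat_def)

lemma tay_neg: "i < 0 \<Longrightarrow> tay H i = 0"
  by (simp add: tay_def pairing_def)

lemma lower_truncated_tay: "lower_truncated (tay H)"
  by (auto simp: lower_truncated_def intro!: exI[of _ 0] tay_neg)

lemma tay_zero [simp]: "tay (\<lambda>_. 0) = (\<lambda>_. 0)"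
  by (rule ext) (simp add: tay_def pairing_def)

lemma pairing_kernel_add:
  assumes "finite {m. F m \<noteq> 0}"
  shows "pairing (\<lambda>m. k m + l m) F = pairing k F + pairing l F"
  using assms pairing_eq_sum[OF assms, of _ F]
  by (subst (1 2 3) pairing_eq_sum[OF assms]) (auto simp: scale_left_distrib sum.distrib)

lemma tay_lin:
  assumes "upper_truncated H" "lower_truncated H"
  shows "tay (lin r H) = lin (r - 1) (tay H)"
proof (rule ext)
  fix i
  have fin: "finite {m. H m \<noteq> 0}" using assms by (simp add: finite_support_iff)
  have "tay (lin r H) i = pairing (\<lambda>m. ibinom (m + 1) i) H - r *s tay H i"
    unfolding tay_def using assms by (intro pairing_lin compat_fin)
  also have "pairing (\<lambda>m. ibinom (m + 1) i) H = tay H i + tay H (i - 1)"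
    unfolding ibinom_Pascal tay_def by (rule pairing_kernel_add[OF fin])
  finally show "tay (lin r H) i = lin (r - 1) (tay H) i" by (simp add: lin_def algebra_simps)
qed

lemma tay_lins:
  assumes "upper_truncated H" "lower_truncated H"
  shows "tay (lins rs H) = lins (map (\<lambda>r. r - 1) rs) (tay H)"
  by (induction rs) (simp_all add: lins_Cons tay_lin assms upper_truncated_lins lower_truncated_lins)

lemma tay_comb:
  assumes "upper_truncated F" "lower_truncated F" "upper_truncated G" "lower_truncated G"
  shows "tay (\<lambda>i. a *s F i + b *s G i) = (\<lambda>i. a *s tay F i + b *s tay G i)"
proof (rule ext)
  fix i
  have "upper_truncated (\<lambda>i. c *s F i)" "lower_truncated (\<lambda>i. c *s F i)"
    if "upper_truncated F" "lower_truncated F" for F :: "int \<Rightarrow> 'w" and c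
    using that upper_truncated_add[of F F c 0] lower_truncated_add[of F F c 0] by auto
  note this[OF assms(1,2), of a] this[OF assms(3,4), of b]
  then show "tay (\<lambda>i. a *s F i + b *s G i) i = a *s tay F i + b *s tay G i"
    unfolding tay_def using assms
    by (subst pairing_add) (simp_all add: pairing_scale compat_fin)
qed

text \<open>\<open>F\<close>, \<open>G\<close>, \<open>C\<close> are the expansions at \<open>\<infinity>\<close>, \<open>0\<close> and \<open>1\<close> of one rational function whose
  denominator is the product of the \<open>z - r\<close> for \<open>r\<close> in \<open>rs\<close>.\<close>

definition expansions :: "complex list \<Rightarrow> (int \<Rightarrow> 'w) \<Rightarrow> (int \<Rightarrow> 'w) \<Rightarrow> (int \<Rightarrow> 'w) \<Rightarrow> bool" where
  "expansions rs F G C \<longleftrightarrow> upper_truncated F \<and> lower_truncated G \<and> lower_truncated C \<and>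
     lins rs F = lins rs G \<and> lins (map (\<lambda>r. r - 1) rs) C = tay (lins rs F)"

lemma expansions_lins_truncated:
  assumes "upper_truncated F" "lower_truncated G" "lins rs F = lins rs G"
  shows "upper_truncated (lins rs F)" "lower_truncated (lins rs F)"
  using assms upper_truncated_lins[of F rs] lower_truncated_lins[of G rs] by auto

lemma expansions_append:
  assumes "expansions rs F G C"
  shows "expansions (ss @ rs) F G C"
  using assms expansions_lins_truncated[of F G rs]
  unfolding expansions_def by (simp add: lins_append tay_lins)

lemma expansions_append':
  assumes "expansions rs F G C"
  shows "expansions (rs @ ss) F G C"
proof -
  have "expansions (ss @ rs) F G C" using assms by (rule expansions_append)
  then show ?thesis unfolding expansions_def by (simp add: lins_append lins_commute[of rs ss]
    lins_commute[of "map (\<lambda>r. r - 1) rs" "map (\<lambda>r. r - 1) ss"])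
qed

text \<open>Over the common denominator \<open>ss @ rs\<close> both candidates satisfy the same
  equations, and linear factors are injective on lower truncated sequences. So the expansion at
  infinity alone determines the other two, whatever denominators are chosen.\<close>

lemma expansions_unique:
  assumes "expansions rs F G C" "expansions ss F G' C'"
  shows "C = C'" "G = G'"
proof -
  have 1: "expansions (ss @ rs) F G C" using assms(1) by (rule expansions_append)
  have 2: "expansions (ss @ rs) F G' C'" using assms(2) by (rule expansions_append')
  show "C = C'" "G = G'"
    using 1 2 lins_lower_cancel[of C C' "map (\<lambda>r. r - 1) (ss @ rs)"] lins_lower_cancel[of G G' "ss @ rs"]
    unfolding expansions_def by auto
qed

lemma expansions_exists:
  assumes "upper_truncated F" "lower_truncated G" "lins rs F = lins rs G"
  shows "\<exists>C. expansions rs F G C"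
  using lins_solve_lower[OF lower_truncated_tay[of "lins rs F"], of "map (\<lambda>r. r - 1) rs"] assms
  unfolding expansions_def by auto

lemma expansions_comb:
  assumes "expansions rs F G C" "expansions ss F' G' C'"
  shows "expansions (rs @ ss) (\<lambda>i. a *s F i + b *s F' i) (\<lambda>i. a *s G i + b *s G' i)
     (\<lambda>i. a *s C i + b *s C' i)"
proof -
  have 1: "expansions (rs @ ss) F G C" using assms(1) by (rule expansions_append')
  have 2: "expansions (rs @ ss) F' G' C'" using assms(2) by (rule expansions_append)
  show ?thesis
    using 1 2 expansions_lins_truncated[of F G "rs @ ss"] expansions_lins_truncated[of F' G' "rs @ ss"]
    unfolding expansions_def
    by (simp add: lins_comb tay_comb upper_truncated_add lower_truncated_add)
qed

lemma expansions_lin: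
  assumes "expansions rs F G C"
  shows "expansions rs (lin r F) (lin r G) (lin (r - 1) C)"
  using assms expansions_lins_truncated[of F G rs] unfolding expansions_def
  by (simp add: lins_lin upper_truncated_lin lower_truncated_lin tay_lin)

lemma expansions_finite:
  assumes "upper_truncated H" "lower_truncated H"
  shows "expansions [] H H (tay H)"
  using assms by (simp add: expansions_def lower_truncated_tay)

text \<open>A sequence truncated on both sides is a Laurent polynomial, for which the empty
  denominator is also valid; uniqueness does the rest. In this way a cleared series loses its formal
  denominator.\<close>

lemma expansions_finite_eq:
  assumes "expansions rs F G C" "lower_truncated F"
  shows "C = tay F"
  using expansions_unique[OF assms(1) expansions_finite] assms by (simp add: expansions_def)

text \<open>The cleared series is a Taylor series at 1, without negative terms. Each factor accounts
  for at most one order of the pole, and only z - 1 fails to be a unit there.\<close>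

lemma expansions_below:
  assumes "expansions rs F G C"
  shows "i < - int (length rs) \<Longrightarrow> C i = 0" and "1 \<notin> set rs \<Longrightarrow> i < 0 \<Longrightarrow> C i = 0"
proof -
  have *: "lower_truncated C" "\<And>i. i < 0 \<Longrightarrow> lins (map (\<lambda>r. r - 1) rs) C i = 0"
    using assms by (auto simp: expansions_def tay_neg)
  show "i < - int (length rs) \<Longrightarrow> C i = 0" using lins_eq_0_below(1)[OF *] by simp
  show "1 \<notin> set rs \<Longrightarrow> i < 0 \<Longrightarrow> C i = 0" using lins_eq_0_below(2)[OF *, of 0 i] by force
qed

lemma expansions_strip_Cons:
  assumes "expansions rs (lin r F) (lin r G) (lin (r - 1) C)"
    "upper_truncated F" "lower_truncated G" "lower_truncated C"
  shows "expansions (r # rs) F G C"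
  using assms unfolding expansions_def by (simp add: lins_Cons lins_lin)

text \<open>The coefficient of x_0^i x_1^j in the left side minus the right side of the Jacobi
  identity, where \<open>F\<close>, \<open>G\<close>, \<open>C\<close> are the slices of the three
  inner series in one total degree.\<close>

definition jacobi_defect :: "(int \<Rightarrow> 'w) \<Rightarrow> (int \<Rightarrow> 'w) \<Rightarrow> (int \<Rightarrow> 'w) \<Rightarrow> int \<Rightarrow> int \<Rightarrow> 'w" where
  "jacobi_defect F G C i j =
     pairing (jker1 i j) F - pairing (jker2 i j) G - pairing (jker3 i j) C"

lemma pairing_jker3_lin:
  assumes "lower_truncated C"
  shows "pairing (jker3 i j) (lin 0 C) = pairing (jker3 (i - 1) j) C"
    and "pairing (jker3 i j) (lin (r - 1) C) = pairing (jker3 i (j - 1)) C - r *s pairing (jker3 i j) C"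
proof -
  have c: "compat (jker3 i j) C" "compat (\<lambda>m. jker3 i j (m + 1)) C"
    using assms jker_truncated(3)[of i j] by (auto simp: compat_def upper_truncated_shift)
  show "pairing (jker3 i j) (lin 0 C) = pairing (jker3 (i - 1) j) C"
    using pairing_lin[OF c(1), of 0] by (simp add: jker3_diff)
  have "pairing (jker3 i (j - 1)) C = pairing (\<lambda>m. jker3 i j (m + 1)) C + pairing (jker3 i j) C"
    unfolding jker3_shift[symmetric] pairing_def scale_left_distrib
    using c by (intro Sum_any.distrib compat_finite)
  then show "pairing (jker3 i j) (lin (r - 1) C) = pairing (jker3 i (j - 1)) C - r *s pairing (jker3 i j) C"
    using pairing_lin[OF c(1), of "r - 1"] by (simp add: algebra_simps)
qed

lemma jacobi_defect_lin:
  assumes "upper_truncated F" "lower_truncated G" "lower_truncated C"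
  shows "jacobi_defect (lin r F) (lin r G) (lin (r - 1) C) i j
      = jacobi_defect F G C i (j - 1) - r *s jacobi_defect F G C i j"
proof -
  have "compat (jker1 i j) F" "compat (jker2 i j) G"
    using assms jker_truncated by (auto simp: compat_def)
  then show ?thesis
    using assms unfolding jacobi_defect_def
    by (simp add: pairing_lin pairing_jker3_lin jker1_shift jker2_shift algebra_simps)
qed

text \<open>For r = 1 the factor x_1/x_2 - 1 may be read as x_0/x_2, so it acts on defects by a
  shift in i, which is invertible. This is why a pole at z = 1 does not have to be cleared in a
  Jacobi identity.\<close>

lemma jacobi_defect_lin_1:
  assumes "upper_truncated F" "lower_truncated G" "lower_truncated C"
  shows "jacobi_defect (lin 1 F) (lin 1 G) (lin 0 C) i j = jacobi_defect F G C (i - 1) j"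
proof -
  have c: "compat (jker1 i j) F" "compat (jker2 i j) G"
    "compat (\<lambda>m. jker1 i j (m + 1)) F" "compat (\<lambda>m. jker2 i j (m + 1)) G"
    using assms jker_truncated by (auto simp: compat_def upper_truncated_shift lower_truncated_shift)
  have d: "finite {m. (k m - l m) *s F m \<noteq> 0}
      \<and> pairing (\<lambda>m. k m - l m) F = pairing k F - pairing l F"
    if "compat k F" "compat l F" for k l F
  proof -
    have "finite {m. k m *s F m \<noteq> 0}" "finite {m. (- l m) *s F m \<noteq> 0}"
      using that by (auto dest: compat_finite)
    from Sum_any.distrib[OF this] have "pairing (\<lambda>m. k m - l m) F
        = pairing k F + Sum_any (\<lambda>m. (- l m) *s F m)"
      by (simp add: pairing_def scale_left_diff_distrib)
    also have "Sum_any (\<lambda>m. (- l m) *s F m) = - pairing l F"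
      by (simp add: pairing_def Sum_any.expand_set sum_negf)
    finally have e: "pairing (\<lambda>m. k m - l m) F = pairing k F - pairing l F" by simp
    have "{m. (k m - l m) *s F m \<noteq> 0} \<subseteq> {m. k m *s F m \<noteq> 0} \<union> {m. (- l m) *s F m \<noteq> 0}"
      by (auto simp: scale_left_diff_distrib)
    then show ?thesis using e \<open>finite {m. k m *s F m \<noteq> 0}\<close> \<open>finite {m. (- l m) *s F m \<noteq> 0}\<close>
      by (meson finite_UnI finite_subset)
  qed
  show ?thesis
    using assms c d[OF c(3,1)] d[OF c(4,2)] unfolding jacobi_defect_def
    by (simp add: pairing_lin pairing_jker3_lin jker1_diff jker2_diff)
qed

text \<open>Everything can be computed monomial by monomial: Vandermonde evaluates the third term,
  and what remains is \<open>jker_delta\<close>.\<close>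

lemma jacobi_defect_finite:
  assumes "upper_truncated H" "lower_truncated H"
  shows "jacobi_defect H H (tay H) i j = 0"
proof -
  let ?A = "{m. H m \<noteq> 0}"
  have fin: "finite ?A" using assms by (simp add: finite_support_iff)
  have sum: "pairing k H = (\<Sum>m\<in>?A. k m *s H m)" for k by (rule pairing_eq_sum[OF fin]) auto
  have "pairing (jker3 i j) (tay H) = (\<Sum>n\<in>{0..i}. jker3 i j n *s tay H n)"
    by (rule pairing_eq_sum) (auto simp: jker3_def not_less[symmetric] tay_neg ibinom_neg)
  also have "\<dots> = (\<Sum>n\<in>{0..i}. \<Sum>m\<in>?A. (ibinom (- j - 1) (i - n) * ibinom m n) *s H m)"
    by (simp add: tay_def sum jker3_def scale_sum_right)
  also have "\<dots> = (\<Sum>m\<in>?A. \<Sum>n\<in>{0..i}. (ibinom (- j - 1) (i - n) * ibinom m n) *s H m)"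
    by (rule sum.swap)
  also have "\<dots> = (\<Sum>m\<in>?A. ibinom (m - j - 1) i *s H m)"
    by (rule sum.cong[OF refl])
       (simp only: scale_sum_left[symmetric] ibinom_Vandermonde[OF finite_atLeastAtMost_int order_refl],
        simp add: algebra_simps)
  also have "\<dots> = (\<Sum>m\<in>?A. jker1 i j m *s H m) - (\<Sum>m\<in>?A. jker2 i j m *s H m)"
    by (simp add: jker_delta[symmetric] scale_left_diff_distrib sum_subtractf)
  finally show ?thesis by (simp add: jacobi_defect_def sum)
qed

lemma jacobi_defect_expansions_lins:
  assumes "expansions rs F G C"
  shows "jacobi_defect (lins rs F) (lins rs G) (lins (map (\<lambda>r. r - 1) rs) C) i j = 0"
  using assms jacobi_defect_finite expansions_lins_truncated[of F G rs]
  unfolding expansions_def by simp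

text \<open>The residue theorem for a rational function whose poles lie in \<open>{0, 1, \<infinity>}\<close>.\<close>

lemma expansions_jacobi_defect:
  assumes "expansions rs F G C" and "set rs \<subseteq> {0, 1}"
  shows "jacobi_defect F G C i j = 0"
  using assms
proof (induction rs arbitrary: F G C i j)
  case Nil
  then have "G = F" "C = tay F" "lower_truncated F" "upper_truncated F" by (auto simp: expansions_def)
  then show ?case using jacobi_defect_finite by simp
next
  case (Cons r rs)
  have "expansions rs (lin r F) (lin r G) (lin (r - 1) C)"
    using Cons.prems(1) unfolding expansions_def
    by (simp add: lins_Cons lins_lin upper_truncated_lin lower_truncated_lin)
  then have 0: "jacobi_defect (lin r F) (lin r G) (lin (r - 1) C) i j = 0" for i j
    using Cons.IH Cons.prems(2) by simp
  have t: "upper_truncated F" "lower_truncated G" "lower_truncated C"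
    using Cons.prems(1) by (auto simp: expansions_def)
  from Cons.prems(2) consider "r = 0" | "r = 1" by auto
  then show ?case
  proof cases
    case 1
    \<comment> \<open>The factor z shifts j and, in the other case, z - 1 shifts i, so the vanishing
      of the defect can be read back. Any other root would only give a recursion in j.\<close>
    then show ?thesis using 0[of i "j + 1"] jacobi_defect_lin[OF t, of 0 i "j + 1"] by simp
  next
    case 2
    then show ?thesis using 0[of "i + 1" j] jacobi_defect_lin_1[OF t, of "i + 1" j] by simp
  qed
qed

text \<open>The residue in x_0: both delta kernels degenerate to a single coefficient, which leaves
  the commutator formula.\<close>

lemma jacobi_defect_minus_1: "jacobi_defect F G C (- 1) j = F j - G j - pairing (jker3 (- 1) j) C"
proof -
  have "pairing (jker1 (- 1) j) F = (\<Sum>m\<in>{j}. jker1 (- 1) j m *s F m)"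
    "pairing (jker2 (- 1) j) G = (\<Sum>m\<in>{j}. jker2 (- 1) j m *s G m)"
    by (rule pairing_eq_sum; auto simp: jker1_def jker2_def ibinom_zero_left split: if_splits)+
  then show ?thesis by (simp add: jacobi_defect_def jker1_def jker2_def)
qed

text \<open>A converse of the residue theorem. Multiplying n times by z - 1 moves C to nonnegative
  exponents, so it drops out of the commutator formula and \<open>F\<close>, \<open>G\<close> agree
  after clearing. The resulting rational function has an expansion at 1 satisfying the same Jacobi
  identity, and the identity determines it.\<close>

lemma jacobi_defect_expansions:
  assumes t: "upper_truncated F" "lower_truncated G" "lower_truncated C"
    and j: "\<And>i j. jacobi_defect F G C i j = 0"
    and C: "\<And>i. i < - int n \<Longrightarrow> C i = 0"
  shows "expansions (replicate n 1) F G C"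
proof -
  have n: "jacobi_defect (lins (replicate n 1) F) (lins (replicate n 1) G) (lins (replicate n 0) C) i j = 0"
    for i j
  proof (induction n arbitrary: i)
    case (Suc n)
    then show ?case
      using t by (simp add: lins_Cons jacobi_defect_lin_1 upper_truncated_lins lower_truncated_lins)
  qed (simp add: j)
  have C0: "lins (replicate n 0) C i = C (i - int n)" for i
    by (induction n arbitrary: i) (simp_all add: lins_Cons lin_def algebra_simps)
  have "pairing (jker3 (- 1) j) (lins (replicate n 0) C) = 0" for j
  proof -
    have "jker3 (- 1) j m = 0 \<or> lins (replicate n 0) C m = 0" for m
      by (cases "m < 0") (auto simp: jker3_def C0 C)
    then show ?thesis
      using pairing_eq_sum[of "{}" "jker3 (- 1) j" "lins (replicate n 0) C"] by auto
  qed
  then have "lins (replicate n 1) F = lins (replicate n 1) G"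
    using n[of "-1"] by (simp add: fun_eq_iff jacobi_defect_minus_1)
  then obtain C' where C': "expansions (replicate n 1) F G C'"
    using expansions_exists t by blast
  have "jacobi_defect F G C' i j = 0" for i j
    using C' by (rule expansions_jacobi_defect) auto
  then have "pairing (jker3 i (- 1)) C = pairing (jker3 i (- 1)) C'" for i
    using j by (simp add: jacobi_defect_def)
  \<comment> \<open>The coefficient of x_1^(-1) isolates the third series.\<close>
  moreover have "pairing (jker3 i (- 1)) D = D i" for D i
  proof -
    have "pairing (jker3 i (- 1)) D = (\<Sum>m\<in>{i}. jker3 i (- 1) m *s D m)"
      by (rule pairing_eq_sum) (auto simp: jker3_def ibinom_zero_left split: if_splits)
    then show ?thesis by (simp add: jker3_def)
  qed
  ultimately have "C = C'" by auto
  with C' show ?thesis by simp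
qed

end

section \<open>Two variables\<close>

text \<open>The triple \<open>(a, b, c)\<close> is the linear form \<open>a + b z\<^sub>1 + c z\<^sub>2\<close>. The functions below substitute
  \<open>z\<^sub>1 = 1 + y\<^sub>1\<close>, \<open>z\<^sub>2 = 1 + y\<^sub>2\<close> and \<open>z\<^sub>1 = z\<^sub>2 + y\<^sub>0\<close>.\<close>

fun shift1 shift2 shiftd :: "complex \<times> complex \<times> complex \<Rightarrow> complex \<times> complex \<times> complex" where
  "shift1 (a, b, c) = (a + b, b, c)"
| "shift2 (a, b, c) = (a + c, b, c)"
| "shiftd (a, b, c) = (a, b, b + c)"

context cspace
begin

definition lc :: "complex \<times> complex \<times> complex \<Rightarrow> (int \<Rightarrow> int \<Rightarrow> 'w) \<Rightarrow> int \<Rightarrow> int \<Rightarrow> 'w" where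
  "lc = (\<lambda>(a, b, c) e i j. a *s e i j + b *s e (i - 1) j + c *s e i (j - 1))"

definition lcs :: "(complex \<times> complex \<times> complex) list \<Rightarrow> (int \<Rightarrow> int \<Rightarrow> 'w) \<Rightarrow> int \<Rightarrow> int \<Rightarrow> 'w" where
  "lcs ts e = foldr lc ts e"

lemma lc_apply: "lc (a, b, c) e = (\<lambda>i j. a *s e i j + b *s e (i - 1) j + c *s e i (j - 1))"
  by (simp add: lc_def)

lemma lcs_Nil [simp]: "lcs [] e = e"
  and lcs_Cons: "lcs (t # ts) e = lc t (lcs ts e)"
  and lcs_append: "lcs (ts @ us) e = lcs ts (lcs us e)"
  by (simp_all add: lcs_def)

lemma lc_commute: "lc t (lc u e) = lc u (lc t e)"
  by (cases t; cases u) (simp add: lc_apply fun_eq_iff algebra_simps)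

lemma lcs_lc: "lcs ts (lc t e) = lc t (lcs ts e)"
  by (induction ts) (simp_all add: lcs_Cons lc_commute)

lemma lcs_commute: "lcs ts (lcs us e) = lcs us (lcs ts e)"
  by (induction ts arbitrary: e) (simp_all add: lcs_Cons lcs_lc)

lemma lcs_partition: "lcs ts e = lcs (filter P ts) (lcs (filter (\<lambda>t. \<not> P t) ts) e)"
  by (induction ts) (simp_all add: lcs_Cons lcs_lc)

lemma lcs_diff: "lcs ts (\<lambda>i j. e i j - e' i j) = (\<lambda>i j. lcs ts e i j - lcs ts e' i j)"
proof (induction ts)
  case (Cons t ts)
  then show ?case
    by (cases t) (simp only: lcs_Cons Cons, simp add: lc_apply fun_eq_iff algebra_simps)
qed simp

lemma lcs_column: "lcs (map (\<lambda>r. (- r, 1, 0)) rs) e i j = lins rs (\<lambda>i. e i j) i"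
  by (induction rs arbitrary: i) (simp_all add: lcs_Cons lins_Cons lc_apply lin_def)

lemma lcs_row: "lcs (map (\<lambda>r. (- r, 0, 1)) rs) e i j = lins rs (e i) j"
  by (induction rs arbitrary: j) (simp_all add: lcs_Cons lins_Cons lc_apply lin_def)

text \<open>A product of n forms z_1 - r z_2 raises the total degree by n; hence the antidiagonal of
  degree \<open>i + j - int (length rs)\<close> on the right.\<close>

lemma lcs_diagonal:
  "lcs (map (\<lambda>r. (0, 1, - r)) rs) e i j = lins rs (\<lambda>m. e m (i + j - int (length rs) - m)) i"
proof (induction rs arbitrary: i j)
  case (Cons r rs)
  then show ?case by (simp add: lcs_Cons lins_Cons lc_apply lin_def algebra_simps)
qed (simp add: algebra_simps)

text \<open>\<open>m\<close> expands \<open>e\<close> in the first variable at \<open>z\<^sub>1 = 1\<close>, in the second one at \<open>z\<^sub>2 = 1\<close>, and in the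
  first one at \<open>z\<^sub>1 = z\<^sub>2\<close>.\<close>

definition exp1 :: "(int \<Rightarrow> int \<Rightarrow> 'w) \<Rightarrow> (int \<Rightarrow> int \<Rightarrow> 'w) \<Rightarrow> (int \<Rightarrow> int \<Rightarrow> 'w) \<Rightarrow> bool" where
  "exp1 e g m \<longleftrightarrow> (\<forall>j. \<exists>rs. expansions rs (\<lambda>i. e i j) (\<lambda>i. g i j) (\<lambda>i. m i j))"

definition exp2 :: "(int \<Rightarrow> int \<Rightarrow> 'w) \<Rightarrow> (int \<Rightarrow> int \<Rightarrow> 'w) \<Rightarrow> (int \<Rightarrow> int \<Rightarrow> 'w) \<Rightarrow> bool" where
  "exp2 e g m \<longleftrightarrow> (\<forall>i. \<exists>rs. expansions rs (e i) (g i) (m i))"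

definition expd :: "(int \<Rightarrow> int \<Rightarrow> 'w) \<Rightarrow> (int \<Rightarrow> int \<Rightarrow> 'w) \<Rightarrow> (int \<Rightarrow> int \<Rightarrow> 'w) \<Rightarrow> bool" where
  "expd e g m \<longleftrightarrow> (\<forall>n. \<exists>rs. expansions rs (\<lambda>i. e i (n - i)) (\<lambda>i. g i (n - i)) (\<lambda>i. m i (n - i)))"

lemma expansions_comb3:
  assumes "\<exists>rs. expansions rs F1 G1 C1" "\<exists>rs. expansions rs F2 G2 C2" "\<exists>rs. expansions rs F3 G3 C3"
  shows "\<exists>rs. expansions rs (\<lambda>i. a *s F1 i + b *s F2 i + c *s F3 i)
    (\<lambda>i. a *s G1 i + b *s G2 i + c *s G3 i) (\<lambda>i. a *s C1 i + b *s C2 i + c *s C3 i)"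
proof -
  obtain rs1 rs2 rs3 where 1: "expansions rs1 F1 G1 C1" and 2: "expansions rs2 F2 G2 C2"
    and 3: "expansions rs3 F3 G3 C3" using assms by blast
  from expansions_comb[OF expansions_comb[OF 1 2, of a b] 3, of 1 c] show ?thesis by auto
qed

lemma exp2_lc:
  assumes "exp2 e g m"
  shows "exp2 (lc t e) (lc t g) (lc (shift2 t) m)"
  unfolding exp2_def
proof
  fix i
  obtain a b c where t: "t = (a, b, c)" by (cases t)
  have *: "\<exists>rs. expansions rs (e i) (g i) (m i)" for i using assms by (simp add: exp2_def)
  have "\<exists>rs. expansions rs (lin 0 (e i)) (lin 0 (g i)) (lin (0 - 1) (m i))"
    using * expansions_lin by blast
  from expansions_comb3[OF *[of i] *[of "i - 1"] this, of a b c]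
  show "\<exists>rs. expansions rs (lc t e i) (lc t g i) (lc (shift2 t) m i)"
    by (simp add: t lc_apply lin_def algebra_simps)
qed

lemma exp1_swap: "exp1 e g m \<longleftrightarrow> exp2 (\<lambda>i j. e j i) (\<lambda>i j. g j i) (\<lambda>i j. m j i)"
  by (simp add: exp1_def exp2_def)

lemma exp1_lc:
  assumes "exp1 e g m"
  shows "exp1 (lc t e) (lc t g) (lc (shift1 t) m)"
proof -
  obtain a b c where t: "t = (a, b, c)" by (cases t)
  have "exp2 (lc (a, c, b) (\<lambda>i j. e j i)) (lc (a, c, b) (\<lambda>i j. g j i)) (lc (a + b, c, b) (\<lambda>i j. m j i))"
    using exp2_lc[of "\<lambda>i j. e j i" _ _ "(a, c, b)"] assms by (simp add: exp1_swap)
  then show ?thesis unfolding exp1_swap by (simp add: t lc_apply algebra_simps)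
qed

lemma expd_lc:
  assumes "expd e g m"
  shows "expd (lc t e) (lc t g) (lc (shiftd t) m)"
  unfolding expd_def
proof
  fix n
  obtain a b c where t: "t = (a, b, c)" by (cases t)
  have *: "\<exists>rs. expansions rs (\<lambda>i. e i (n - i)) (\<lambda>i. g i (n - i)) (\<lambda>i. m i (n - i))" for n
    using assms by (simp add: expd_def)
  let ?d = "\<lambda>(e :: int \<Rightarrow> int \<Rightarrow> 'w) i. e i (n - 1 - i)"
  have "\<exists>rs. expansions rs (lin 0 (?d e)) (lin 0 (?d g)) (lin (0 - 1) (?d m))"
    using *[of "n - 1"] expansions_lin by blast
  from expansions_comb3[OF *[of n] this *[of "n - 1"], of a b c]
  show "\<exists>rs. expansions rs (\<lambda>i. lc t e i (n - i)) (\<lambda>i. lc t g i (n - i)) (\<lambda>i. lc (shiftd t) m i (n - i))"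
    by (simp add: t lc_apply lin_def algebra_simps)
qed

lemma exp2_lcs: "exp2 e g m \<Longrightarrow> exp2 (lcs ts e) (lcs ts g) (lcs (map shift2 ts) m)"
  and exp1_lcs: "exp1 e g m \<Longrightarrow> exp1 (lcs ts e) (lcs ts g) (lcs (map shift1 ts) m)"
  and expd_lcs: "expd e g m \<Longrightarrow> expd (lcs ts e) (lcs ts g) (lcs (map shiftd ts) m)"
  by (induction ts) (simp_all add: lcs_Cons exp2_lc exp1_lc expd_lc)

section \<open>Taylor expansions of Laurent polynomials in two variables\<close>

definition tay1 :: "(int \<Rightarrow> int \<Rightarrow> 'w) \<Rightarrow> int \<Rightarrow> int \<Rightarrow> 'w" where
  "tay1 K i j = tay (\<lambda>m. K m j) i"

definition tay2 :: "(int \<Rightarrow> int \<Rightarrow> 'w) \<Rightarrow> int \<Rightarrow> int \<Rightarrow> 'w" where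
  "tay2 K i j = tay (K i) j"

definition tayd :: "(int \<Rightarrow> int \<Rightarrow> 'w) \<Rightarrow> int \<Rightarrow> int \<Rightarrow> 'w" where
  "tayd K i j = tay (\<lambda>m. K m (i + j - m)) i"

definition finsupp :: "(int \<Rightarrow> int \<Rightarrow> 'w) \<Rightarrow> bool" where
  "finsupp K \<longleftrightarrow> (\<exists>A B. \<forall>i j. K i j \<noteq> 0 \<longrightarrow> A \<le> i \<and> i \<le> B \<and> A \<le> j \<and> j \<le> B)"

lemma exp2_tay2: "exp2 e g m \<Longrightarrow> (\<And>i. lower_truncated (e i)) \<Longrightarrow> m = tay2 e"
  unfolding exp2_def using expansions_finite_eq by (fastforce simp: tay2_def fun_eq_iff)

lemma exp1_tay1: "exp1 e g m \<Longrightarrow> (\<And>j. lower_truncated (\<lambda>i. e i j)) \<Longrightarrow> m = tay1 e"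
  unfolding exp1_def tay1_def fun_eq_iff by (metis expansions_finite_eq)

lemma expd_tayd: "expd e g m \<Longrightarrow> (\<And>n. lower_truncated (\<lambda>i. e i (n - i))) \<Longrightarrow> m = tayd e"
  unfolding expd_def tayd_def fun_eq_iff
proof (intro allI)
  fix i j
  assume e: "\<forall>n. \<exists>rs. expansions rs (\<lambda>i. e i (n - i)) (\<lambda>i. g i (n - i)) (\<lambda>i. m i (n - i))"
    "\<And>n. lower_truncated (\<lambda>i. e i (n - i))"
  have "(\<lambda>i'. m i' (i + j - i')) = tay (\<lambda>i'. e i' (i + j - i'))"
    using e expansions_finite_eq by blast
  from fun_cong[OF this, of i] show "m i j = tay (\<lambda>m. e m (i + j - m)) i" by simp
qed

lemma lcs_support:
  shows "\<forall>i<M. \<forall>j. e i j = 0 \<Longrightarrow> \<forall>i<M. \<forall>j. lcs ts e i j = 0"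
    and "\<forall>j<M. \<forall>i. e i j = 0 \<Longrightarrow> \<forall>j<M. \<forall>i. lcs ts e i j = 0"
    and "\<forall>i j. i + j > M \<longrightarrow> e i j = 0 \<Longrightarrow> \<forall>i j. i + j > M + int (length ts) \<longrightarrow> lcs ts e i j = 0"
proof -
  show "\<forall>i<M. \<forall>j. e i j = 0 \<Longrightarrow> \<forall>i<M. \<forall>j. lcs ts e i j = 0"
  proof (induction ts)
    case (Cons t ts)
    then show ?case by (cases t) (simp add: lcs_Cons lc_apply)
  qed simp
  show "\<forall>j<M. \<forall>i. e i j = 0 \<Longrightarrow> \<forall>j<M. \<forall>i. lcs ts e i j = 0"
  proof (induction ts)
    case (Cons t ts)
    then show ?case by (cases t) (simp add: lcs_Cons lc_apply)
  qed simp
  show "\<forall>i j. i + j > M \<longrightarrow> e i j = 0 \<Longrightarrow> \<forall>i j. i + j > M + int (length ts) \<longrightarrow> lcs ts e i j = 0"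
  proof (induction ts)
    case (Cons t ts)
    then show ?case by (cases t) (simp add: lcs_Cons lc_apply)
  qed simp
qed

lemma tay_eq_sum: "finite A \<Longrightarrow> (\<And>m. m \<notin> A \<Longrightarrow> H m = 0) \<Longrightarrow> tay H i = (\<Sum>m\<in>A. ibinom m i *s H m)"
  unfolding tay_def by (rule pairing_eq_sum) auto

lemma ibinom_trinomial: "ibinom m r * ibinom r i = ibinom m i * ibinom (m - i) (r - i)"
proof (cases "0 \<le> i \<and> i \<le> r")
  case True
  then obtain k n where k: "i = int k" "r = int n" "k \<le> n"
    by (metis nat_0_le nat_mono order_trans)
  then show ?thesis
    using gbinomial_trinomial_revision[OF k(3), of "of_int m :: complex"]
    by (simp add: ibinom_def nat_diff_distrib of_nat_diff flip: of_nat_diff)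
next
  case False
  then show ?thesis by (cases "r < 0"; cases "i < 0") (auto simp: ibinom_eq_0)
qed

text \<open>Substitutions into a Laurent polynomial may be carried out in any order: putting z_1 =
  z_2 + y_0 and then z_2 = 1 + y_2 is the same as expanding at (1, 1) and then putting y_1 = y_2 +
  y_0.\<close>

lemma tay2_tayd:
  assumes "finsupp K"
  shows "tay1 (tay2 K) = tay2 (tay1 K)" and "tay2 (tayd K) = tayd (tay1 (tay2 K))"
proof -
  obtain A B where AB: "K i j \<noteq> 0 \<Longrightarrow> A \<le> i \<and> i \<le> B \<and> A \<le> j \<and> j \<le> B" for i j
    using assms unfolding finsupp_def by blast
  define S where "S = {A..B}"
  have S: "finite S" "\<And>i j. i \<notin> S \<or> j \<notin> S \<Longrightarrow> K i j = 0" using AB by (force simp: S_def)+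
  have t2: "tay2 K i j = (\<Sum>n\<in>S. ibinom n j *s K i n)" for i j
    unfolding tay2_def by (rule tay_eq_sum) (use S in auto)
  have t1: "tay1 K i j = (\<Sum>m\<in>S. ibinom m i *s K m j)" for i j
    unfolding tay1_def by (rule tay_eq_sum) (use S in auto)
  have t12: "tay1 (tay2 K) i j = (\<Sum>m\<in>S. \<Sum>n\<in>S. (ibinom m i * ibinom n j) *s K m n)" for i j
  proof -
    have "tay1 (tay2 K) i j = (\<Sum>m\<in>S. ibinom m i *s tay2 K m j)"
      unfolding tay1_def by (rule tay_eq_sum) (use S t2 in auto)
    then show ?thesis by (simp add: t2 scale_sum_right)
  qed
  have t21: "tay2 (tay1 K) i j = (\<Sum>m\<in>S. \<Sum>n\<in>S. (ibinom m i * ibinom n j) *s K m n)" for i j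
  proof -
    have "tay2 (tay1 K) i j = (\<Sum>n\<in>S. ibinom n j *s tay1 K i n)"
      unfolding tay2_def by (rule tay_eq_sum) (use S t1 in auto)
    also have "\<dots> = (\<Sum>n\<in>S. \<Sum>m\<in>S. (ibinom m i * ibinom n j) *s K m n)"
      by (simp add: t1 scale_sum_right mult.commute)
    finally show ?thesis by (subst sum.swap)
  qed
  show "tay1 (tay2 K) = tay2 (tay1 K)" by (rule ext)+ (simp only: t12 t21)
  have td: "tayd K i j = (\<Sum>m\<in>S. ibinom m i *s K m (i + j - m))" for i j
    unfolding tayd_def by (rule tay_eq_sum) (use S in auto)
  show "tay2 (tayd K) = tayd (tay1 (tay2 K))"
  proof (rule ext)+
    fix i j
    \<comment> \<open>A nonzero term needs both indices of \<open>K\<close> in [A, B], and these add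
      up to i + j'.\<close>
    let ?T = "{2 * A - i..2 * B - i}"
    have "tay2 (tayd K) i j = (\<Sum>j'\<in>?T. ibinom j' j *s tayd K i j')"
      unfolding tay2_def
    proof (rule tay_eq_sum)
      fix j' assume j': "j' \<notin> ?T"
      have "m \<notin> S \<or> i + j' - m \<notin> S" for m using j' by (auto simp: S_def)
      then show "tayd K i j' = 0" unfolding td using S(2) by (intro sum.neutral) auto
    qed simp
    also have "\<dots> = (\<Sum>m\<in>S. \<Sum>j'\<in>?T. (ibinom j' j * ibinom m i) *s K m (i + j' - m))"
      by (subst sum.swap) (simp add: td scale_sum_right)
    also have "\<dots> = (\<Sum>m\<in>S. \<Sum>n\<in>S. (ibinom (m + n - i) j * ibinom m i) *s K m n)"
    proof (rule sum.cong[OF refl])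
      fix m assume m: "m \<in> S"
      have "(\<Sum>j'\<in>?T. (ibinom j' j * ibinom m i) *s K m (i + j' - m))
          = (\<Sum>n\<in>(\<lambda>j'. i + j' - m) ` ?T. (ibinom (m + n - i) j * ibinom m i) *s K m n)"
        by (subst sum.reindex) (auto simp: inj_on_def)
      also have "\<dots> = (\<Sum>n\<in>S. (ibinom (m + n - i) j * ibinom m i) *s K m n)"
      proof (rule sum.mono_neutral_right)
        show "S \<subseteq> (\<lambda>j'. i + j' - m) ` ?T"
        proof
          fix n assume "n \<in> S"
          then have "m + n - i \<in> ?T" using m by (auto simp: S_def)
          then show "n \<in> (\<lambda>j'. i + j' - m) ` ?T" by (rule rev_image_eqI) simp
        qed
      qed (use S in auto)
      finally show "(\<Sum>j'\<in>?T. (ibinom j' j * ibinom m i) *s K m (i + j' - m))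
          = (\<Sum>n\<in>S. (ibinom (m + n - i) j * ibinom m i) *s K m n)" .
    qed
    finally have L: "tay2 (tayd K) i j = (\<Sum>m\<in>S. \<Sum>n\<in>S. (ibinom (m + n - i) j * ibinom m i) *s K m n)" .
    \<comment> \<open>Both sides are the coefficient of y_0^i y_2^j in (1 + y_0 + y_2)^m (1 +
      y_2)^n. Trinomial revision reduces the sum to Vandermonde's.\<close>
    have sc: "(\<Sum>r\<in>{0..i + j}. ibinom r i * (ibinom m r * ibinom n (i + j - r)))
        = ibinom (m + n - i) j * ibinom m i" for m n
    proof -
      have "(\<Sum>r\<in>{0..i + j}. ibinom r i * (ibinom m r * ibinom n (i + j - r)))
          = (\<Sum>r\<in>{0..i + j}. ibinom m i * (ibinom (m - i) (r - i) * ibinom n (i + j - r)))"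
        by (rule sum.cong) (use ibinom_trinomial[of m _ i] in \<open>auto simp: mult_ac\<close>)
      also have "\<dots> = ibinom m i * (\<Sum>r\<in>{0..i + j}. ibinom (m - i) (r - i) * ibinom n (i + j - r))"
        by (simp add: sum_distrib_left)
      also have "(\<Sum>r\<in>{0..i + j}. ibinom (m - i) (r - i) * ibinom n (i + j - r))
          = (\<Sum>s\<in>{- i..j}. ibinom (m - i) s * ibinom n (j - s))"
        by (rule sum.reindex_bij_witness[of _ "\<lambda>s. s + i" "\<lambda>r. r - i"]) (auto simp: algebra_simps)
      finally have eq: "(\<Sum>r\<in>{0..i + j}. ibinom r i * (ibinom m r * ibinom n (i + j - r)))
          = ibinom m i * (\<Sum>s\<in>{- i..j}. ibinom (m - i) s * ibinom n (j - s))" .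
      show ?thesis
      proof (cases "i < 0")
        case False
        then have "(\<Sum>s\<in>{- i..j}. ibinom n (j - s) * ibinom (m - i) s) = ibinom (n + (m - i)) j"
          by (intro ibinom_Vandermonde) auto
        then show ?thesis unfolding eq by (simp add: algebra_simps)
      qed (simp add: eq)
    qed
    have "tayd (tay1 (tay2 K)) i j = (\<Sum>r\<in>{0..i + j}. ibinom r i *s tay1 (tay2 K) r (i + j - r))"
      unfolding tayd_def
    proof (rule tay_eq_sum)
      fix r assume "r \<notin> {0..i + j}"
      then have z: "ibinom m r * ibinom n (i + j - r) = 0" for m n by auto
      show "tay1 (tay2 K) r (i + j - r) = 0"
        by (simp only: t12 z scale_zero_left sum.neutral_const)
    qed simp
    also have "\<dots> = (\<Sum>m\<in>S. \<Sum>n\<in>S. \<Sum>r\<in>{0..i + j}.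
        (ibinom r i * (ibinom m r * ibinom n (i + j - r))) *s K m n)"
      by (simp add: t12 scale_sum_right) (subst sum.swap, rule sum.cong[OF refl], rule sum.swap)
    also have "\<dots> = tay2 (tayd K) i j" unfolding L scale_sum_left[symmetric] sc ..
    finally show "tay2 (tayd K) i j = tayd (tay1 (tay2 K)) i j" by simp
  qed
qed

text \<open>Membership in \<open>W((y\<^sub>1))((y\<^sub>2))\<close> and in \<open>W((y\<^sub>2))((y\<^sub>1))\<close>.\<close>

definition lowA :: "(int \<Rightarrow> int \<Rightarrow> 'w) \<Rightarrow> bool" where
  "lowA e \<longleftrightarrow> (\<exists>J. \<forall>j<J. \<forall>i. e i j = 0) \<and> (\<forall>j. lower_truncated (\<lambda>i. e i j))"

definition lowB :: "(int \<Rightarrow> int \<Rightarrow> 'w) \<Rightarrow> bool" where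
  "lowB e \<longleftrightarrow> (\<exists>I. \<forall>i<I. \<forall>j. e i j = 0) \<and> (\<forall>i. lower_truncated (e i))"

lemma lowB_swap: "lowB e \<longleftrightarrow> lowA (\<lambda>i j. e j i)"
  by (simp add: lowA_def lowB_def)

lemma lower_truncated_comb3:
  assumes "lower_truncated F" "lower_truncated G" "lower_truncated H"
  shows "lower_truncated (\<lambda>i. a *s F i + b *s G i + c *s (H i :: 'w))"
  using lower_truncated_add[OF lower_truncated_add[OF assms(1,2), of a b] assms(3), of 1 c] by simp

lemma lowA_lc: "lowA e \<Longrightarrow> lowA (lc t e)"
proof -
  assume e: "lowA e"
  obtain a b c where t: "t = (a, b, c)" by (cases t)
  obtain J where "\<forall>j<J. \<forall>i. e i j = 0" using e by (auto simp: lowA_def)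
  then have "\<forall>j<J. \<forall>i. lc t e i j = 0" by (simp add: t lc_apply)
  moreover have "lower_truncated (\<lambda>i. lc t e i j)" for j
  proof -
    have *: "lower_truncated (\<lambda>i. e i j)" for j using e by (simp add: lowA_def)
    have "lower_truncated (\<lambda>i. e (i - 1) j)"
      using *[of j] lower_truncated_shift[of "\<lambda>i. e i j" "- 1"] by simp
    from lower_truncated_comb3[OF *[of j] this *[of "j - 1"], of a b c]
    show ?thesis by (simp add: t lc_apply)
  qed
  ultimately show ?thesis by (auto simp: lowA_def)
qed

lemma lowA_lcs: "lowA e \<Longrightarrow> lowA (lcs ts e)"
  by (induction ts) (simp_all add: lcs_Cons lowA_lc)

lemma lcs_swap': "lcs (map (\<lambda>(a, b, c). (a, c, b)) ts) (\<lambda>i j. e j i) = (\<lambda>i j. lcs ts e j i)"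
proof (induction ts)
  case (Cons t ts)
  then show ?case by (cases t) (simp add: lcs_Cons lc_apply algebra_simps)
qed simp

lemma lowB_lcs: "lowB e \<Longrightarrow> lowB (lcs ts e)"
  unfolding lowB_swap lcs_swap'[symmetric] by (rule lowA_lcs)

lemma lowA_diff: "lowA e \<Longrightarrow> lowA e' \<Longrightarrow> lowA (\<lambda>i j. e i j - e' i j)"
proof -
  assume e: "lowA e" "lowA e'"
  then obtain J J' where "\<forall>j<J. \<forall>i. e i j = 0" "\<forall>j<J'. \<forall>i. e' i j = 0" by (auto simp: lowA_def)
  then have "\<forall>j<min J J'. \<forall>i. e i j - e' i j = 0" by simp
  then show ?thesis using e lower_truncated_diff unfolding lowA_def by blast
qed

lemma lowB_diff: "lowB e \<Longrightarrow> lowB e' \<Longrightarrow> lowB (\<lambda>i j. e i j - e' i j)"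
  unfolding lowB_swap using lowA_diff by fastforce

text \<open>A form with nonzero constant term is a unit of W((y_1))((y_2)): the equation at (i, j)
  expresses the entry there by entries at lower positions. The argument is local to any region
  \<open>Q\<close> closed under lowering an index; it serves for the complement of the quadrant and
  for the whole plane.\<close>

lemma lc_unit_cancel:
  assumes low: "lowA e" and a: "fst t \<noteq> 0"
    and Q: "\<And>i j. Q i j \<Longrightarrow> Q (i - 1) j \<and> Q i (j - 1)"
    and z: "\<And>i j. Q i j \<Longrightarrow> lc t e i j = 0" and q: "Q i j"
  shows "e i j = 0"
proof -
  obtain a b c where t: "t = (a, b, c)" by (cases t)
  obtain J where J: "\<forall>j<J. \<forall>i. e i j = 0" using low by (auto simp: lowA_def)
  have row: "\<forall>i. Q i (J - 1 + int n) \<longrightarrow> e i (J - 1 + int n) = 0" for n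
  proof (induction n)
    case 0
    then show ?case using J by simp
  next
    case (Suc n)
    let ?j = "J - 1 + int (Suc n)"
    obtain I where I: "\<forall>i<I. e i ?j = 0" using low unfolding lowA_def lower_truncated_def by blast
    have "Q (I - 1 + int k) ?j \<longrightarrow> e (I - 1 + int k) ?j = 0" for k
    proof (induction k)
      case 0
      then show ?case using I by simp
    next
      case (Suc k)
      show ?case
      proof
        assume q: "Q (I - 1 + int (Suc k)) ?j"
        have i: "I - 1 + int (Suc k) - 1 = I - 1 + int k" and j: "?j - 1 = J - 1 + int n" by auto
        have 1: "e (I - 1 + int k) ?j = 0" using Suc Q[OF q] unfolding i by blast
        have 2: "e (I - 1 + int (Suc k)) (J - 1 + int n) = 0"
          using \<open>\<forall>i. Q i (J - 1 + int n) \<longrightarrow> e i (J - 1 + int n) = 0\<close> Q[OF q] unfolding j by blast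
        have "a *s e (I - 1 + int (Suc k)) ?j = 0"
          using z[OF q] unfolding t lc_apply i j 1 2 by simp
        then show "e (I - 1 + int (Suc k)) ?j = 0" using assms(2) t by simp
      qed
    qed
    note k = this
    show ?case
    proof (intro allI impI)
      fix i assume q: "Q i ?j"
      show "e i ?j = 0"
      proof (cases "i < I")
        case False
        then have "I - 1 + int (nat (i - I + 1)) = i" by simp
        then show ?thesis using k[of "nat (i - I + 1)"] q by simp
      qed (use I in blast)
    qed
  qed
  show ?thesis
  proof (cases "j < J")
    case False
    then have "J - 1 + int (nat (j - J + 1)) = j" by simp
    then show ?thesis using row[of "nat (j - J + 1)"] q by simp
  qed (use J in blast)
qed

lemma lcs_unit_cancel:
  assumes low: "lowA e" and a: "\<forall>t\<in>set ts. fst t \<noteq> 0"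
    and Q: "\<And>i j. Q i j \<Longrightarrow> Q (i - 1) j \<and> Q i (j - 1)"
    and z: "\<And>i j. Q i j \<Longrightarrow> lcs ts e i j = 0" and q: "Q i j"
  shows "e i j = 0"
  using a z q
proof (induction ts arbitrary: i j)
  case (Cons t ts)
  have "lcs ts e i j = 0" if "Q i j" for i j
    by (rule lc_unit_cancel[where t = t and Q = Q])
      (use Cons.prems Q that lowA_lcs[OF low] in \<open>auto simp: lcs_Cons\<close>)
  then show ?case using Cons by auto
qed simp

lemma lcs_unit_cancel_B:
  assumes low: "lowB e" and a: "\<forall>t\<in>set ts. fst t \<noteq> 0"
    and Q: "\<And>i j. Q i j \<Longrightarrow> Q (i - 1) j \<and> Q i (j - 1)"
    and z: "\<And>i j. Q i j \<Longrightarrow> lcs ts e i j = 0" and q: "Q i j"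
  shows "e i j = 0"
proof -
  let ?s = "map (\<lambda>(a, b, c). (a, c, b)) ts"
  have eq: "lcs ?s (\<lambda>i j. e j i) j i = lcs ts e i j" for i j
    by (simp add: lcs_swap')
  show ?thesis
  proof (rule lcs_unit_cancel[of "\<lambda>i j. e j i" ?s "\<lambda>i j. Q j i" j i])
    show "lowA (\<lambda>i j. e j i)" using low by (simp add: lowB_swap)
    show "\<forall>t\<in>set ?s. fst t \<noteq> 0" using a by auto
  qed (use Q z q eq in auto)
qed

lemma tayd_lc:
  assumes "\<And>n. upper_truncated (\<lambda>i. K i (n - i)) \<and> lower_truncated (\<lambda>i. K i (n - i))"
  shows "tayd (lc t K) = lc (shiftd t) (tayd K)"
    and "\<And>n. upper_truncated (\<lambda>i. lc t K i (n - i)) \<and> lower_truncated (\<lambda>i. lc t K i (n - i))"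
proof -
  have K: "expd K K (tayd K)"
    unfolding expd_def tayd_def
  proof
    fix n
    from expansions_finite[OF conjunct1[OF assms[of n]] conjunct2[OF assms[of n]]]
    show "\<exists>rs. expansions rs (\<lambda>i. K i (n - i)) (\<lambda>i. K i (n - i))
        (\<lambda>i. tay (\<lambda>m. K m (i + (n - i) - m)) i)" by auto
  qed
  from expd_lc[OF K, of t] have "expd (lc t K) (lc t K) (lc (shiftd t) (tayd K))" .
  then show "\<And>n. upper_truncated (\<lambda>i. lc t K i (n - i)) \<and> lower_truncated (\<lambda>i. lc t K i (n - i))"
    by (auto simp: expd_def expansions_def)
  with expd_tayd[OF \<open>expd (lc t K) (lc t K) (lc (shiftd t) (tayd K))\<close>]
  show "tayd (lc t K) = lc (shiftd t) (tayd K)" by simp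
qed

lemma tayd_lcs:
  assumes "\<And>n. upper_truncated (\<lambda>i. K i (n - i)) \<and> lower_truncated (\<lambda>i. K i (n - i))"
  shows "tayd (lcs ts K) = lcs (map shiftd ts) (tayd K)"
proof -
  have "tayd (lcs ts K) = lcs (map shiftd ts) (tayd K) \<and>
    (\<forall>n. upper_truncated (\<lambda>i. lcs ts K i (n - i)) \<and> lower_truncated (\<lambda>i. lcs ts K i (n - i)))"
    by (induction ts) (use assms in \<open>auto simp: lcs_Cons tayd_lc\<close>)
  then show ?thesis by simp
qed

text \<open>In one total degree, with z = y_1/y_2, the forms y_1 - y_2, y_1 and y_2 are
  multiplication by z - 1, z and 1. After y_1 = y_2 + y_0 the same roots, lowered by 1, describe
  them.\<close>

lemma lcs_monic_diagonal:
  assumes "set ts \<subseteq> {(0, 1, -1), (0, 1, 0), (0, 0, 1)}"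
  shows "\<exists>rs. set rs \<subseteq> {0, 1} \<and> (\<forall>e n.
     (\<lambda>i. lcs ts e i (n + int (length ts) - i)) = lins rs (\<lambda>i. e i (n - i)) \<and>
     (\<lambda>i. lcs (map shiftd ts) e i (n + int (length ts) - i)) = lins (map (\<lambda>r. r - 1) rs) (\<lambda>i. e i (n - i)))"
  using assms
proof (induction ts)
  case Nil
  show ?case by (rule exI[of _ "[]"]) simp
next
  case (Cons t ts)
  then obtain rs where rs: "set rs \<subseteq> {0, 1}"
    and IH: "\<And>e n. (\<lambda>i. lcs ts e i (n + int (length ts) - i)) = lins rs (\<lambda>i. e i (n - i))"
      "\<And>e n. (\<lambda>i. lcs (map shiftd ts) e i (n + int (length ts) - i)) = lins (map (\<lambda>r. r - 1) rs) (\<lambda>i. e i (n - i))"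
    by auto
  have "\<exists>r. set r \<subseteq> {0, 1} \<and> (\<forall>e n. (\<lambda>i. lc t e i (n + 1 - i)) = lins r (\<lambda>i. e i (n - i)) \<and>
      (\<lambda>i. lc (shiftd t) e i (n + 1 - i)) = lins (map (\<lambda>r. r - 1) r) (\<lambda>i. e i (n - i)))"
  proof -
    from Cons.prems consider "t = (0, 1, -1)" | "t = (0, 1, 0)" | "t = (0, 0, 1)" by auto
    then show ?thesis
    proof cases
      case 1
      show ?thesis by (rule exI[of _ "[1]"]) (simp add: 1 lins_Cons lc_apply lin_def algebra_simps)
    next
      case 2
      show ?thesis by (rule exI[of _ "[0]"]) (simp add: 2 lins_Cons lc_apply lin_def algebra_simps)
    next
      case 3
      show ?thesis by (rule exI[of _ "[]"]) (simp add: 3 lc_apply algebra_simps)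
    qed
  qed
  then obtain r where r: "set r \<subseteq> {0, 1}"
    and step: "\<And>e n. (\<lambda>i. lc t e i (n + 1 - i)) = lins r (\<lambda>i. e i (n - i))"
      "\<And>e n. (\<lambda>i. lc (shiftd t) e i (n + 1 - i)) = lins (map (\<lambda>r. r - 1) r) (\<lambda>i. e i (n - i))"
    by blast
  have n: "n + int (length (t # ts)) = n + int (length ts) + 1" for n by simp
  show ?case
    by (rule exI[of _ "r @ rs"])
       (use r rs in \<open>simp only: n lcs_Cons list.map map_append set_append Un_least step IH lins_append, simp\<close>)
qed

lemma finsuppD:
  assumes "finsupp K"
  shows "lower_truncated (K i)" "lower_truncated (\<lambda>i. K i j)"
    "upper_truncated (\<lambda>i. K i (n - i))" "lower_truncated (\<lambda>i. K i (n - i))"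
    "lower_truncated (\<lambda>i. tay2 K i j)" "lower_truncated (tay1 K i)" "lower_truncated (tayd K i)"
proof -
  obtain A B where AB: "K i j \<noteq> 0 \<Longrightarrow> A \<le> i \<and> i \<le> B \<and> A \<le> j \<and> j \<le> B" for i j
    using assms unfolding finsupp_def by blast
  have z: "K i j = 0" if "i < A \<or> B < i \<or> j < A \<or> B < j" for i j
    using AB[of i j] that by linarith
  show "lower_truncated (K i)" "lower_truncated (\<lambda>i. K i j)"
      "upper_truncated (\<lambda>i. K i (n - i))" "lower_truncated (\<lambda>i. K i (n - i))"
    unfolding lower_truncated_def upper_truncated_def
    by (rule exI[of _ A] exI[of _ B]; use z in simp)+
  show "lower_truncated (\<lambda>i. tay2 K i j)"
    unfolding lower_truncated_def
  proof (rule exI[of _ A], intro allI impI)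
    fix k assume "k < A"
    then have "K k = (\<lambda>_. 0)" using AB by force
    then show "tay2 K k j = 0" by (simp add: tay2_def)
  qed
  show "lower_truncated (tay1 K i)"
    unfolding lower_truncated_def
  proof (rule exI[of _ A], intro allI impI)
    fix k assume "k < A"
    then have "(\<lambda>m. K m k) = (\<lambda>_. 0)" using AB by force
    then show "tay1 K i k = 0" by (simp add: tay1_def)
  qed
  show "lower_truncated (tayd K i)"
    unfolding lower_truncated_def
  proof (rule exI[of _ "2 * A - i"], intro allI impI)
    fix k assume "k < 2 * A - i"
    then have "(\<lambda>m. K m (i + k - m)) = (\<lambda>_. 0)" using AB by force
    then show "tayd K i k = 0" by (simp add: tayd_def)
  qed
qed

text \<open>With no negative exponents present, y_1^m becomes the polynomial (y_2 + y_0)^m, so none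
  are created.\<close>

lemma tayd_quadrant:
  assumes "\<And>i j. i < 0 \<or> j < 0 \<Longrightarrow> V i j = 0"
  shows "i < 0 \<or> j < 0 \<Longrightarrow> tayd V i j = 0"
proof -
  assume ij: "i < 0 \<or> j < 0"
  have "ibinom m i *s V m (i + j - m) = 0" for m
  proof (cases "m < 0 \<or> i + j < m \<or> i < 0")
    case True
    then show ?thesis using assms[of m "i + j - m"] by auto
  next
    case False
    then show ?thesis using ij ibinom_eq_0[of m i] by simp
  qed
  then show "tayd V i j = 0" 
    by (simp only: tayd_def tay_def pairing_def Sum_any.neutral)
qed

text \<open>Clearing all denominators of \<open>D\<close> leaves a Laurent polynomial, whose expansions are compatible. The
  cleared factors with nonzero constant term are invertible in the iterated Laurent series and can be
  cancelled again; the others are \<open>y\<^sub>1 - y\<^sub>2\<close>, \<open>y\<^sub>1\<close> and \<open>y\<^sub>2\<close>, with poles of \<open>y\<^sub>1/y\<^sub>2\<close> at \<open>0\<close> and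
  \<open>1\<close> only.\<close>

lemma triple_expansions:
  assumes fin: "finsupp (lcs ts D)" and eq: "lcs ts D = lcs ts D'"
    and ts: "\<And>t. t \<in> set ts \<Longrightarrow> fst (shift1 (shift2 t)) = 0 \<Longrightarrow>
        shift1 (shift2 t) \<in> {(0, 1, -1), (0, 1, 0), (0, 0, 1)}"
    and 12: "exp2 D g2 M" "exp1 M g1 e12" "lowA e12"
    and 21: "exp1 D' h1 M'" "exp2 M' h2 e21" "lowB e21"
    and 0: "expd D g0 M0" "exp2 M0 h0 e0" "lowB e0"
  shows "\<exists>rs. set rs \<subseteq> {0, 1} \<and>
    expansions rs (\<lambda>i. e12 i (n - i)) (\<lambda>i. e21 i (n - i)) (\<lambda>i. e0 i (n - i))"
proof -
  define K where "K = lcs ts D"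
  define us where "us = map (shift1 \<circ> shift2) ts"
  have K: "finsupp K" using fin by (simp add: K_def)
  note lt = finsuppD[OF K]
  define T where "T = tay1 (tay2 K)"
  have "exp2 K (lcs ts g2) (lcs (map shift2 ts) M)"
    unfolding K_def by (rule exp2_lcs[OF 12(1)])
  from exp2_tay2[OF this] lt have "lcs (map shift2 ts) M = tay2 K" by simp
  with exp1_lcs[OF 12(2), of "map shift2 ts"]
  have "exp1 (tay2 K) (lcs (map shift2 ts) g1) (lcs us e12)" by (simp add: us_def)
  \<comment> \<open>Clearing commutes with expanding, so the cleared iterated expansion is the
    Taylor series \<open>T\<close> of the Laurent polynomial \<open>K\<close> at (1, 1). The other
    two ways of expanding also lead to \<open>T\<close>, for \<open>e0\<close> after y_1 = y_2 +
    y_0.\<close>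
  from exp1_tay1[OF this] lt have T12: "lcs us e12 = T" by (simp add: T_def)
  have "exp1 K (lcs ts h1) (lcs (map shift1 ts) M')"
    unfolding K_def eq by (rule exp1_lcs[OF 21(1)])
  from exp1_tay1[OF this] lt have "lcs (map shift1 ts) M' = tay1 K" by simp
  moreover have "map shift2 (map shift1 ts) = us" by (auto simp: us_def)
  ultimately have "exp2 (tay1 K) (lcs (map shift1 ts) h2) (lcs us e21)"
    using exp2_lcs[OF 21(2), of "map shift1 ts"] by metis
  from exp2_tay2[OF this] lt have T21: "lcs us e21 = T" by (simp add: T_def tay2_tayd(1)[OF K])
  have "expd K (lcs ts g0) (lcs (map shiftd ts) M0)"
    unfolding K_def by (rule expd_lcs[OF 0(1)])
  from expd_tayd[OF this] lt have "lcs (map shiftd ts) M0 = tayd K" by simp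
  moreover have "map shift2 (map shiftd ts) = map shiftd us" by (auto simp: us_def)
  ultimately have "exp2 (tayd K) (lcs (map shiftd ts) h0) (lcs (map shiftd us) e0)"
    using exp2_lcs[OF 0(2), of "map shiftd ts"] by metis
  from exp2_tay2[OF this] lt have T0: "lcs (map shiftd us) e0 = tayd T"
    by (simp add: T_def tay2_tayd(2)[OF K])
  define un where "un = filter (\<lambda>t. fst t \<noteq> 0) us"
  define nu where "nu = filter (\<lambda>t. \<not> fst t \<noteq> 0) us"
  have split: "lcs us e = lcs un (lcs nu e)" for e
    unfolding un_def nu_def by (rule lcs_partition)
  have fs: "fst (shiftd t) = fst t" for t by (cases t) simp
  have splitd: "lcs (map shiftd us) e = lcs (map shiftd un) (lcs (map shiftd nu) e)" for e
    unfolding un_def nu_def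
    using lcs_partition[of "map shiftd us" e "\<lambda>t. fst t \<noteq> 0"]
    by (simp add: filter_map o_def fs)
  have un: "\<forall>t\<in>set un. fst t \<noteq> 0" "\<forall>t\<in>set (map shiftd un). fst t \<noteq> 0"
    by (auto simp: un_def fs)
  define V12 where "V12 = lcs nu e12"
  define V21 where "V21 = lcs nu e21"
  define V0 where "V0 = lcs (map shiftd nu) e0"
  have low: "lowA V12" "lowB V21" "lowB V0"
    by (simp_all add: V12_def V21_def V0_def 12 21 0 lowA_lcs lowB_lcs)
  have Tq: "T i j = 0" if "i < 0 \<or> j < 0" for i j
  proof (cases "i < 0")
    case True
    then show ?thesis by (simp add: T_def tay1_def tay_neg)
  next
    case False
    then show ?thesis using that by (simp add: T_def tay1_def tay2_def tay_neg)
  qed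
  \<comment> \<open>\<open>T\<close> vanishes off the quadrant of nonnegative exponents, a region
    closed under lowering an index. Cancelling the unit factors there shows that \<open>V12\<close>
    and \<open>V21\<close> vanish there too.\<close>
  let ?Q = "\<lambda>i j. i < (0::int) \<or> j < (0::int)"
  have q12: "V12 i j = 0" if "?Q i j" for i j
    by (rule lcs_unit_cancel[OF low(1) un(1), where Q = ?Q])
      (use that Tq T12 in \<open>auto simp: split V12_def\<close>)
  have q21: "V21 i j = 0" if "?Q i j" for i j
    by (rule lcs_unit_cancel_B[OF low(2) un(1), where Q = ?Q])
      (use that Tq T21 in \<open>auto simp: split V21_def\<close>)
  \<comment> \<open>The crossing between the two spaces of iterated series: being supported in the
    quadrant, \<open>V21\<close> also belongs to the space of \<open>V12\<close>, where units can be
    cancelled from the difference.\<close>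
  have A: "lowA V21"
    using low(2) q21 unfolding lowA_def lower_truncated_def by (meson less_imp_le)
  have V: "V12 = V21"
  proof (rule ext)+
    fix i j
    have "lcs un (\<lambda>i j. V12 i j - V21 i j) i j = 0" for i j
      using T12 T21 by (simp add: lcs_diff split V12_def V21_def)
    from lcs_unit_cancel[OF lowA_diff[OF low(1) A] un(1), of "\<lambda>_ _. True"] this
    show "V12 i j = V21 i j" by simp
  qed
  have q0: "tayd V12 i j = 0" if "?Q i j" for i j
    using tayd_quadrant[of V12] q12 that by blast
  have B: "lowB (tayd V12)"
    using q0 unfolding lowB_def lower_truncated_def by blast
  have dg: "upper_truncated (\<lambda>i. V12 i (n - i)) \<and> lower_truncated (\<lambda>i. V12 i (n - i))" for n
    unfolding upper_truncated_def lower_truncated_def using q12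
    by (intro conjI exI[of _ n] exI[of _ 0]) auto
  have V0: "V0 = tayd V12"
  proof (rule ext)+
    fix i j
    have "lcs (map shiftd un) (tayd V12) = tayd T"
      using tayd_lcs[where K = V12 and ts = un, OF dg] T12 by (simp add: split V12_def)
    then have "lcs (map shiftd un) (\<lambda>i j. V0 i j - tayd V12 i j) i j = 0" for i j
      using T0 by (simp add: lcs_diff splitd V0_def)
    from lcs_unit_cancel_B[OF lowB_diff[OF low(3) B] un(2), of "\<lambda>_ _. True"] this
    show "V0 i j = tayd V12 i j" by simp
  qed
  have "set nu \<subseteq> {(0, 1, -1), (0, 1, 0), (0, 0, 1)}"
  proof
    fix u assume "u \<in> set nu"
    then obtain t where "t \<in> set ts" "u = shift1 (shift2 t)" "fst u = 0"
      unfolding nu_def us_def by auto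
    then show "u \<in> {(0, 1, -1), (0, 1, 0), (0, 0, 1)}" using ts by simp
  qed
  from lcs_monic_diagonal[OF this] obtain rs where rs: "set rs \<subseteq> {0, 1}"
    and dia': "\<forall>e n. (\<lambda>i. lcs nu e i (n + int (length nu) - i)) = lins rs (\<lambda>i. e i (n - i)) \<and>
      (\<lambda>i. lcs (map shiftd nu) e i (n + int (length nu) - i)) = lins (map (\<lambda>r. r - 1) rs) (\<lambda>i. e i (n - i))"
    by (elim exE conjE)
  note dia = dia'[rule_format, THEN conjunct1] dia'[rule_format, THEN conjunct2]
  have "expansions rs (\<lambda>i. e12 i (n - i)) (\<lambda>i. e21 i (n - i)) (\<lambda>i. e0 i (n - i))"
    unfolding expansions_def
  proof (intro conjI)
    obtain J where "\<forall>j<J. \<forall>i. e12 i j = 0" using 12(3) by (auto simp: lowA_def)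
    then have "\<forall>k>n - J. e12 k (n - k) = 0" by auto
    then show "upper_truncated (\<lambda>i. e12 i (n - i))" unfolding upper_truncated_def by blast
    show "lower_truncated (\<lambda>i. e21 i (n - i))" "lower_truncated (\<lambda>i. e0 i (n - i))"
      using 21(3) 0(3) unfolding lowB_def lower_truncated_def by blast+
    show "lins rs (\<lambda>i. e12 i (n - i)) = lins rs (\<lambda>i. e21 i (n - i))"
      unfolding dia[symmetric] using V by (simp add: V12_def V21_def)
    show "lins (map (\<lambda>r. r - 1) rs) (\<lambda>i. e0 i (n - i)) = tay (lins rs (\<lambda>i. e12 i (n - i)))"
      unfolding dia[symmetric] V0_def[symmetric] V12_def[symmetric] V0
      by (simp add: tayd_def)
  qed
  with rs show ?thesis by blast
qed

text \<open>Lowest rows first: row \<open>i\<close> of the equation expresses a shift of row \<open>i\<close> of \<open>\<Delta>\<close>, minus a multiple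
  of it, by row \<open>i - 1\<close>.\<close>

lemma lcs_row_annihilators:
  fixes \<Delta> :: "'x \<Rightarrow> int \<Rightarrow> int \<Rightarrow> 'w"
  assumes "\<And>x i j. lcs ts (\<Delta> x) i j = 0"
    and low: "\<And>x i j. i < I \<Longrightarrow> \<Delta> x i j = 0"
    and ts: "\<And>a b c. (a, b, c) \<in> set ts \<Longrightarrow> c \<noteq> 0 \<or> (a = 0 \<and> b \<noteq> 0)"
  shows "\<exists>rs. \<forall>x. lins rs (\<Delta> x i) = (\<lambda>_. 0)"
proof -
  have step: "\<forall>i. \<exists>rs. \<forall>x. lins rs (E x i) = (\<lambda>_. 0)"
    if E: "\<forall>i. \<exists>rs. \<forall>x. lins rs (lc (a, b, c) (E x) i) = (\<lambda>_. 0)"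
      and I: "\<forall>x i j. i < I \<longrightarrow> E x i j = 0"
      and abc: "c \<noteq> 0 \<or> (a = 0 \<and> b \<noteq> 0)" for E :: "'x \<Rightarrow> int \<Rightarrow> int \<Rightarrow> 'w" and a b c
  proof (cases "c = 0")
    case True
    then have "b \<noteq> 0" "a = 0" using abc by auto
    show ?thesis
    proof
      fix i
      \<comment> \<open>The form is b times the first variable here, so row i + 1 of the equation is
        b times row i of \<open>E x\<close>.\<close>
      obtain rs where "\<forall>x. lins rs (lc (a, b, c) (E x) (i + 1)) = (\<lambda>_. 0)" using E by blast
      then have "(\<lambda>j. b *s lins rs (E x i) j) = (\<lambda>_. 0)" for x
        using lins_comb[of rs b "E x i" 0 "E x i"] by (simp add: lc_apply True \<open>a = 0\<close>)
      then have "\<forall>x. lins rs (E x i) = (\<lambda>_. 0)" using \<open>b \<noteq> 0\<close> by (simp add: fun_eq_iff)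
      then show "\<exists>rs. \<forall>x. lins rs (E x i) = (\<lambda>_. 0)" ..
    qed
  next
    case False
    have "\<exists>rs. \<forall>x. lins rs (E x (I - 1 + int n)) = (\<lambda>_. 0)" for n
    proof (induction n)
      case 0
      have "E x (I - 1 + int 0) = (\<lambda>_. 0)" for x using I by auto
      then show ?case by (intro exI[of _ "[]"]) simp
    next
      case (Suc n)
      let ?i = "I - 1 + int (Suc n)"
      have i: "?i - 1 = I - 1 + int n" by simp
      obtain rs where rs: "\<forall>x. lins rs (E x (?i - 1)) = (\<lambda>_. 0)" using Suc i by metis
      obtain ss where ss: "\<forall>x. lins ss (lc (a, b, c) (E x) ?i) = (\<lambda>_. 0)" using E by blast
      \<comment> \<open>The factor with root -a/c turns row \<open>?i\<close> into a combination of
        the equation's row, killed by \<open>ss\<close>, and the row below, killed by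
        \<open>rs\<close>.\<close>
      have "lins (rs @ ss @ [- a / c]) (E x ?i) = (\<lambda>_. 0)" for x
      proof -
        have "lin (- a / c) (E x ?i)
            = (\<lambda>j. (1 / c) *s lc (a, b, c) (E x) ?i j + (- b / c) *s E x (?i - 1) j)"
          using False by (simp add: lin_def lc_apply fun_eq_iff scale_right_distrib)
        then have "lins (rs @ ss @ [- a / c]) (E x ?i)
            = (\<lambda>j. (1 / c) *s lins rs (lins ss (lc (a, b, c) (E x) ?i)) j
                 + (- b / c) *s lins ss (lins rs (E x (?i - 1))) j)"
          by (simp only: lins_append lins_Cons lins_Nil lins_comb lins_commute[of ss rs])
        then show ?thesis using rs ss by simp
      qed
      then show ?case by blast
    qed
    note n = this
    show ?thesis
    proof
      fix i
      show "\<exists>rs. \<forall>x. lins rs (E x i) = (\<lambda>_. 0)"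
      proof (cases "i < I")
        case True
        then have "E x i = (\<lambda>_. 0)" for x using I by auto
        then show ?thesis by (intro exI[of _ "[]"]) simp
      next
        case False
        then have "I - 1 + int (nat (i - I + 1)) = i" by simp
        then show ?thesis using n[of "nat (i - I + 1)"] by simp
      qed
    qed
  qed
  have "(\<forall>i. \<exists>rs. \<forall>x. lins rs (lcs ts (\<Delta> x) i) = (\<lambda>_. 0)) \<longrightarrow>
      (\<forall>i. \<exists>rs. \<forall>x. lins rs (\<Delta> x i) = (\<lambda>_. 0))"
    using ts
  proof (induction ts)
    case (Cons t ts)
    obtain a b c where t: "t = (a, b, c)" by (cases t)
    have I: "\<forall>x i j. i < I \<longrightarrow> lcs ts (\<Delta> x) i j = 0"
      using lcs_support(1)[of I] low by blast
    have abc: "c \<noteq> 0 \<or> (a = 0 \<and> b \<noteq> 0)" using Cons.prems[of a b c] t by simp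
    have "\<forall>i. \<exists>rs. \<forall>x. lins rs (lcs ts (\<Delta> x) i) = (\<lambda>_. 0)"
      if "\<forall>i. \<exists>rs. \<forall>x. lins rs (lcs (t # ts) (\<Delta> x) i) = (\<lambda>_. 0)"
      using that unfolding t lcs_Cons by (rule step[OF _ I abc])
    moreover have "(\<forall>i. \<exists>rs. \<forall>x. lins rs (lcs ts (\<Delta> x) i) = (\<lambda>_. 0)) \<longrightarrow>
      (\<forall>i. \<exists>rs. \<forall>x. lins rs (\<Delta> x i) = (\<lambda>_. 0))"
      by (rule Cons.IH) (rule Cons.prems, simp)
    ultimately show ?case by blast
  qed simp
  moreover have "lcs ts (\<Delta> x) i = (\<lambda>_. 0)" for x i using assms(1) by auto
  then have "\<forall>i. \<exists>rs. \<forall>x. lins rs (lcs ts (\<Delta> x) i) = (\<lambda>_. 0)" by simp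
  ultimately show ?thesis by blast
qed

end

section \<open>Quasi-local fields\<close>

definition homog_map :: "(complex \<Rightarrow> 'v::ab_group_add \<Rightarrow> 'v) \<Rightarrow> (complex \<Rightarrow> 'w::ab_group_add \<Rightarrow> 'w) \<Rightarrow> ('v \<Rightarrow> 'w) \<Rightarrow> bool" where
  "homog_map s1 s2 T \<longleftrightarrow> (\<forall>x y. T (x + y) = T x + T y) \<and> (\<forall>c x. T (s1 c x) = s2 c (T x))"

context
  fixes s1 :: "complex \<Rightarrow> 'v::ab_group_add \<Rightarrow> 'v" and s2 :: "complex \<Rightarrow> 'w::ab_group_add \<Rightarrow> 'w"
    and T :: "'v \<Rightarrow> 'w"
  assumes s1: "cspace s1" and s2: "cspace s2" and T: "homog_map s1 s2 T"
begin

interpretation V: cspace s1 by (rule s1)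
interpretation W: cspace s2 by (rule s2)

lemma homog_map_simps: "T (x + y) = T x + T y" "T (s1 c x) = s2 c (T x)" "T 0 = 0" "T (x - y) = T x - T y"
  "T (\<Sum>i\<in>I. f i) = (\<Sum>i\<in>I. T (f i))"
proof -
  show add: "T (x + y) = T x + T y" for x y using T by (simp add: homog_map_def)
  interpret additive T by (rule additive.intro) (rule add)
  show "T 0 = 0" "T (x - y) = T x - T y" "T (\<Sum>i\<in>I. f i) = (\<Sum>i\<in>I. T (f i))"
    by (rule zero diff sum)+
  show "T (s1 c x) = s2 c (T x)" using T by (simp add: homog_map_def)
qed

lemma lins_map: "W.lins rs (\<lambda>i. T (F i)) = (\<lambda>i. T (V.lins rs F i))"
  by (induction rs) (simp_all add: V.lins_Cons W.lins_Cons V.lin_def W.lin_def homog_map_simps)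

text \<open>Clearing denominators and the Taylor expansion of a Laurent polynomial are finite linear
  combinations, so a linear map can be applied to all three expansions at once.\<close>

lemma expansions_map:
  assumes e: "V.expansions rs F G C"
  shows "W.expansions rs (\<lambda>i. T (F i)) (\<lambda>i. T (G i)) (\<lambda>i. T (C i))"
proof -
  let ?H = "V.lins rs F"
  have t: "upper_truncated F" "lower_truncated G" "lower_truncated C" "V.lins rs F = V.lins rs G"
    "V.lins (map (\<lambda>r. r - 1) rs) C = V.tay ?H"
    using e by (auto simp: V.expansions_def)
  have fin: "finite {m. ?H m \<noteq> 0}"
    using V.expansions_lins_truncated[OF t(1,2,4)] by (simp add: finite_support_iff)
  have "T (V.tay ?H i) = W.tay (\<lambda>m. T (?H m)) i" for i
  proof -
    have "V.tay ?H i = (\<Sum>m\<in>{m. ?H m \<noteq> 0}. s1 (ibinom m i) (?H m))"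
      by (rule V.tay_eq_sum[OF fin]) simp
    moreover have "W.tay (\<lambda>m. T (?H m)) i = (\<Sum>m\<in>{m. ?H m \<noteq> 0}. s2 (ibinom m i) (T (?H m)))"
      by (rule W.tay_eq_sum[OF fin]) (simp add: homog_map_simps)
    ultimately show ?thesis by (simp add: homog_map_simps)
  qed
  moreover have "upper_truncated (\<lambda>i. T (F i))" "lower_truncated (\<lambda>i. T (G i))" "lower_truncated (\<lambda>i. T (C i))"
    using t(1-3) unfolding upper_truncated_def lower_truncated_def by (metis homog_map_simps(3))+
  ultimately show ?thesis
    using t unfolding W.expansions_def by (simp add: lins_map)
qed

end

context cspace
begin

lemma cspace_scale: "cspace scale" ..

definition vfield :: "(int \<Rightarrow> 'w \<Rightarrow> 'w) \<Rightarrow> bool" where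
  "vfield a \<longleftrightarrow> (\<forall>k. homog_map scale scale (a k)) \<and> (\<forall>w. lower_truncated (\<lambda>k. a k w))"

lemma vfield_homog: "vfield a \<Longrightarrow> homog_map scale scale (a k)"
  by (simp add: vfield_def)

lemma vfield_bound: "vfield a \<Longrightarrow> \<exists>M. \<forall>k<M. a k w = 0"
  by (simp add: vfield_def lower_truncated_def)

lemma vfield_zero: "vfield a \<Longrightarrow> a k 0 = 0"
  using homog_map_simps(3)[OF cspace_scale cspace_scale vfield_homog] .

definition opF :: "(int \<Rightarrow> 'w \<Rightarrow> 'w) \<Rightarrow> (int \<Rightarrow> 'w \<Rightarrow> 'w) \<Rightarrow> int \<Rightarrow> 'w \<Rightarrow> int \<Rightarrow> 'w" where
  "opF a b N w i = a i (b (N - i) w)"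

definition opG :: "(int \<Rightarrow> 'w \<Rightarrow> 'w) \<Rightarrow> (int \<Rightarrow> 'w \<Rightarrow> 'w) \<Rightarrow> int \<Rightarrow> 'w \<Rightarrow> int \<Rightarrow> 'w" where
  "opG a b N w i = b (N - i) (a i w)"

lemma opF_eq: "opF a b N w = (\<lambda>i. a i (b (N - i) w))"
  and opG_eq: "opG a b N w = (\<lambda>i. b (N - i) (a i w))"
  by (auto simp: opF_def opG_def)

text \<open>The roots are uniform in \<open>N\<close> and \<open>w\<close>: this is commutation of
  the fields after multiplication by the one homogeneous polynomial whose factors are the x_1 - r
  x_2.\<close>

definition qlocal :: "(int \<Rightarrow> 'w \<Rightarrow> 'w) \<Rightarrow> (int \<Rightarrow> 'w \<Rightarrow> 'w) \<Rightarrow> bool" where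
  "qlocal a b \<longleftrightarrow> (\<exists>rs. \<forall>N w. lins rs (opF a b N w) = lins rs (opG a b N w))"

definition ope :: "complex list \<Rightarrow> (int \<Rightarrow> 'w \<Rightarrow> 'w) \<Rightarrow> (int \<Rightarrow> 'w \<Rightarrow> 'w) \<Rightarrow> (int \<Rightarrow> int \<Rightarrow> 'w \<Rightarrow> 'w) \<Rightarrow> bool" where
  "ope rs a b C \<longleftrightarrow> (\<forall>N w. expansions rs (opF a b N w) (opG a b N w) (\<lambda>i. C i (N - i) w))"

text \<open>The coefficient of \<open>x\<^sub>0^i\<close> in \<open>Y(a, x\<^sub>0) b\<close>; unspecified if \<open>a\<close> and \<open>b\<close> are not
  quasi-local.\<close>

definition vprod :: "(int \<Rightarrow> 'w \<Rightarrow> 'w) \<Rightarrow> (int \<Rightarrow> 'w \<Rightarrow> 'w) \<Rightarrow> int \<Rightarrow> int \<Rightarrow> 'w \<Rightarrow> 'w" where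
  "vprod a b i k w = (THE C. \<exists>rs. expansions rs (opF a b (i + k) w) (opG a b (i + k) w) C) i"

lemma opF_truncated: "vfield a \<Longrightarrow> vfield b \<Longrightarrow> upper_truncated (opF a b N w)"
proof -
  assume ab: "vfield a" "vfield b"
  have "upper_truncated (\<lambda>i. b (N - i) w)"
    using ab(2) truncated_reflect(1)[of "\<lambda>k. b k w" N] by (simp add: vfield_def)
  then show ?thesis
    using vfield_zero[OF ab(1)] unfolding upper_truncated_def opF_def by metis
qed

lemma opG_truncated: "vfield a \<Longrightarrow> vfield b \<Longrightarrow> lower_truncated (opG a b N w)"
proof -
  assume ab: "vfield a" "vfield b"
  then have "lower_truncated (\<lambda>i. a i w)" by (simp add: vfield_def)
  then show ?thesis
    using vfield_zero[OF ab(2)] unfolding lower_truncated_def opG_def by metis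
qed

lemma expansions_vprod:
  assumes "expansions rs (opF a b N w) (opG a b N w) C"
  shows "C = (\<lambda>i. vprod a b i (N - i) w)"
proof -
  have "(THE C. \<exists>rs. expansions rs (opF a b N w) (opG a b N w) C) = C"
    using assms expansions_unique(1) by (blast intro: the_equality)
  then show ?thesis by (simp add: vprod_def fun_eq_iff)
qed

lemma ope_unique: "ope rs a b C \<Longrightarrow> C = vprod a b"
proof (rule ext)+
  fix i k w
  assume "ope rs a b C"
  then have "(\<lambda>i'. C i' (i + k - i') w) = (\<lambda>i'. vprod a b i' (i + k - i') w)"
    unfolding ope_def using expansions_vprod by blast
  from fun_cong[OF this, of i] show "C i k w = vprod a b i k w" by simp
qed

lemma ope_vprod_lins:
  assumes "vfield a" "vfield b" "\<And>N w. lins rs (opF a b N w) = lins rs (opG a b N w)"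
  shows "ope rs a b (vprod a b)"
  unfolding ope_def
proof (intro allI)
  fix N w
  obtain C where C: "expansions rs (opF a b N w) (opG a b N w) C"
    using expansions_exists[OF opF_truncated opG_truncated] assms by blast
  with expansions_vprod[OF C]
  show "expansions rs (opF a b N w) (opG a b N w) (\<lambda>i. vprod a b i (N - i) w)" by simp
qed

lemma ope_vprod: "vfield a \<Longrightarrow> vfield b \<Longrightarrow> qlocal a b \<Longrightarrow> \<exists>rs. ope rs a b (vprod a b)"
  unfolding qlocal_def using ope_vprod_lins by blast

lemma ope_qlocal: "ope rs a b C \<Longrightarrow> qlocal a b"
  unfolding ope_def qlocal_def expansions_def by blast

lemma opF_comb: "vfield a \<Longrightarrow> vfield b \<Longrightarrow> opF a b N (c *s w + d *s w') = (\<lambda>i. c *s opF a b N w i + d *s opF a b N w' i)"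
  and opG_comb: "vfield a \<Longrightarrow> vfield b \<Longrightarrow> opG a b N (c *s w + d *s w') = (\<lambda>i. c *s opG a b N w i + d *s opG a b N w' i)"
  by (simp_all add: opF_def opG_def fun_eq_iff vfield_def homog_map_def)

text \<open>Linearity in w comes from uniqueness of expansions. For truncation, the cleared series
  has exponents at least A because of \<open>opG\<close>, and at most N - B + length rs because of
  \<open>opF\<close>. For small N these bounds exclude each other, so the whole slice of total
  degree N is 0.\<close>

lemma vfield_vprod:
  assumes a: "vfield a" "vfield b" and loc: "qlocal a b"
  shows "vfield (vprod a b i)"
  unfolding vfield_def
proof (intro conjI allI)
  obtain rs where rs: "ope rs a b (vprod a b)" using ope_vprod[OF assms] by blast
  then have e: "expansions rs (opF a b N w) (opG a b N w) (\<lambda>i. vprod a b i (N - i) w)" for N w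
    by (simp add: ope_def)
  fix k
  have comb: "vprod a b i k (c *s w + d *s w') = c *s vprod a b i k w + d *s vprod a b i k w'" for c d w w'
  proof -
    have "expansions (rs @ rs) (opF a b (i + k) (c *s w + d *s w')) (opG a b (i + k) (c *s w + d *s w'))
      (\<lambda>i'. c *s vprod a b i' (i + k - i') w + d *s vprod a b i' (i + k - i') w')"
      using expansions_comb[OF e[of "i + k" w] e[of "i + k" w'], of c d] a
      by (simp add: opF_comb opG_comb)
    from fun_cong[OF expansions_vprod[OF this], of i] show ?thesis by simp
  qed
  show "homog_map scale scale (vprod a b i k)"
    unfolding homog_map_def
  proof (intro conjI allI)
    show "vprod a b i k (x + y) = vprod a b i k x + vprod a b i k y" for x y
      using comb[of 1 x 1 y] by simp
    show "vprod a b i k (c *s x) = c *s vprod a b i k x" for c x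
      using comb[of c x 0 x] by simp
  qed
next
  fix w
  obtain rs where rs: "ope rs a b (vprod a b)" using ope_vprod[OF assms] by blast
  then have e: "expansions rs (opF a b N w) (opG a b N w) (\<lambda>i. vprod a b i (N - i) w)" for N
    by (simp add: ope_def)
  obtain A where A: "\<forall>i<A. a i w = 0" using vfield_bound[OF a(1)] by blast
  obtain B where B: "\<forall>i<B. b i w = 0" using vfield_bound[OF a(2)] by blast
  have "vprod a b i (N - i) w = 0" if N: "N < A + B - int (length rs)" for N
  proof -
    have G: "lins rs (opF a b N w) m = 0" if "m < A" for m
    proof -
      have "\<forall>i<A. opG a b N w i = 0" using A vfield_zero[OF a(2)] by (simp add: opG_def)
      then have "lins rs (opG a b N w) m = 0"
        using lcs_support(1)[of A "\<lambda>i j. opG a b N w i" "map (\<lambda>r. (- r, 1, 0)) rs"] that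
        by (simp add: lcs_column)
      then show ?thesis using e[of N] by (simp add: expansions_def)
    qed
    let ?e = "\<lambda>i j. if j = (0::int) then opF a b N w i else 0"
    have "\<forall>i j. i + j > N - B \<longrightarrow> ?e i j = 0"
      using B vfield_zero[OF a(1)] by (simp add: opF_def)
    from lcs_support(3)[OF this, of "map (\<lambda>r. (- r, 1, 0)) rs"]
    have F: "lins rs (opF a b N w) m = 0" if "m > N - B + int (length rs)" for m
      using that lcs_column[of rs ?e m 0] by auto
    have "lins rs (opF a b N w) = (\<lambda>_. 0)"
    proof
      fix m show "lins rs (opF a b N w) m = 0"
        using F[of m] G[of m] N by linarith
    qed
    then have z: "opF a b N w = (\<lambda>_. 0)" "opG a b N w = (\<lambda>_. 0)"
      using lins_upper_eq_0 lins_lower_eq_0 e[of N] by (auto simp: expansions_def)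
    from e[of N] have "(\<lambda>i. vprod a b i (N - i) w) = tay (\<lambda>_. 0)"
      unfolding z by (rule expansions_finite_eq) (simp add: lower_truncated_def)
    then show ?thesis by (simp add: fun_eq_iff)
  qed
  then have "vprod a b i k w = 0" if "k < A + B - int (length rs) - i" for k
    using that \<open>\<And>N. N < A + B - int (length rs) \<Longrightarrow> vprod a b i (N - i) w = 0\<close>[of "k + i"] by simp
  then show "lower_truncated (\<lambda>k. vprod a b i k w)" unfolding lower_truncated_def by blast
qed

lemma vprod_below:
  assumes "vfield a" "vfield b" "qlocal a b"
  shows "\<exists>I. \<forall>i<I. vprod a b i = (\<lambda>k w. 0)"
proof -
  obtain rs where rs: "ope rs a b (vprod a b)" using ope_vprod[OF assms] by blast
  have "vprod a b i k w = 0" if "i < - int (length rs)" for i k w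
    using expansions_below(1)[of rs "opF a b (i + k) w" "opG a b (i + k) w" "\<lambda>i'. vprod a b i' (i + k - i') w" i]
      rs that by (simp add: ope_def)
  then show ?thesis by blast
qed

lemma vprod_zero:
  assumes "vfield a"
  shows "vprod a (\<lambda>k w. 0) = (\<lambda>i k w. 0)" and "vprod (\<lambda>k w. 0) a = (\<lambda>i k w. 0)"
proof -
  have "ope [] a (\<lambda>k w. 0) (\<lambda>i k w. 0)"  "ope [] (\<lambda>k w. 0) a (\<lambda>i k w. 0)"
    using expansions_finite[of "\<lambda>_. 0"]
    by (simp_all add: ope_def opF_eq opG_eq vfield_zero[OF assms] upper_truncated_def lower_truncated_def)
  then show "vprod a (\<lambda>k w. 0) = (\<lambda>i k w. 0)" and "vprod (\<lambda>k w. 0) a = (\<lambda>i k w. 0)"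
    using ope_unique by fastforce+
qed

lemma lins_strip_zeros: "lins rs F = (\<lambda>_. 0) \<Longrightarrow> lins (filter (\<lambda>r. r \<noteq> 0) rs) F = (\<lambda>_. 0)"
proof (induction rs arbitrary: F)
  case (Cons r rs)
  show ?case
  proof (cases "r = 0")
    case True
    have "lins rs F i = 0" for i
      using fun_cong[OF Cons.prems, of "i + 1"] True by (simp add: lins_Cons lin_def)
    then show ?thesis using Cons.IH True by auto
  next
    case False
    have "lins rs (lin r F) = (\<lambda>_. 0)" using Cons.prems by (simp add: lins_Cons lins_lin)
    from Cons.IH[OF this] show ?thesis using False by (simp add: lins_Cons lins_lin)
  qed
qed simp

lemma lins_reflect:
  "0 \<notin> set rs \<Longrightarrow> lins rs F = (\<lambda>_. 0) \<Longrightarrow> lins (map inverse rs) (\<lambda>i. F (N - i)) = (\<lambda>_. 0)"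
proof (induction rs arbitrary: F N)
  case Nil
  then have "F x = 0" for x by (simp add: fun_eq_iff)
  then show ?case by simp
next
  case (Cons r rs)
  have "lins rs (lin r F) = (\<lambda>_. 0)" using Cons.prems by (simp add: lins_Cons lins_lin)
  with Cons have "lins (map inverse rs) (\<lambda>i. lin r F (N + 1 - i)) = (\<lambda>_. 0)" by simp
  moreover have "lin (inverse r) (\<lambda>i. F (N - i)) = (\<lambda>i. (- inverse r) *s lin r F (N + 1 - i) + 0 *s lin r F (N + 1 - i))"
    using Cons.prems by (simp add: lin_def fun_eq_iff scale_right_diff_distrib algebra_simps)
  ultimately show ?case by (simp only: list.map lins_Cons lins_lin[symmetric] lins_comb) simp
qed

text \<open>Exchanging the fields replaces z by 1/z and each root by its inverse. Zero roots are
  removed beforehand, which is possible since multiplication by z is invertible.\<close>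

lemma qlocal_sym: "qlocal a b \<Longrightarrow> qlocal b a"
proof -
  assume "qlocal a b"
  then obtain rs where rs: "\<forall>N w. lins rs (opF a b N w) = lins rs (opG a b N w)"
    unfolding qlocal_def by blast
  have "lins rs (\<lambda>i. opF a b N w i - opG a b N w i) = (\<lambda>_. 0)" for N w
    unfolding lins_diff using rs by simp
  note strip = lins_strip_zeros[OF this]
  have "lins (map inverse (filter (\<lambda>r. r \<noteq> 0) rs)) (\<lambda>i. opF a b N w (N - i) - opG a b N w (N - i)) = (\<lambda>_. 0)" for N w
    by (rule lins_reflect[where F = "\<lambda>i. opF a b N w i - opG a b N w i"]) (simp, rule strip)
  moreover have "(\<lambda>i. opF a b N w (N - i)) = opG b a N w" "(\<lambda>i. opG a b N w (N - i)) = opF b a N w" for N w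
    by (auto simp: opF_def opG_def)
  ultimately show ?thesis unfolding qlocal_def lins_diff
    by (intro exI[of _ "map inverse (filter (\<lambda>r. r \<noteq> 0) rs)"]) (simp add: fun_eq_iff)
qed

end

section \<open>Three mutually quasi-local fields\<close>

locale local_triple = cspace scale
  for scale :: "complex \<Rightarrow> 'w::ab_group_add \<Rightarrow> 'w" +
  fixes a b c :: "int \<Rightarrow> 'w \<Rightarrow> 'w" and P Q R :: "complex list"
  assumes fields: "vfield a" "vfield b" "vfield c"
    and P: "\<And>N w. lins P (opF a b N w) = lins P (opG a b N w)"
    and Q: "\<And>N w. lins Q (opF a c N w) = lins Q (opG a c N w)"
    and R: "\<And>N w. lins R (opF b c N w) = lins R (opG b c N w)"
begin

text \<open>The common denominator of all orders of the three fields, where z_1 and z_2 are the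
  arguments of a and b divided by that of c.\<close>

definition ts :: "(complex \<times> complex \<times> complex) list" where
  "ts = map (\<lambda>r. (0, 1, - r)) P @ map (\<lambda>r. (- r, 1, 0)) Q @ map (\<lambda>r. (- r, 0, 1)) R"

lemmas map_a = lins_map[OF cspace_scale cspace_scale vfield_homog[OF fields(1)]]
  and map_b = lins_map[OF cspace_scale cspace_scale vfield_homog[OF fields(2)]]

lemmas zeros = fields[THEN vfield_zero]

lemma ts_rotate:
  "lcs ts e = lcs (map (\<lambda>r. (0, 1, - r)) P @ map (\<lambda>r. (- r, 1, 0)) Q) (lcs (map (\<lambda>r. (- r, 0, 1)) R) e)"
  "lcs ts e = lcs (map (\<lambda>r. (0, 1, - r)) P @ map (\<lambda>r. (- r, 0, 1)) R) (lcs (map (\<lambda>r. (- r, 1, 0)) Q) e)"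
  "lcs ts e = lcs (map (\<lambda>r. (- r, 1, 0)) Q @ map (\<lambda>r. (- r, 0, 1)) R) (lcs (map (\<lambda>r. (0, 1, - r)) P) e)"
  unfolding ts_def lcs_append
  by (simp_all only: lcs_commute[of "map (\<lambda>r. (- r, 1, 0)) Q" "map (\<lambda>r. (- r, 0, 1)) R"]
    lcs_commute[of "map (\<lambda>r. (0, 1, - r)) P" "map (\<lambda>r. (- r, 0, 1)) R"]
    lcs_commute[of "map (\<lambda>r. (0, 1, - r)) P" "map (\<lambda>r. (- r, 1, 0)) Q"])

context
  fixes N :: int and w :: 'w
begin

text \<open>In whichever order the operators are applied, i is the exponent belonging to a, j the
  one belonging to b, and N - i - j the one belonging to c.\<close>

definition "abc = (\<lambda>i j. a i (b j (c (N - i - j) w)))"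
definition "acb = (\<lambda>i j. a i (c (N - i - j) (b j w)))"
definition "cab = (\<lambda>i j. c (N - i - j) (a i (b j w)))"
definition "bac = (\<lambda>i j. b j (a i (c (N - i - j) w)))"
definition "bca = (\<lambda>i j. b j (c (N - i - j) (a i w)))"
definition "cba = (\<lambda>i j. c (N - i - j) (b j (a i w)))"

lemma abc_acb: "lcs ts abc = lcs ts acb"
proof -
  have "lcs (map (\<lambda>r. (- r, 0, 1)) R) abc = lcs (map (\<lambda>r. (- r, 0, 1)) R) acb"
  proof (rule ext)+
    fix i j
    have "abc i = (\<lambda>j. a i (opF b c (N - i) w j))" "acb i = (\<lambda>j. a i (opG b c (N - i) w j))"
      by (simp_all add: abc_def acb_def opF_eq opG_eq)
    then show "lcs (map (\<lambda>r. (- r, 0, 1)) R) abc i j = lcs (map (\<lambda>r. (- r, 0, 1)) R) acb i j"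
      by (simp only: lcs_row map_a R)
  qed
  then show ?thesis by (simp add: ts_rotate(1))
qed

lemma acb_cab: "lcs ts acb = lcs ts cab"
proof -
  have "lcs (map (\<lambda>r. (- r, 1, 0)) Q) acb = lcs (map (\<lambda>r. (- r, 1, 0)) Q) cab"
  proof (rule ext)+
    fix i j
    have "(\<lambda>i. acb i j) = opF a c (N - j) (b j w)" "(\<lambda>i. cab i j) = opG a c (N - j) (b j w)"
      by (auto simp: acb_def cab_def opF_eq opG_eq algebra_simps)
    then show "lcs (map (\<lambda>r. (- r, 1, 0)) Q) acb i j = lcs (map (\<lambda>r. (- r, 1, 0)) Q) cab i j"
      by (simp only: lcs_column Q)
  qed
  then show ?thesis by (simp add: ts_rotate(2))
qed

lemma bac_bca: "lcs ts bac = lcs ts bca"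
proof -
  have "lcs (map (\<lambda>r. (- r, 1, 0)) Q) bac = lcs (map (\<lambda>r. (- r, 1, 0)) Q) bca"
  proof (rule ext)+
    fix i j
    have "(\<lambda>i. bac i j) = (\<lambda>i. b j (opF a c (N - j) w i))" "(\<lambda>i. bca i j) = (\<lambda>i. b j (opG a c (N - j) w i))"
      by (auto simp: bac_def bca_def opF_eq opG_eq algebra_simps)
    then show "lcs (map (\<lambda>r. (- r, 1, 0)) Q) bac i j = lcs (map (\<lambda>r. (- r, 1, 0)) Q) bca i j"
      by (simp only: lcs_column map_b Q)
  qed
  then show ?thesis by (simp add: ts_rotate(2))
qed

lemma abc_bac: "lcs ts abc = lcs ts bac"
proof -
  have "lcs (map (\<lambda>r. (0, 1, - r)) P) abc = lcs (map (\<lambda>r. (0, 1, - r)) P) bac"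
  proof (rule ext)+
    fix i j
    have "(\<lambda>m. abc m (n - m)) = opF a b n (c (N - n) w)" "(\<lambda>m. bac m (n - m)) = opG a b n (c (N - n) w)" for n
      by (auto simp: abc_def bac_def opF_eq opG_eq)
    then show "lcs (map (\<lambda>r. (0, 1, - r)) P) abc i j = lcs (map (\<lambda>r. (0, 1, - r)) P) bac i j"
      by (simp only: lcs_diagonal P)
  qed
  then show ?thesis by (simp add: ts_rotate(3))
qed

text \<open>After clearing, all orders give the same coefficients, and each order contributes a
  bound: \<open>bca\<close> bounds i below, \<open>acb\<close> bounds j below, and
  \<open>abc\<close> bounds i + j above. Together they confine the support to a triangle.\<close>

lemma finsupp_abc: "finsupp (lcs ts abc)"
proof -
  obtain A where "\<forall>i<A. a i w = 0" using vfield_bound[OF fields(1)] by blast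
  then have "\<forall>i<A. \<forall>j. bca i j = 0" by (simp add: zeros bca_def)
  then have 1: "\<forall>i<A. \<forall>j. lcs ts abc i j = 0" unfolding abc_bac bac_bca by (rule lcs_support(1))
  obtain B where "\<forall>i<B. b i w = 0" using vfield_bound[OF fields(2)] by blast
  then have "\<forall>j<B. \<forall>i. acb i j = 0" by (simp add: zeros acb_def)
  then have 2: "\<forall>j<B. \<forall>i. lcs ts abc i j = 0" unfolding abc_acb by (rule lcs_support(2))
  obtain C where "\<forall>i<C. c i w = 0" using vfield_bound[OF fields(3)] by blast
  then have "\<forall>i j. i + j > N - C \<longrightarrow> abc i j = 0" by (simp add: zeros abc_def)
  then have 3: "\<forall>i j. i + j > N - C + int (length ts) \<longrightarrow> lcs ts abc i j = 0" by (rule lcs_support(3))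
  let ?M = "N - C + int (length ts)"
  show ?thesis
    unfolding finsupp_def
  proof (rule exI[of _ "min A B"], rule exI[of _ "?M - min A B"], intro allI impI)
    fix i j assume "lcs ts abc i j \<noteq> 0"
    then have "\<not> i < A" "\<not> j < B" "\<not> i + j > ?M" using 1 2 3 by blast+
    then show "min A B \<le> i \<and> i \<le> ?M - min A B \<and> min A B \<le> j \<and> j \<le> ?M - min A B" by linarith
  qed
qed

lemma expd_abc: "expd abc bac (\<lambda>i j. vprod a b i j (c (N - i - j) w))"
  unfolding expd_def
proof
  fix n
  have "expansions P (opF a b n (c (N - n) w)) (opG a b n (c (N - n) w)) (\<lambda>i. vprod a b i (n - i) (c (N - n) w))"
    using ope_vprod_lins[OF fields(1,2) P] by (simp add: ope_def)
  then show "\<exists>rs. expansions rs (\<lambda>i. abc i (n - i)) (\<lambda>i. bac i (n - i)) (\<lambda>i. vprod a b i (n - i) (c (N - i - (n - i)) w))"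
    by (intro exI[of _ P]) (simp add: abc_def bac_def opF_eq opG_eq)
qed

lemma expd_cab: "expd cab cba (\<lambda>i j. c (N - i - j) (vprod a b i j w))"
  unfolding expd_def
proof
  fix n
  have "expansions P (opF a b n w) (opG a b n w) (\<lambda>i. vprod a b i (n - i) w)"
    using ope_vprod_lins[OF fields(1,2) P] by (simp add: ope_def)
  from expansions_map[OF cspace_scale cspace_scale vfield_homog[OF fields(3), of "N - n"] this]
  show "\<exists>rs. expansions rs (\<lambda>i. cab i (n - i)) (\<lambda>i. cba i (n - i)) (\<lambda>i. c (N - i - (n - i)) (vprod a b i (n - i) w))"
    by (intro exI[of _ P]) (simp add: cab_def cba_def opF_eq opG_eq)
qed

text \<open>\<open>abc\<close> and \<open>cab\<close> become the same Laurent polynomial when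
  cleared. Expanding it at z_1 = z_2 puts \<open>vprod a b\<close> to the left of c in one reading
  and to the right of c in the other.\<close>

lemma dong_relation:
  "lcs (map shiftd ts) (\<lambda>i j. vprod a b i j (c (N - i - j) w) - c (N - i - j) (vprod a b i j w)) i j = 0"
proof -
  have K: "lcs ts cab = lcs ts abc" by (simp add: abc_acb acb_cab)
  have "lcs (map shiftd ts) (\<lambda>i j. vprod a b i j (c (N - i - j) w)) = tayd (lcs ts abc)"
    using expd_tayd[OF expd_lcs[OF expd_abc, of ts]] finsuppD(4)[OF finsupp_abc] by simp
  moreover have "lcs (map shiftd ts) (\<lambda>i j. c (N - i - j) (vprod a b i j w)) = tayd (lcs ts abc)"
    using expd_tayd[OF expd_lcs[OF expd_cab, of ts]] finsuppD(4)[OF finsupp_abc] by (simp add: K)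
  ultimately show ?thesis by (simp add: lcs_diff)
qed

end

end

context cspace
begin

text \<open>Dong's lemma for quasi-local fields.\<close>

lemma qlocal_vprod:
  assumes fields: "vfield a" "vfield b" "vfield c"
    and loc: "qlocal a b" "qlocal a c" "qlocal b c"
  shows "qlocal (vprod a b i) c"
proof -
  obtain P where P: "\<forall>N w. lins P (opF a b N w) = lins P (opG a b N w)"
    using loc(1) unfolding qlocal_def by blast
  obtain Q where Q: "\<forall>N w. lins Q (opF a c N w) = lins Q (opG a c N w)"
    using loc(2) unfolding qlocal_def by blast
  obtain R where R: "\<forall>N w. lins R (opF b c N w) = lins R (opG b c N w)"
    using loc(3) unfolding qlocal_def by blast
  interpret local_triple scale a b c P Q R
    by unfold_locales (use fields P Q R in simp_all)
  obtain I where I: "\<And>i. i < I \<Longrightarrow> vprod a b i = (\<lambda>k w. 0)" using vprod_below[OF fields(1,2) loc(1)] by blast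
  \<comment> \<open>Rows are indexed by the power of x_0 and the family by the pair of total degree
    and vector, so the annihilating roots come out uniform in both.\<close>
  let ?D = "\<lambda>(N, w) i j. vprod a b i j (c (N - i - j) w) - c (N - i - j) (vprod a b i j w)"
  have "\<exists>rs. \<forall>x. lins rs (?D x i) = (\<lambda>_. 0)"
  proof (rule lcs_row_annihilators[where ts = "map shiftd ts" and I = I])
    show "lcs (map shiftd ts) (?D x) i j = 0" for x i j
      by (cases x) (simp add: dong_relation)
    show "?D x i j = 0" if "i < I" for x i j
      using I[OF that] vfield_zero[OF fields(3)] by (cases x) simp
    \<comment> \<open>Under z_1 = z_2 + y_0 the three kinds of factors become y_0 + (1 - r) z_2, -r
      + y_0 + z_2 and -r + z_2. Only the first can lose z_2, for r = 1, and then it is y_0.\<close>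
    show "\<gamma> \<noteq> 0 \<or> \<alpha> = 0 \<and> \<beta> \<noteq> 0" if "(\<alpha>, \<beta>, \<gamma>) \<in> set (map shiftd ts)" for \<alpha> \<beta> \<gamma>
    proof -
      have "\<forall>t\<in>set (map shiftd ts). snd (snd t) \<noteq> 0 \<or> fst t = 0 \<and> fst (snd t) \<noteq> 0"
        by (simp add: ts_def ball_Un)
      from bspec[OF this that] show ?thesis by simp
    qed
  qed
  then obtain rs where rs: "\<And>N w. lins rs (?D (N, w) i) = (\<lambda>_. 0)" by blast
  have "lins rs (opF (vprod a b i) c N w) = lins rs (opG (vprod a b i) c N w)" for N w
  proof -
    have "?D (N + i, w) i = (\<lambda>j. opF (vprod a b i) c N w j - opG (vprod a b i) c N w j)"
      by (simp add: opF_def opG_def)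
    then show ?thesis using rs[of "N + i" w] by (simp add: lins_diff fun_eq_iff)
  qed
  then show ?thesis unfolding qlocal_def by blast
qed

text \<open>In contrast to the fields themselves, their actions by \<open>vprod\<close> have no poles besides \<open>0\<close> and the
  coincidence of the arguments.\<close>

lemma vprod_jacobi:
  assumes fields: "vfield a" "vfield b" "vfield c"
    and loc: "qlocal a b" "qlocal a c" "qlocal b c"
  shows "\<exists>rs. set rs \<subseteq> {0, 1} \<and> expansions rs (\<lambda>i. vprod a (vprod b c (n - i)) i k w)
    (\<lambda>i. vprod b (vprod a c i) (n - i) k w) (\<lambda>i. vprod (vprod a b i) c (n - i) k w)"
proof -
  obtain P where P: "\<forall>N w. lins P (opF a b N w) = lins P (opG a b N w)"
    using loc(1) unfolding qlocal_def by blast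
  obtain Q where Q: "\<forall>N w. lins Q (opF a c N w) = lins Q (opG a c N w)"
    using loc(2) unfolding qlocal_def by blast
  obtain R where R: "\<forall>N w. lins R (opF b c N w) = lins R (opG b c N w)"
    using loc(3) unfolding qlocal_def by blast
  interpret local_triple scale a b c P Q R
    by unfold_locales (use fields P Q R in simp_all)
  have vf: "vfield (vprod a b i)" "vfield (vprod a c i)" "vfield (vprod b c i)" for i
    using fields loc by (simp_all add: vfield_vprod)
  have loc': "qlocal (vprod a b i) c" "qlocal b (vprod a c i)" "qlocal a (vprod b c i)" for i
    using fields loc by (auto intro: qlocal_vprod qlocal_sym)
  define N where "N = n + k"
  \<comment> \<open>In \<open>?e12\<close> and \<open>?e21\<close> the indices i and j are the
    exponents of the expansion parameters of a and b at c. In \<open>?e0\<close>, i belongs to a at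
    b and j to the resulting product at c.\<close>
  let ?e12 = "\<lambda>i j. vprod a (vprod b c j) i (N - j - i) w"
  let ?e21 = "\<lambda>i j. vprod b (vprod a c i) j (N - i - j) w"
  let ?e0 = "\<lambda>i j. vprod (vprod a b i) c j (N - i - j) w"
  have ex: "\<exists>rs. expansions rs (opF x y N w) (opG x y N w) (\<lambda>i. vprod x y i (N - i) w)"
    if "vfield x" "vfield y" "qlocal x y" for x y N w
    using ope_vprod[OF that] by (auto simp: ope_def)
  have low: "lower_truncated (\<lambda>i. vprod x y i (N - i) w)" if "vfield x" "vfield y" "qlocal x y" for x y N
    using ex[OF that] by (auto simp: expansions_def)
  have "\<exists>rs. set rs \<subseteq> {0, 1} \<and> expansions rs (\<lambda>i. ?e12 i (n - i)) (\<lambda>i. ?e21 i (n - i)) (\<lambda>i. ?e0 i (n - i))"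
  proof (rule triple_expansions[OF finsupp_abc[of N w] abc_bac[of N w]])
    \<comment> \<open>In all three families the constant term after shifting to (1, 1) is 1 -
      r.\<close>
    show "shift1 (shift2 t) \<in> {(0, 1, - 1), (0, 1, 0), (0, 0, 1)}"
      if "t \<in> set ts" "fst (shift1 (shift2 t)) = 0" for t
      using that by (auto simp: ts_def)
    show "exp2 (abc N w) (\<lambda>i j. a i (opG b c (N - i) w j)) (\<lambda>i j. a i (vprod b c j (N - i - j) w))"
      unfolding exp2_def
    proof
      fix i
      obtain rs where "expansions rs (opF b c (N - i) w) (opG b c (N - i) w) (\<lambda>j. vprod b c j (N - i - j) w)"
        using ex fields loc by blast
      from expansions_map[OF cspace_scale cspace_scale vfield_homog[OF fields(1), of i] this]
      show "\<exists>rs. expansions rs (abc N w i) (\<lambda>j. a i (opG b c (N - i) w j)) (\<lambda>j. a i (vprod b c j (N - i - j) w))"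
        by (auto simp: abc_def opF_eq)
    qed
    show "exp1 (\<lambda>i j. a i (vprod b c j (N - i - j) w)) (\<lambda>i j. opG a (vprod b c j) (N - j) w i) ?e12"
      unfolding exp1_def
    proof
      fix j
      have "(\<lambda>i. a i (vprod b c j (N - i - j) w)) = opF a (vprod b c j) (N - j) w"
        by (auto simp: opF_eq algebra_simps)
      then show "\<exists>rs. expansions rs (\<lambda>i. a i (vprod b c j (N - i - j) w)) (\<lambda>i. opG a (vprod b c j) (N - j) w i) (\<lambda>i. ?e12 i j)"
        using ex[of a "vprod b c j" "N - j" w] fields vf loc' by simp
    qed
    show "lowA ?e12"
      unfolding lowA_def
    proof (intro conjI allI)
      obtain J where J: "\<forall>j<J. vprod b c j = (\<lambda>k w. 0)"
        using vprod_below fields loc by blast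
      then have "\<forall>j<J. \<forall>i. ?e12 i j = 0" using vprod_zero[OF fields(1)] by simp
      then show "\<exists>J. \<forall>j<J. \<forall>i. ?e12 i j = 0" by blast
      show "lower_truncated (\<lambda>i. ?e12 i j)" for j
        using low[of a "vprod b c j" "N - j"] fields vf loc' by simp
    qed
    show "exp1 (bac N w) (\<lambda>i j. b j (opG a c (N - j) w i)) (\<lambda>i j. b j (vprod a c i (N - j - i) w))"
      unfolding exp1_def
    proof
      fix j
      obtain rs where "expansions rs (opF a c (N - j) w) (opG a c (N - j) w) (\<lambda>i. vprod a c i (N - j - i) w)"
        using ex fields loc by blast
      from expansions_map[OF cspace_scale cspace_scale vfield_homog[OF fields(2), of j] this]
      have "\<exists>rs. expansions rs (\<lambda>i. b j (opF a c (N - j) w i)) (\<lambda>i. b j (opG a c (N - j) w i)) (\<lambda>i. b j (vprod a c i (N - j - i) w))"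
        by blast
      moreover have "(\<lambda>i. b j (opF a c (N - j) w i)) = (\<lambda>i. bac N w i j)"
        by (auto simp: bac_def opF_eq algebra_simps)
      ultimately show "\<exists>rs. expansions rs (\<lambda>i. bac N w i j) (\<lambda>i. b j (opG a c (N - j) w i)) (\<lambda>i. b j (vprod a c i (N - j - i) w))"
        by simp
    qed
    show "exp2 (\<lambda>i j. b j (vprod a c i (N - j - i) w)) (\<lambda>i j. opG b (vprod a c i) (N - i) w j) ?e21"
      unfolding exp2_def
    proof
      fix i
      have "(\<lambda>j. b j (vprod a c i (N - j - i) w)) = opF b (vprod a c i) (N - i) w"
        by (auto simp: opF_eq algebra_simps)
      then show "\<exists>rs. expansions rs (\<lambda>j. b j (vprod a c i (N - j - i) w)) (\<lambda>j. opG b (vprod a c i) (N - i) w j) (?e21 i)"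
        using ex[of b "vprod a c i" "N - i" w] fields vf loc' by simp
    qed
    show "lowB ?e21"
      unfolding lowB_def
    proof (intro conjI allI)
      obtain J where J: "\<forall>j<J. vprod a c j = (\<lambda>k w. 0)"
        using vprod_below fields loc by blast
      then have "\<forall>i<J. \<forall>j. ?e21 i j = 0" using vprod_zero[OF fields(2)] by simp
      then show "\<exists>J. \<forall>i<J. \<forall>j. ?e21 i j = 0" by blast
      show "lower_truncated (?e21 i)" for i
        using low[of b "vprod a c i" "N - i"] fields vf loc' by simp
    qed
    show "expd (abc N w) (bac N w) (\<lambda>i j. vprod a b i j (c (N - i - j) w))" by (rule expd_abc)
    show "exp2 (\<lambda>i j. vprod a b i j (c (N - i - j) w)) (\<lambda>i j. opG (vprod a b i) c (N - i) w j) ?e0"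
      unfolding exp2_def
    proof
      fix i
      have "(\<lambda>j. vprod a b i j (c (N - i - j) w)) = opF (vprod a b i) c (N - i) w"
        by (auto simp: opF_eq algebra_simps)
      then show "\<exists>rs. expansions rs (\<lambda>j. vprod a b i j (c (N - i - j) w)) (\<lambda>j. opG (vprod a b i) c (N - i) w j) (?e0 i)"
        using ex[of "vprod a b i" c "N - i" w] fields vf loc' by simp
    qed
    show "lowB ?e0"
      unfolding lowB_def
    proof (intro conjI allI)
      obtain J where J: "\<forall>j<J. vprod a b j = (\<lambda>k w. 0)"
        using vprod_below fields loc by blast
      then have "\<forall>i<J. \<forall>j. ?e0 i j = 0" using vprod_zero[OF fields(3)] by simp
      then show "\<exists>J. \<forall>i<J. \<forall>j. ?e0 i j = 0" by blast
      show "lower_truncated (?e0 i)" for i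
        using low[of "vprod a b i" c "N - i"] fields vf loc' by simp
    qed
  qed
  then show ?thesis by (simp add: N_def algebra_simps)
qed

end

section \<open>The Jacobi identity of a quasi module\<close>

lemma Sum_any_inj:
  assumes "inj h" and "\<And>x. g x \<noteq> 0 \<Longrightarrow> x \<in> range h"
  shows "Sum_any g = Sum_any (\<lambda>m. g (h m))"
proof -
  have "{x. g x \<noteq> 0} = h ` {m. g (h m) \<noteq> 0}" using assms(2) by auto
  then show ?thesis
    unfolding Sum_any.expand_set
    using sum.reindex[of h "{m. g (h m) \<noteq> 0}" g] assms(1) by (simp add: inj_on_subset o_def)
qed

lemma finite_inj_support:
  assumes "finite {m. g (h m) \<noteq> 0}" and "\<And>x. g x \<noteq> 0 \<Longrightarrow> x \<in> range h"
  shows "finite {x. g x \<noteq> 0}"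
proof -
  have "{x. g x \<noteq> 0} = h ` {m. g (h m) \<noteq> 0}" using assms(2) by auto
  then show ?thesis using assms(1) by simp
qed

lemma delta_jker:
  "delta_12_0 i (j - m) (m - j - i - 1) = jker1 i j m"
  "delta_21_0 i (j - m) (m - j - i - 1) = jker2 i j m"
  "delta_10_2 (i - m) j (m - i - j - 1) = jker3 i j m"
proof -
  show "delta_12_0 i (j - m) (m - j - i - 1) = jker1 i j m"
    by (simp add: delta_12_0_def binom_coeff_def jker1_def ibinom_def power_int_def)
  have "(-1 :: complex) powi (- i - 1) * (-1) powi (j - m) = (-1) powi (m - j - i - 1)"
  proof -
    have "(-1 :: complex) powi (j - m) = (-1) powi (m - j)"
      using power_int_minus_one_minus[of "m - j", where 'a = complex] by simp
    then show ?thesis by (simp add: power_int_add[symmetric] algebra_simps)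
  qed
  note sgn = this
  show "delta_21_0 i (j - m) (m - j - i - 1) = jker2 i j m"
  proof (cases "j < m")
    case False
    have "(-1 :: complex) ^ nat (j - m) = (-1) powi (j - m)" using False by (simp add: power_int_def)
    then show ?thesis
      using False unfolding jker2_def sgn[symmetric]
      by (simp add: delta_21_0_def binom_coeff_def ibinom_def)
  qed (simp add: delta_21_0_def binom_coeff_def jker2_def)
  show "delta_10_2 (i - m) j (m - i - j - 1) = jker3 i j m"
    using ibinom_minus[of "- j - 1" "i - m"]
    by (simp add: delta_10_2_def binom_coeff_def jker3_def ibinom_def power_int_def algebra_simps)
qed

context cspace
begin

definition pmul :: "(nat \<times> nat \<Rightarrow>\<^sub>0 complex) \<Rightarrow> (int \<Rightarrow> int \<Rightarrow> 'w) \<Rightarrow> int \<Rightarrow> int \<Rightarrow> 'w" where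
  "pmul f Z j k = (\<Sum>(a, b)\<in>Poly_Mapping.keys f. Poly_Mapping.lookup f (a, b) *s Z (j - int a) (k - int b))"

lemma series_mult_poly: "series_mult scale (poly_series f) A i j k = pmul f (A i) j k"
proof -
  let ?g = "\<lambda>(a, b, c). poly_series f a b c *s A (i - a) (j - b) (k - c)"
  let ?h = "\<lambda>(a, b). (0 :: int, int a, int b)"
  have inj: "inj_on ?h S" for S by (auto simp: inj_on_def)
  have "series_mult scale (poly_series f) A i j k = sum ?g (?h ` Poly_Mapping.keys f)"
    unfolding series_mult_def
    by (rule Sum_any.expand_superset)
       (force simp: poly_series_def in_keys_iff image_iff split: if_splits)+
  also have "\<dots> = pmul f (A i) j k"
    unfolding pmul_def by (subst sum.reindex[OF inj]) (auto intro!: sum.cong simp: poly_series_def)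
  finally show ?thesis .
qed

definition smfin :: "complex series3 \<Rightarrow> 'w series3 \<Rightarrow> bool" where
  "smfin D A \<longleftrightarrow> (\<forall>i j k. finite {x. (case x of (a, b, c) \<Rightarrow> D a b c *s A (i - a) (j - b) (k - c)) \<noteq> 0})"

text \<open>The polynomial stands inside the delta product and has to be pulled out.
  \<open>Sum_any\<close> is additive only over finite supports, which is what \<open>smfin\<close>
  provides.\<close>

lemma series_mult_pmul:
  assumes "smfin D A"
  shows "series_mult scale D (\<lambda>i. pmul f (A i)) i j k = pmul f (series_mult scale D A i) j k"
proof -
  let ?g = "\<lambda>p x. case x of (a, b, c) \<Rightarrow> D a b c *s A (i - a) (j - int (fst p) - b) (k - int (snd p) - c)"
  let ?S = "\<Union>p\<in>Poly_Mapping.keys f. {x. ?g p x \<noteq> 0}"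
  have fin: "finite ?S" using assms by (auto simp: smfin_def)
  have eq: "(case x of (a, b, c) \<Rightarrow> D a b c *s pmul f (A (i - a)) (j - b) (k - c))
      = (\<Sum>p\<in>Poly_Mapping.keys f. Poly_Mapping.lookup f p *s ?g p x)" for x
    by (cases x) (simp add: pmul_def scale_sum_right case_prod_unfold mult.commute algebra_simps)
  have "series_mult scale D (\<lambda>i. pmul f (A i)) i j k
      = (\<Sum>x\<in>?S. \<Sum>p\<in>Poly_Mapping.keys f. Poly_Mapping.lookup f p *s ?g p x)"
    unfolding series_mult_def eq
  proof (rule Sum_any.expand_superset[OF fin])
    show "{x. (\<Sum>p\<in>Poly_Mapping.keys f. Poly_Mapping.lookup f p *s ?g p x) \<noteq> 0} \<subseteq> ?S"
      by (auto elim!: sum.not_neutral_contains_not_neutral)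
  qed
  also have "\<dots> = (\<Sum>p\<in>Poly_Mapping.keys f. Poly_Mapping.lookup f p *s (\<Sum>x\<in>?S. ?g p x))"
    by (subst sum.swap) (simp add: scale_sum_right)
  also have "\<dots> = (\<Sum>p\<in>Poly_Mapping.keys f. Poly_Mapping.lookup f p *s Sum_any (?g p))"
    by (intro sum.cong refl arg_cong[where f = "scale _"] Sum_any.expand_superset[symmetric] fin) auto
  also have "\<dots> = pmul f (series_mult scale D A i) j k"
    by (simp add: pmul_def series_mult_def case_prod_unfold)
  finally show ?thesis .
qed

text \<open>The inner series does not involve one of the variables and the delta series is
  homogeneous of degree -1. So the triple sum runs over a line, parametrised by
  \<open>h i j\<close>, and the coefficient at (i, j, k) involves the inner series in total degree i
  + j + k + 1.\<close>

lemma series_mult_kernel: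
  fixes h :: "int \<Rightarrow> int \<Rightarrow> int \<Rightarrow> int \<times> int \<times> int"
  assumes h: "\<And>i j. inj (h i j)"
    and D: "\<And>i j m. (case h i j m of (a, b, c) \<Rightarrow> D a b c) = \<kappa> i j m"
    and A: "\<And>i j k m. (case h i j m of (a, b, c) \<Rightarrow> A (i - a) (j - b) (k - c)) = F (i + j + k + 1) m"
    and supp: "\<And>i j k a b c. D a b c \<noteq> 0 \<Longrightarrow> A (i - a) (j - b) (k - c) \<noteq> 0 \<Longrightarrow> (a, b, c) \<in> range (h i j)"
    and compat: "\<And>i j n. compat (\<kappa> i j) (F n)"
  shows "series_mult scale D A i j k = pairing (\<kappa> i j) (F (i + j + k + 1))" and "smfin D A"
proof -
  let ?g = "\<lambda>i j k x. case x of (a, b, c) \<Rightarrow> D a b c *s A (i - a) (j - b) (k - c)"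
  have gh: "?g i j k (h i j m) = \<kappa> i j m *s F (i + j + k + 1) m" for i j k m
    using D[of i j m] A[where i = i and j = j and k = k and m = m] by (cases "h i j m") simp
  have s: "x \<in> range (h i j)" if "?g i j k x \<noteq> 0" for i j k x
  proof -
    obtain a b c where x: "x = (a, b, c)" by (cases x)
    show ?thesis using that supp[of a b c i j k] unfolding x by auto
  qed
  show "series_mult scale D A i j k = pairing (\<kappa> i j) (F (i + j + k + 1))"
    unfolding series_mult_def pairing_def gh[symmetric]
    by (rule Sum_any_inj[OF h]) (rule s)
  show "smfin D A"
    unfolding smfin_def
  proof (intro allI)
    fix i j k
    show "finite {x. ?g i j k x \<noteq> 0}"
      by (rule finite_inj_support[where h = "h i j"])
         (use compat_finite[OF compat] s gh in \<open>simp_all\<close>)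
  qed
qed

definition jacobi_series :: "('v \<Rightarrow> int \<Rightarrow> 'v \<Rightarrow> 'v) \<Rightarrow> ('v \<Rightarrow> int \<Rightarrow> 'w \<Rightarrow> 'w) \<Rightarrow> 'v \<Rightarrow> 'v \<Rightarrow> 'w \<Rightarrow> int \<Rightarrow> int \<Rightarrow> int \<Rightarrow> 'w" where
  "jacobi_series Y YW u v w i j k = jacobi_defect (opF (YW u) (YW v) (i + j + k + 1) w)
     (opG (YW u) (YW v) (i + j + k + 1) w) (\<lambda>m. YW (Y u m v) (i + j + k + 1 - m) w) i j"

lemma pmul_diff: "pmul f (\<lambda>j k. Z j k - Z' j k) j k = pmul f Z j k - pmul f Z' j k"
  by (simp add: pmul_def scale_right_diff_distrib sum_subtractf case_prod_unfold)

text \<open>With the polynomial pulled out of the delta products, the identity says that f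
  annihilates the series of defects for each power of x_0. The bound \<open>I\<close>, uniform in k
  and w, makes the third pairing finite.\<close>

lemma jacobi_identity_iff:
  assumes "vfield (YW u)" "vfield (YW v)"
    and I: "\<And>m k w. m < I \<Longrightarrow> YW (Y u m v) k w = 0"
  shows "jacobi_identity scale Y YW f u v \<longleftrightarrow> (\<forall>w i j k. pmul f (jacobi_series Y YW u v w i) j k = 0)"
proof -
  define A1 where "A1 w = (\<lambda>i j k. if i = (0::int) then YW u j (YW v k w) else 0)" for w
  define A2 where "A2 w = (\<lambda>i j k. if i = (0::int) then YW v k (YW u j w) else 0)" for w
  define A3 where "A3 w = (\<lambda>i j k. if j = (0::int) then YW (Y u i v) k w else 0)" for w
  let ?C = "\<lambda>w n m. YW (Y u m v) (n - m) w"
  have c1: "compat (jker1 i j) (opF (YW u) (YW v) n w)" for i j n w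
    using opF_truncated[OF assms(1,2)] jker_truncated by (simp add: compat_def)
  have c2: "compat (jker2 i j) (opG (YW u) (YW v) n w)" for i j n w
    using opG_truncated[OF assms(1,2)] jker_truncated by (simp add: compat_def)
  have c3: "compat (jker3 i j) (?C w n)" for i j n w
  proof -
    have "lower_truncated (?C w n)" using I unfolding lower_truncated_def by blast
    then show ?thesis using jker_truncated by (simp add: compat_def)
  qed
  define h where "h = (\<lambda>i j m. (i::int, j - m, m - j - i - 1 :: int))"
  define h3 where "h3 = (\<lambda>i j m. (i - m, j::int, m - i - j - 1 :: int))"
  have inj: "inj (h i j)" "inj (h3 i j)" for i j by (auto simp: inj_def h_def h3_def)
  have r: "(a, b, c) \<in> range (h i j)" if "a = i" "b + c = - i - 1" for a b c i j
    by (rule range_eqI[of _ _ "j - b"]) (use that in \<open>auto simp: h_def\<close>)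
  have r3: "(a, b, c) \<in> range (h3 i j)" if "b = j" "a + b = - c - 1" for a b c i j
    by (rule range_eqI[of _ _ "i - a"]) (use that in \<open>auto simp: h3_def\<close>)
  have k1: "series_mult scale delta_12_0 (A1 w) i j k
        = pairing (jker1 i j) (opF (YW u) (YW v) (i + j + k + 1) w)" "smfin delta_12_0 (A1 w)" for w i j k
  proof -
    have 1: "(case h i j m of (a, b, c) \<Rightarrow> delta_12_0 a b c) = jker1 i j m" for i j m
      by (simp add: h_def delta_jker)
    have 2: "(case h i j m of (a, b, c) \<Rightarrow> A1 w (i - a) (j - b) (k - c)) = opF (YW u) (YW v) (i + j + k + 1) w m" for i j k m
      by (simp add: h_def A1_def opF_def algebra_simps)
    have 3: "(a, b, c) \<in> range (h i j)" if "delta_12_0 a b c \<noteq> 0" "A1 w (i - a) (j - b) (k - c) \<noteq> 0" for i j k a b c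
      by (rule r) (use that in \<open>auto simp: A1_def delta_12_0_def binom_coeff_def split: if_splits\<close>)
    note * = series_mult_kernel[where h = h and F = "\<lambda>n. opF (YW u) (YW v) n w"]
    show "series_mult scale delta_12_0 (A1 w) i j k = pairing (jker1 i j) (opF (YW u) (YW v) (i + j + k + 1) w)"
      "smfin delta_12_0 (A1 w)"
      by (rule *(1), rule inj(1), rule 1, rule 2, erule (1) 3, rule c1,
          rule *(2), rule inj(1), rule 1, rule 2, erule (1) 3, rule c1)
  qed
  have k2: "series_mult scale delta_21_0 (A2 w) i j k
        = pairing (jker2 i j) (opG (YW u) (YW v) (i + j + k + 1) w)" "smfin delta_21_0 (A2 w)" for w i j k
  proof -
    have 1: "(case h i j m of (a, b, c) \<Rightarrow> delta_21_0 a b c) = jker2 i j m" for i j m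
      by (simp add: h_def delta_jker)
    have 2: "(case h i j m of (a, b, c) \<Rightarrow> A2 w (i - a) (j - b) (k - c)) = opG (YW u) (YW v) (i + j + k + 1) w m" for i j k m
      by (simp add: h_def A2_def opG_def algebra_simps)
    have 3: "(a, b, c) \<in> range (h i j)" if "delta_21_0 a b c \<noteq> 0" "A2 w (i - a) (j - b) (k - c) \<noteq> 0" for i j k a b c
      by (rule r) (use that in \<open>auto simp: A2_def delta_21_0_def binom_coeff_def split: if_splits\<close>)
    note * = series_mult_kernel[where h = h and F = "\<lambda>n. opG (YW u) (YW v) n w"]
    show "series_mult scale delta_21_0 (A2 w) i j k = pairing (jker2 i j) (opG (YW u) (YW v) (i + j + k + 1) w)"
      "smfin delta_21_0 (A2 w)"
      by (rule *(1), rule inj(1), rule 1, rule 2, erule (1) 3, rule c2,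
          rule *(2), rule inj(1), rule 1, rule 2, erule (1) 3, rule c2)
  qed
  have k3: "series_mult scale delta_10_2 (A3 w) i j k
        = pairing (jker3 i j) (?C w (i + j + k + 1))" "smfin delta_10_2 (A3 w)" for w i j k
  proof -
    have 1: "(case h3 i j m of (a, b, c) \<Rightarrow> delta_10_2 a b c) = jker3 i j m" for i j m
      by (simp add: h3_def delta_jker)
    have 2: "(case h3 i j m of (a, b, c) \<Rightarrow> A3 w (i - a) (j - b) (k - c)) = ?C w (i + j + k + 1) m" for i j k m
      by (simp add: h3_def A3_def algebra_simps)
    have 3: "(a, b, c) \<in> range (h3 i j)" if "delta_10_2 a b c \<noteq> 0" "A3 w (i - a) (j - b) (k - c) \<noteq> 0" for i j k a b c
      by (rule r3) (use that in \<open>auto simp: A3_def delta_10_2_def binom_coeff_def split: if_splits\<close>)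
    note * = series_mult_kernel[where h = h3 and F = "\<lambda>n. ?C w n"]
    show "series_mult scale delta_10_2 (A3 w) i j k = pairing (jker3 i j) (?C w (i + j + k + 1))"
      "smfin delta_10_2 (A3 w)"
      by (rule *(1), rule inj(2), rule 1, rule 2, erule (1) 3, rule c3,
          rule *(2), rule inj(2), rule 1, rule 2, erule (1) 3, rule c3)
  qed
  have P: "series_mult scale (poly_series f) A = (\<lambda>i. pmul f (A i))" for A
    by (rule ext)+ (rule series_mult_poly)
  have js: "jacobi_series Y YW u v w i = (\<lambda>j k. (series_mult scale delta_12_0 (A1 w) i j k
      - series_mult scale delta_21_0 (A2 w) i j k) - series_mult scale delta_10_2 (A3 w) i j k)" for w i
    by (rule ext)+ (simp add: jacobi_series_def jacobi_defect_def k1 k2 k3)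
  show ?thesis
    unfolding jacobi_identity_def A1_def[symmetric] A2_def[symmetric] A3_def[symmetric]
    by (simp add: P series_mult_pmul[OF k1(2)] series_mult_pmul[OF k2(2)] series_mult_pmul[OF k3(2)]
        js pmul_diff)
qed

lemma pmul_1: "pmul 1 Z = Z"
  by (rule ext)+ (simp add: pmul_def lookup_one zero_prod_def)

lemma pmul_eq_Sum_any: "pmul f Z j k = Sum_any (\<lambda>(a, b). Poly_Mapping.lookup f (a, b) *s Z (j - int a) (k - int b))"
  unfolding pmul_def
  by (rule Sum_any.expand_superset[symmetric]) (auto simp: in_keys_iff)

end

text \<open>The coefficients of the product of the x_1 - r x_2, obtained by multiplying in one
  factor at a time.\<close>

fun linear_product_coeff :: "complex list \<Rightarrow> nat \<times> nat \<Rightarrow> complex" where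
  "linear_product_coeff [] (a, b) = (if a = 0 \<and> b = 0 then 1 else 0)"
| "linear_product_coeff (r # rs) (a, b) =
     (if a = 0 then 0 else linear_product_coeff rs (a - 1, b))
     - r * (if b = 0 then 0 else linear_product_coeff rs (a, b - 1))"

lemma linear_product_coeff_support:
  "linear_product_coeff rs (a, b) \<noteq> 0 \<Longrightarrow> a + b = length rs"
proof (induction rs arbitrary: a b)
  case (Cons r rs)
  then have "(a \<noteq> 0 \<and> linear_product_coeff rs (a - 1, b) \<noteq> 0)
      \<or> (b \<noteq> 0 \<and> linear_product_coeff rs (a, b - 1) \<noteq> 0)"
    by (auto split: if_splits)
  then show ?case
  proof
    assume "a \<noteq> 0 \<and> linear_product_coeff rs (a - 1, b) \<noteq> 0"
    then show ?thesis using Cons.IH[of "a - 1" b] by (cases a) auto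
  next
    assume "b \<noteq> 0 \<and> linear_product_coeff rs (a, b - 1) \<noteq> 0"
    then show ?thesis using Cons.IH[of a "b - 1"] by (cases b) auto
  qed
qed (auto split: if_splits)

lemma finite_linear_product_coeff: "finite {p. linear_product_coeff rs p \<noteq> 0}"
proof (rule finite_subset)
  show "{p. linear_product_coeff rs p \<noteq> 0} \<subseteq> {..length rs} \<times> {..length rs}"
    using linear_product_coeff_support by fastforce
qed simp

definition linear_product :: "complex list \<Rightarrow> (nat \<times> nat \<Rightarrow>\<^sub>0 complex)" where
  "linear_product rs = Abs_poly_mapping (linear_product_coeff rs)"

lemma lookup_linear_product: "Poly_Mapping.lookup (linear_product rs) = linear_product_coeff rs"
  unfolding linear_product_def using finite_linear_product_coeff by (rule lookup_Abs_poly_mapping)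

lemma linear_product_nonzero: "linear_product rs \<noteq> 0"
proof -
  have "linear_product_coeff rs (length rs, 0) = 1" by (induction rs) auto
  then have "Poly_Mapping.lookup (linear_product rs) (length rs, 0) \<noteq> 0"
    by (simp add: lookup_linear_product)
  then show ?thesis by auto
qed

context cspace
begin

lemma pmul_linear_product: "pmul (linear_product rs) Z j k = lcs (map (\<lambda>r. (0, 1, - r)) rs) Z j k"
proof (induction rs arbitrary: j k)
  case Nil
  have "pmul (linear_product []) Z j k = (\<Sum>(a, b)\<in>{(0, 0)}. linear_product_coeff [] (a, b) *s Z (j - int a) (k - int b))"
    unfolding pmul_eq_Sum_any lookup_linear_product
    by (rule Sum_any.expand_superset) (auto split: if_splits)
  then show ?case by simp
next
  case (Cons r rs)
  let ?c = "linear_product_coeff rs"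
  let ?g1 = "\<lambda>(a, b). (if a = 0 then 0 else ?c (a - 1, b)) *s Z (j - int a) (k - int b)"
  let ?g2 = "\<lambda>(a, b). (- r * (if b = 0 then 0 else ?c (a, b - 1))) *s Z (j - int a) (k - int b)"
  let ?h1 = "\<lambda>(a, b). (Suc a, b :: nat)" and ?h2 = "\<lambda>(a :: nat, b). (a, Suc b)"
  have r1: "x \<in> range ?h1" if "?g1 x \<noteq> 0" for x
    using that by (cases x; cases "fst x") (auto simp: image_iff)
  have r2: "x \<in> range ?h2" if "?g2 x \<noteq> 0" for x
    using that by (cases x; cases "snd x") (auto simp: image_iff)
  have e1: "?g1 (?h1 p) = ?c p *s Z (j - 1 - int (fst p)) (k - int (snd p))" for p
    by (cases p) (simp add: algebra_simps)
  have e2: "?g2 (?h2 p) = (- r) *s ?c p *s Z (j - int (fst p)) (k - 1 - int (snd p))" for p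
    by (cases p) (simp add: algebra_simps)
  have f1: "finite {x. ?g1 x \<noteq> 0}"
    by (rule finite_inj_support[where h = ?h1, OF finite_subset[OF _ finite_linear_product_coeff[of rs]]])
       (use e1 r1 in auto)
  have f2: "finite {x. ?g2 x \<noteq> 0}"
    by (rule finite_inj_support[where h = ?h2, OF finite_subset[OF _ finite_linear_product_coeff[of rs]]])
       (use e2 r2 in auto)
  have "pmul (linear_product (r # rs)) Z j k = Sum_any (\<lambda>x. ?g1 x + ?g2 x)"
    unfolding pmul_eq_Sum_any lookup_linear_product
    by (rule Sum_any.cong) (auto simp: scale_left_diff_distrib)
  also have "\<dots> = Sum_any ?g1 + Sum_any ?g2" by (rule Sum_any.distrib[OF f1 f2])
  also have "Sum_any ?g1 = Sum_any (\<lambda>p. ?g1 (?h1 p))"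
    by (rule Sum_any_inj) (use r1 in \<open>auto simp: inj_def\<close>)
  also have "\<dots> = pmul (linear_product rs) Z (j - 1) k"
    unfolding e1 pmul_eq_Sum_any lookup_linear_product by (simp add: case_prod_unfold)
  also have "Sum_any ?g2 = Sum_any (\<lambda>p. ?g2 (?h2 p))"
    by (rule Sum_any_inj) (use r2 in \<open>auto simp: inj_def\<close>)
  also have "\<dots> = (- r) *s pmul (linear_product rs) Z j (k - 1)"
  proof -
    let ?S = "{p. ?c p \<noteq> 0}"
    have "Sum_any (\<lambda>p. ?g2 (?h2 p)) = (\<Sum>p\<in>?S. (- r) *s ?c p *s Z (j - int (fst p)) (k - 1 - int (snd p)))"
      unfolding e2 by (rule Sum_any.expand_superset[OF finite_linear_product_coeff]) auto
    also have "\<dots> = (- r) *s (\<Sum>p\<in>?S. ?c p *s Z (j - int (fst p)) (k - 1 - int (snd p)))"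
      by (simp only: scale_sum_right)
    also have "(\<Sum>p\<in>?S. ?c p *s Z (j - int (fst p)) (k - 1 - int (snd p))) = pmul (linear_product rs) Z j (k - 1)"
      unfolding pmul_eq_Sum_any lookup_linear_product case_prod_unfold prod.collapse
      by (rule Sum_any.expand_superset[symmetric, OF finite_linear_product_coeff]) auto
    finally show ?thesis .
  qed
  finally show ?case by (simp add: Cons.IH lcs_Cons lc_apply)
qed

lemma jacobi_defect_lins:
  assumes "upper_truncated F" "lower_truncated G" "lower_truncated C"
  shows "jacobi_defect (lins rs F) (lins rs G) (lins (map (\<lambda>r. r - 1) rs) C) i = lins rs (jacobi_defect F G C i)"
proof (induction rs)
  case (Cons r rs)
  have "jacobi_defect (lin r (lins rs F)) (lin r (lins rs G)) (lin (r - 1) (lins (map (\<lambda>r. r - 1) rs) C)) i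
      = lin r (jacobi_defect (lins rs F) (lins rs G) (lins (map (\<lambda>r. r - 1) rs) C) i)"
    by (rule ext) (subst jacobi_defect_lin,
      simp_all add: assms upper_truncated_lins lower_truncated_lins, simp add: lin_def)
  then show ?case by (simp add: lins_Cons Cons)
qed simp

text \<open>The homogeneous multiplier acts on the defects of one total degree as
  \<open>lins\<close>, which can be moved onto the three expansions. There it clears the
  denominators and leaves the case of a Laurent polynomial.\<close>

lemma ope_jacobi_identity:
  assumes u: "vfield (YW u)" and v: "vfield (YW v)"
    and ope: "ope rs (YW u) (YW v) (\<lambda>i. YW (Y u i v))"
  shows "jacobi_identity scale Y YW (linear_product rs) u v"
proof -
  have e: "expansions rs (opF (YW u) (YW v) N w) (opG (YW u) (YW v) N w) (\<lambda>i. YW (Y u i v) (N - i) w)" for N w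
    using ope by (simp add: ope_def)
  have I: "YW (Y u m v) k w = 0" if "m < - int (length rs)" for m k w
    using expansions_below(1)[OF e[of "m + k" w] that] by simp
  have "pmul (linear_product rs) (jacobi_series Y YW u v w i) j k = 0" for w i j k
  proof -
    \<comment> \<open>The polynomial raises the degree by \<open>length rs\<close>; the 1
      compensates the degree -1 of the delta series.\<close>
    define n where "n = i + (j + k - int (length rs)) + 1"
    let ?F = "opF (YW u) (YW v) n w" and ?G = "opG (YW u) (YW v) n w"
      and ?C = "\<lambda>m. YW (Y u m v) (n - m) w"
    have "(\<lambda>m. jacobi_series Y YW u v w i m (j + k - int (length rs) - m)) = jacobi_defect ?F ?G ?C i"
    proof
      fix m
      have "i + m + (j + k - int (length rs) - m) + 1 = n" by (simp add: n_def)
      then show "jacobi_series Y YW u v w i m (j + k - int (length rs) - m) = jacobi_defect ?F ?G ?C i m"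
        unfolding jacobi_series_def by presburger
    qed
    then have "pmul (linear_product rs) (jacobi_series Y YW u v w i) j k = lins rs (jacobi_defect ?F ?G ?C i) j"
      by (simp add: pmul_linear_product lcs_diagonal)
    also have "\<dots> = jacobi_defect (lins rs ?F) (lins rs ?G) (lins (map (\<lambda>r. r - 1) rs) ?C) i j"
      using jacobi_defect_lins[of ?F ?G ?C rs i] e[of n w] by (simp add: expansions_def)
    also have "\<dots> = 0" by (rule jacobi_defect_expansions_lins[OF e])
    finally show ?thesis .
  qed
  then show ?thesis using jacobi_identity_iff[where YW = YW and Y = Y and u = u and v = v, OF u v I] by blast
qed

text \<open>The coefficients of \<open>f(x\<^sub>0 + x\<^sub>2, x\<^sub>2)\<close>.\<close>

definition taylor_poly :: "(nat \<times> nat \<Rightarrow>\<^sub>0 complex) \<Rightarrow> nat \<Rightarrow> nat \<Rightarrow> complex" where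
  "taylor_poly f r t = (\<Sum>(a, b)\<in>Poly_Mapping.keys f.
     if a + b = r + t then Poly_Mapping.lookup f (a, b) * of_nat (a choose r) else 0)"

text \<open>Let A be the highest power of x_1 in f. Only terms with this power can produce x_0^A, so
  the coefficient of x_0^A x_2^B is the coefficient of f at (A, B).\<close>

lemma taylor_poly_nonzero:
  assumes "f \<noteq> 0"
  shows "\<exists>r t. taylor_poly f r t \<noteq> 0"
proof -
  let ?K = "Poly_Mapping.keys f"
  have K: "finite ?K" "?K \<noteq> {}" using assms by simp_all
  define A where "A = Max (fst ` ?K)"
  have "A \<in> fst ` ?K" unfolding A_def using K by (intro Max_in) auto
  then obtain B where B: "(A, B) \<in> ?K" by auto
  have A: "a \<le> A" if "(a, b) \<in> ?K" for a b
    unfolding A_def using K that by (intro Max_ge) (auto intro: rev_image_eqI)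
  have "taylor_poly f A B = (\<Sum>p\<in>{(A, B)}. case p of (a, b) \<Rightarrow>
     if a + b = A + B then Poly_Mapping.lookup f (a, b) * of_nat (a choose A) else 0)"
    unfolding taylor_poly_def
  proof (rule sum.mono_neutral_right)
    show "\<forall>p\<in>?K - {(A, B)}. (case p of (a, b) \<Rightarrow>
       if a + b = A + B then Poly_Mapping.lookup f (a, b) * of_nat (a choose A) else 0) = 0"
    proof
      fix p assume p: "p \<in> ?K - {(A, B)}"
      obtain a b where ab: "p = (a, b)" by (cases p)
      have "a \<le> A" using p A ab by blast
      then have "a + b \<noteq> A + B \<or> a < A" using p ab by auto
      then show "(case p of (a, b) \<Rightarrow>
        if a + b = A + B then Poly_Mapping.lookup f (a, b) * of_nat (a choose A) else 0) = 0"
        unfolding ab by (auto simp: binomial_eq_0)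
    qed
  qed (use K B in auto)
  then have "taylor_poly f A B \<noteq> 0" using B by (simp add: in_keys_iff)
  then show ?thesis by blast
qed

text \<open>The series \<open>x\<^sub>2^(-1) \<delta>((x\<^sub>1 - x\<^sub>0)/x\<^sub>2) D(x\<^sub>0, x\<^sub>2)\<close>.\<close>

definition delta_series :: "(int \<Rightarrow> int \<Rightarrow> 'w) \<Rightarrow> int \<Rightarrow> int \<Rightarrow> int \<Rightarrow> 'w" where
  "delta_series D i j k = pairing (jker3 i j) (\<lambda>m. D m (i + j + k + 1 - m))"

text \<open>The series \<open>f(x\<^sub>0 + x\<^sub>2, x\<^sub>2) D(x\<^sub>0, x\<^sub>2)\<close>.\<close>

definition taylor_mult :: "(nat \<times> nat \<Rightarrow>\<^sub>0 complex) \<Rightarrow> (int \<Rightarrow> int \<Rightarrow> 'w) \<Rightarrow> int \<Rightarrow> int \<Rightarrow> 'w" where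
  "taylor_mult f D i k = (\<Sum>(a, b)\<in>Poly_Mapping.keys f. Poly_Mapping.lookup f (a, b) *s
     (\<Sum>r\<in>{0..int a}. ibinom (int a) r *s D (i - r) (k - int a - int b + r)))"

lemma delta_series_minus_1: "delta_series D i (- 1) k = D i k"
proof -
  have "delta_series D i (- 1) k = (\<Sum>m\<in>{i}. jker3 i (- 1) m *s D m (i - 1 + k + 1 - m))"
    unfolding delta_series_def
    by (subst pairing_eq_sum[of "{i}"]) (auto simp: jker3_def ibinom_zero_left split: if_splits)
  then show ?thesis by (simp add: jker3_def)
qed

text \<open>In the product with this delta series x_1 may be replaced by x_0 + x_2, which on
  coefficients is Vandermonde's identity. The coefficient of x_1^(-1) will then isolate f(x_0 + x_2,
  x_2) D.\<close>

lemma delta_series_taylor_mult: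
  assumes low: "\<And>i k. i < I \<Longrightarrow> D i k = 0"
  shows "delta_series (taylor_mult f D) i j k = pmul f (delta_series D i) j k"
proof -
  let ?M = "{I..i}"
  have ds: "delta_series D i j k = (\<Sum>m\<in>?M. jker3 i j m *s D m (i + j + k + 1 - m))" for j k
    unfolding delta_series_def
    by (rule pairing_eq_sum) (auto simp: jker3_def not_less[symmetric] low)
  have one: "(\<Sum>m\<in>?M. jker3 i j m *s (\<Sum>r\<in>{0..int a}. ibinom (int a) r *s D (m - r) (n - m - int a - int b + r)))
      = (\<Sum>m\<in>?M. jker3 i (j - int a) m *s D m (n - int a - int b - m))" for a b n
  proof -
    have "(\<Sum>m\<in>?M. jker3 i j m *s (\<Sum>r\<in>{0..int a}. ibinom (int a) r *s D (m - r) (n - m - int a - int b + r)))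
        = (\<Sum>r\<in>{0..int a}. \<Sum>m\<in>?M. (jker3 i j m * ibinom (int a) r) *s D (m - r) (n - int a - int b - (m - r)))"
      by (subst sum.swap) (simp add: scale_sum_right algebra_simps)
    also have "\<dots> = (\<Sum>r\<in>{0..int a}. \<Sum>m\<in>?M. (jker3 i j (m + r) * ibinom (int a) r) *s D m (n - int a - int b - m))"
    proof (rule sum.cong[OF refl])
      fix r assume r: "r \<in> {0..int a}"
      have "(\<Sum>m\<in>?M. (jker3 i j m * ibinom (int a) r) *s D (m - r) (n - int a - int b - (m - r)))
          = (\<Sum>m\<in>{I - r..i - r}. (jker3 i j (m + r) * ibinom (int a) r) *s D m (n - int a - int b - m))"
        by (rule sum.reindex_bij_witness[of _ "\<lambda>m. m + r" "\<lambda>m. m - r"]) auto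
      also have "\<dots> = (\<Sum>m\<in>{I - r..i}. (jker3 i j (m + r) * ibinom (int a) r) *s D m (n - int a - int b - m))"
        by (rule sum.mono_neutral_left) (use r in \<open>auto simp: jker3_def\<close>)
      also have "\<dots> = (\<Sum>m\<in>?M. (jker3 i j (m + r) * ibinom (int a) r) *s D m (n - int a - int b - m))"
        by (rule sum.mono_neutral_right) (use r in \<open>auto simp: low\<close>)
      finally show "(\<Sum>m\<in>?M. (jker3 i j m * ibinom (int a) r) *s D (m - r) (n - int a - int b - (m - r)))
          = (\<Sum>m\<in>?M. (jker3 i j (m + r) * ibinom (int a) r) *s D m (n - int a - int b - m))" .
    qed
    also have "\<dots> = (\<Sum>m\<in>?M. (\<Sum>r\<in>{0..int a}. jker3 i j (m + r) * ibinom (int a) r) *s D m (n - int a - int b - m))"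
      by (subst sum.swap) (simp add: scale_sum_left)
    also have "\<dots> = (\<Sum>m\<in>?M. jker3 i (j - int a) m *s D m (n - int a - int b - m))"
    proof (rule sum.cong[OF refl])
      fix m assume "m \<in> ?M"
      let ?A = "{0..max (int a) (i - m)}"
      have "(\<Sum>r\<in>{0..int a}. jker3 i j (m + r) * ibinom (int a) r)
          = (\<Sum>r\<in>?A. ibinom (- j - 1) (i - m - r) * ibinom (int a) r)"
        by (rule sum.mono_neutral_cong_left) (auto simp: jker3_def ibinom_eq_0 algebra_simps)
      also have "\<dots> = ibinom (- j - 1 + int a) (i - m)"
        by (rule ibinom_Vandermonde) auto
      finally show "(\<Sum>r\<in>{0..int a}. jker3 i j (m + r) * ibinom (int a) r) *s D m (n - int a - int b - m)
          = jker3 i (j - int a) m *s D m (n - int a - int b - m)"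
        by (simp add: jker3_def algebra_simps)
    qed
    finally show ?thesis .
  qed
  have low': "taylor_mult f D m k = 0" if "m < I" for m k
    unfolding taylor_mult_def using that
    by (intro sum.neutral) (auto simp: low intro!: sum.neutral)
  have "delta_series (taylor_mult f D) i j k
      = (\<Sum>m\<in>?M. jker3 i j m *s taylor_mult f D m (i + j + k + 1 - m))"
    unfolding delta_series_def
    by (rule pairing_eq_sum) (auto simp: jker3_def not_less[symmetric] low')
  also have "\<dots> = (\<Sum>p\<in>Poly_Mapping.keys f. Poly_Mapping.lookup f p *s
      (\<Sum>m\<in>?M. jker3 i j m *s (\<Sum>r\<in>{0..int (fst p)}. ibinom (int (fst p)) r *s
         D (m - r) (i + j + k + 1 - m - int (fst p) - int (snd p) + r))))"
    unfolding taylor_mult_def case_prod_unfold prod.collapse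
    by (simp only: scale_sum_right[of _ _ "Poly_Mapping.keys f"] scale_left_commute[of "jker3 _ _ _"],
        subst sum.swap) (simp only: scale_sum_right[of _ _ ?M])
  also have "\<dots> = pmul f (delta_series D i) j k"
    unfolding one pmul_def ds case_prod_unfold prod.collapse
    by (intro sum.cong refl arg_cong[where f = "scale _"]) (simp add: algebra_simps)
  finally show ?thesis .
qed

lemma taylor_mult_eq_sum:
  assumes "\<And>a b. (a, b) \<in> Poly_Mapping.keys f \<Longrightarrow> a + b \<le> M"
  shows "taylor_mult f D i k = (\<Sum>r\<in>{0..M}. \<Sum>t\<in>{0..M}. taylor_poly f r t *s D (i - int r) (k - int t))"
proof -
  let ?l = "Poly_Mapping.lookup f"
  have inner: "(\<Sum>t\<in>{0..M}. (if a + b = r + t then ?l (a, b) * of_nat (a choose r) else 0) *s D (i - int r) (k - int t))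
     = ?l (a, b) *s (if r \<le> a then of_nat (a choose r) *s D (i - int r) (k - int a - int b + int r) else 0)"
    if ab: "a + b \<le> M" for a b r
  proof (cases "r \<le> a")
    case True
    then have t: "a + b - r \<in> {0..M}" and e: "k - int (a + b - r) = k - int a - int b + int r"
      using ab by (auto simp: of_nat_diff)
    have "(\<Sum>t\<in>{0..M}. (if a + b = r + t then ?l (a, b) * of_nat (a choose r) else 0) *s D (i - int r) (k - int t))
        = (\<Sum>t\<in>{a + b - r}. (?l (a, b) * of_nat (a choose r)) *s D (i - int r) (k - int t))"
      by (rule sum.mono_neutral_cong_right) (use t True in auto)
    then show ?thesis using True by (simp add: algebra_simps)
  next
    case False
    then show ?thesis by (auto intro!: sum.neutral simp: binomial_eq_0)
  qed
  have "(\<Sum>r\<in>{0..M}. \<Sum>t\<in>{0..M}. taylor_poly f r t *s D (i - int r) (k - int t))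
      = (\<Sum>r\<in>{0..M}. \<Sum>t\<in>{0..M}. \<Sum>p\<in>Poly_Mapping.keys f.
          (if fst p + snd p = r + t then ?l p * of_nat (fst p choose r) else 0) *s D (i - int r) (k - int t))"
    unfolding taylor_poly_def case_prod_unfold scale_sum_left prod.collapse by (rule refl)
  also have "\<dots> = (\<Sum>r\<in>{0..M}. \<Sum>p\<in>Poly_Mapping.keys f. \<Sum>t\<in>{0..M}.
          (if fst p + snd p = r + t then ?l p * of_nat (fst p choose r) else 0) *s D (i - int r) (k - int t))"
    by (rule sum.cong[OF refl], rule sum.swap)
  also have "\<dots> = (\<Sum>p\<in>Poly_Mapping.keys f. \<Sum>r\<in>{0..M}. \<Sum>t\<in>{0..M}.
          (if fst p + snd p = r + t then ?l p * of_nat (fst p choose r) else 0) *s D (i - int r) (k - int t))"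
    by (rule sum.swap)
  also have "\<dots> = taylor_mult f D i k"
    unfolding taylor_mult_def case_prod_unfold
  proof (rule sum.cong[OF refl])
    fix p assume p: "p \<in> Poly_Mapping.keys f"
    obtain a b where ab: "p = (a, b)" by (cases p)
    have M: "a + b \<le> M" using assms p ab by simp
    have "(\<Sum>r\<in>{0..M}. \<Sum>t\<in>{0..M}.
          (if fst p + snd p = r + t then ?l p * of_nat (fst p choose r) else 0) *s D (i - int r) (k - int t))
        = ?l p *s (\<Sum>r\<in>{0..M}. if r \<le> a then of_nat (a choose r) *s D (i - int r) (k - int a - int b + int r) else 0)"
      unfolding ab fst_conv snd_conv inner[OF M] scale_sum_right ..
    also have "(\<Sum>r\<in>{0..M}. if r \<le> a then of_nat (a choose r) *s D (i - int r) (k - int a - int b + int r) else 0)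
        = (\<Sum>r\<in>{0..a}. of_nat (a choose r) *s D (i - int r) (k - int a - int b + int r))"
      by (rule sum.mono_neutral_cong_right) (use M in auto)
    also have "\<dots> = (\<Sum>r\<in>{0..int a}. ibinom (int a) r *s D (i - r) (k - int a - int b + r))"
      by (rule sum.reindex_bij_witness[of _ nat int]) (auto simp: ibinom_of_nat)
    finally show "(\<Sum>r\<in>{0..M}. \<Sum>t\<in>{0..M}.
          (if fst p + snd p = r + t then ?l p * of_nat (fst p choose r) else 0) *s D (i - int r) (k - int t))
      = ?l (fst p, snd p) *s (\<Sum>r\<in>{0..int (fst p)}. ibinom (int (fst p)) r *s
          D (i - r) (k - int (fst p) - int (snd p) + r))"
      by (simp add: ab)
  qed
  finally show ?thesis by simp
qed

lemma lowB_taylor_mult: "lowB D \<Longrightarrow> lowB (taylor_mult f D)"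
proof -
  assume D: "lowB D"
  obtain I where I: "\<forall>i<I. \<forall>k. D i k = 0" using D by (auto simp: lowB_def)
  have "\<forall>i<I. \<forall>k. taylor_mult f D i k = 0"
    unfolding taylor_mult_def using I by (auto intro!: sum.neutral)
  moreover have "lower_truncated (taylor_mult f D i)" for i
  proof -
    have *: "lower_truncated (\<lambda>k. c *s F k)" if "lower_truncated F" for c and F :: "int \<Rightarrow> 'w"
      using that by (auto simp: lower_truncated_def)
    have sum: "lower_truncated (\<lambda>k. \<Sum>x\<in>S. F x k)" if "\<And>x. x \<in> S \<Longrightarrow> lower_truncated (F x)"
      for S :: "'x set" and F :: "'x \<Rightarrow> int \<Rightarrow> 'w"
      using that
    proof (induction S rule: infinite_finite_induct)
      case (insert x S)
      then show ?case using lower_truncated_add[of "F x" "\<lambda>k. \<Sum>x\<in>S. F x k" 1 1] by simp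
    qed (auto simp: lower_truncated_def)
    have sh: "lower_truncated (\<lambda>k. D i (k - a - b + r))" for i a b r
      using D lower_truncated_shift[of "D i" "r - a - b"] by (simp add: lowB_def algebra_simps)
    show ?thesis
      unfolding taylor_mult_def case_prod_unfold
      by (intro sum * sh)
  qed
  ultimately show ?thesis by (auto simp: lowB_def)
qed

lemma int_least:
  assumes "P (x :: int)" and "\<And>y. y < N \<Longrightarrow> \<not> P y"
  shows "\<exists>x. P x \<and> (\<forall>y<x. \<not> P y)"
proof -
  define n where "n = (LEAST n. P (N + int n))"
  have ex: "P (N + int (nat (x - N)))" using assms by (cases "x < N") auto
  have 1: "P (N + int n)" unfolding n_def by (rule LeastI[of _ "nat (x - N)"]) (rule ex)
  have 2: "\<not> P y" if "y < N + int n" for y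
  proof (cases "y < N")
    case False
    then have "nat (y - N) < n" "y = N + int (nat (y - N))" using that by auto
    then show ?thesis using not_less_Least[of "nat (y - N)" "\<lambda>n. P (N + int n)"] unfolding n_def by metis
  qed (use assms in simp)
  from 1 2 show ?thesis by blast
qed

text \<open>Lowest terms multiply: if (i0, k0) and (r0, t0) are the lexicographically lowest indices
  of D and of \<open>taylor_poly f\<close>, the coefficient at their sum is a nonzero scalar times a
  nonzero vector. \<open>lowB D\<close> guarantees that the minima exist.\<close>

lemma taylor_mult_eq_0:
  assumes "f \<noteq> 0" and D: "lowB D" and z: "\<And>i k. taylor_mult f D i k = 0"
  shows "D i k = 0"
proof (rule ccontr)
  assume nz: "D i k \<noteq> 0"
  obtain I where I: "\<forall>i<I. \<forall>k. D i k = 0" using D by (auto simp: lowB_def)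
  obtain i0 where i0: "\<exists>k. D i0 k \<noteq> 0" "\<And>i k. i < i0 \<Longrightarrow> D i k = 0"
    using int_least[of "\<lambda>i. \<exists>k. D i k \<noteq> 0" i I] nz I by blast
  obtain K where K: "\<forall>k<K. D i0 k = 0" using D unfolding lowB_def lower_truncated_def by blast
  obtain k0 where k0: "D i0 k0 \<noteq> 0" "\<And>k. k < k0 \<Longrightarrow> D i0 k = 0"
    using i0(1) int_least[of "\<lambda>k. D i0 k \<noteq> 0" _ K] K by blast
  let ?g = "taylor_poly f"
  define r0 where "r0 = (LEAST r. \<exists>t. ?g r t \<noteq> 0)"
  have "\<exists>t. ?g r0 t \<noteq> 0" unfolding r0_def by (rule LeastI_ex) (rule taylor_poly_nonzero[OF assms(1)])
  then obtain t0 where t0: "?g r0 t0 \<noteq> 0" "\<And>t. t < t0 \<Longrightarrow> ?g r0 t = 0"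
    using LeastI_ex[of "\<lambda>t. ?g r0 t \<noteq> 0"] not_less_Least[of _ "\<lambda>t. ?g r0 t \<noteq> 0"] by blast
  have r0: "?g r t = 0" if "r < r0" for r t
    using not_less_Least[of r "\<lambda>r. \<exists>t. ?g r t \<noteq> 0"] that unfolding r0_def by blast
  define M where "M = Max ((\<lambda>(a, b). a + b) ` Poly_Mapping.keys f \<union> {r0 + t0})"
  have M: "a + b \<le> M" if "(a, b) \<in> Poly_Mapping.keys f" for a b
    unfolding M_def using that by (intro Max_ge) (auto intro: rev_image_eqI)
  have M': "r0 + t0 \<le> M" unfolding M_def by (intro Max_ge) auto
  have "0 = (\<Sum>r\<in>{0..M}. \<Sum>t\<in>{0..M}. ?g r t *s D (i0 + int r0 - int r) (k0 + int t0 - int t))"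
    using taylor_mult_eq_sum[where f = f and M = M and D = D and i = "i0 + int r0" and k = "k0 + int t0", OF M] z by simp
  also have "\<dots> = (\<Sum>r\<in>{r0}. \<Sum>t\<in>{0..M}. ?g r t *s D (i0 + int r0 - int r) (k0 + int t0 - int t))"
  proof (rule sum.mono_neutral_right)
    show "\<forall>r\<in>{0..M} - {r0}. (\<Sum>t\<in>{0..M}. ?g r t *s D (i0 + int r0 - int r) (k0 + int t0 - int t)) = 0"
    proof
      fix r assume "r \<in> {0..M} - {r0}"
      then consider "r < r0" | "r0 < r" by fastforce
      then show "(\<Sum>t\<in>{0..M}. ?g r t *s D (i0 + int r0 - int r) (k0 + int t0 - int t)) = 0"
        by cases (simp_all add: r0 i0(2))
    qed
  qed (use M' in auto)
  also have "\<dots> = (\<Sum>t\<in>{0..M}. ?g r0 t *s D i0 (k0 + int t0 - int t))" by simp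
  also have "\<dots> = (\<Sum>t\<in>{t0}. ?g r0 t *s D i0 (k0 + int t0 - int t))"
  proof (rule sum.mono_neutral_right)
    show "\<forall>t\<in>{0..M} - {t0}. ?g r0 t *s D i0 (k0 + int t0 - int t) = 0"
    proof
      fix t assume "t \<in> {0..M} - {t0}"
      then consider "t < t0" | "t0 < t" by fastforce
      then show "?g r0 t *s D i0 (k0 + int t0 - int t) = 0"
        by cases (simp_all add: t0 k0(2))
    qed
  qed (use M' in auto)
  finally show False using t0(1) k0(1) by simp
qed

lemma pmul_delta_series_eq_0:
  assumes "f \<noteq> 0" "lowB D" "\<And>i j k. pmul f (delta_series D i) j k = 0"
  shows "D = (\<lambda>_ _. 0)"
proof -
  obtain I where I: "\<And>i k. i < I \<Longrightarrow> D i k = 0" using assms(2) by (auto simp: lowB_def)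
  have "taylor_mult f D i k = 0" for i k
    using delta_series_taylor_mult[where D = D and f = f and i = i and j = "-1" and k = k, OF I] assms(3) by (simp add: delta_series_minus_1)
  from taylor_mult_eq_0[OF assms(1,2) this] show ?thesis by blast
qed

lemma pmul_pmul_delta_series_eq_0:
  assumes "f \<noteq> 0" "g \<noteq> 0" "lowB D" "\<And>i j k. pmul f (pmul g (delta_series D i)) j k = 0"
  shows "D = (\<lambda>_ _. 0)"
proof -
  obtain I where I: "\<And>i k. i < I \<Longrightarrow> D i k = 0" using assms(3) by (auto simp: lowB_def)
  have eq: "delta_series (taylor_mult g D) i = pmul g (delta_series D i)" for i
    by (rule ext)+ (rule delta_series_taylor_mult[OF I])
  have "taylor_mult g D = (\<lambda>_ _. 0)"
    by (rule pmul_delta_series_eq_0[OF assms(1) lowB_taylor_mult[OF assms(3)]])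
       (simp add: eq assms(4))
  then have "D i k = 0" for i k
    using taylor_mult_eq_0[OF assms(2,3)] by simp
  then show ?thesis by blast
qed

lemma pmul_commute: "pmul f (pmul g Z) j k = pmul g (pmul f Z) j k"
  unfolding pmul_def case_prod_unfold scale_sum_right
  by (subst sum.swap) (simp add: mult.commute algebra_simps)

lemma pmul_zero: "pmul f (\<lambda>j k. 0) j k = 0"
  by (simp add: pmul_def case_prod_unfold)

text \<open>Both Jacobi identities have the same left-hand side, so multiplying by both polynomials kills the
  difference of the right-hand sides.\<close>

lemma jacobi_identity_iterate_unique:
  assumes fields: "\<And>v. vfield (YW v)" "\<And>v. vfield (YW' v)"
    and agree: "YW u = YW' u" "YW v = YW' v"
    and low: "\<And>m k w. m < I \<Longrightarrow> YW (Y u m v) k w = 0" "\<And>m k w. m < I \<Longrightarrow> YW' (Y u m v) k w = 0"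
    and f: "f \<noteq> 0" "jacobi_identity scale Y YW f u v"
    and g: "g \<noteq> 0" "jacobi_identity scale Y YW' g u v"
  shows "YW (Y u m v) = YW' (Y u m v)"
proof (rule ext)+
  fix k w
  define D where "D = (\<lambda>m k. YW (Y u m v) k w - YW' (Y u m v) k w)"
  have lt: "lower_truncated (\<lambda>k. YW (Y u m v) k w)" "lower_truncated (\<lambda>k. YW' (Y u m v) k w)" for m
    using fields by (simp_all add: vfield_def)
  have B: "lowB D"
    unfolding lowB_def D_def
  proof (intro conjI allI exI[of _ I] impI)
    show "YW (Y u i v) j w - YW' (Y u i v) j w = 0" if "i < I" for i j
      using low that by simp
    show "lower_truncated (\<lambda>j. YW (Y u i v) j w - YW' (Y u i v) j w)" for i
      by (rule lower_truncated_diff[OF lt])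
  qed
  have lm: "lower_truncated (\<lambda>m. YW (Y u m v) (n - m) w)" "lower_truncated (\<lambda>m. YW' (Y u m v) (n - m) w)" for n
    using low unfolding lower_truncated_def by blast+
  have "delta_series D i j k = jacobi_series Y YW' u v w i j k - jacobi_series Y YW u v w i j k" for i j k
  proof -
    let ?n = "i + j + k + 1"
    have c: "compat (jker3 i j) (\<lambda>m. YW (Y u m v) (?n - m) w)"
      "compat (jker3 i j) (\<lambda>m. (-1) *s YW' (Y u m v) (?n - m) w)"
      "compat (jker3 i j) (\<lambda>m. YW' (Y u m v) (?n - m) w)"
      using lm[of ?n] jker_truncated(3)[of i j] by (auto simp: compat_def lower_truncated_def)
    have "delta_series D i j k = pairing (jker3 i j) (\<lambda>m. YW (Y u m v) (?n - m) w)
        - pairing (jker3 i j) (\<lambda>m. YW' (Y u m v) (?n - m) w)"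
      using pairing_add[OF c(1,2)] pairing_scale[OF c(3), of "-1"]
      by (simp add: delta_series_def D_def)
    then show ?thesis by (simp add: jacobi_series_def jacobi_defect_def agree)
  qed
  then have ds: "delta_series D i = (\<lambda>j k. jacobi_series Y YW' u v w i j k - jacobi_series Y YW u v w i j k)" for i
    by (simp add: fun_eq_iff)
  have zf: "pmul f (jacobi_series Y YW u v w i) = (\<lambda>j k. 0)" for i
    using f(2) jacobi_identity_iff[where YW = YW and Y = Y and u = u and v = v, OF fields(1) fields(1) low(1)] by (simp add: fun_eq_iff)
  have zg: "pmul g (jacobi_series Y YW' u v w i) = (\<lambda>j k. 0)" for i
    using g(2) jacobi_identity_iff[where YW = YW' and Y = Y and u = u and v = v, OF fields(2) fields(2) low(2)] by (simp add: fun_eq_iff)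
  have "pmul f (pmul g (delta_series D i)) j k = 0" for i j k
  proof -
    have "pmul g (delta_series D i) = (\<lambda>j k. - pmul g (jacobi_series Y YW u v w i) j k)"
      by (rule ext)+ (simp add: ds pmul_diff zg)
    then have "pmul f (pmul g (delta_series D i)) j k
        = pmul f (\<lambda>j k. 0 - pmul g (jacobi_series Y YW u v w i) j k) j k" by simp
    also have "\<dots> = 0"
      by (simp only: pmul_diff pmul_zero pmul_commute[of f g] zf)  simp
    finally show ?thesis .
  qed
  from pmul_pmul_delta_series_eq_0[OF f(1) g(1) B this]
  have "D m k = 0" by simp
  then show "YW (Y u m v) k w = YW' (Y u m v) k w" by (simp add: D_def)
qed

end

section \<open>The module over the affine Lie algebra of \<open>A\<^sub>*\<close>\<close>

definition pm_sum :: "('i \<Rightarrow> 'a::zero \<Rightarrow> 'c::comm_monoid_add) \<Rightarrow> ('i \<Rightarrow>\<^sub>0 'a) \<Rightarrow> 'c" where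
  "pm_sum h p = (\<Sum>i\<in>Poly_Mapping.keys p. h i (Poly_Mapping.lookup p i))"

lemma pm_sum_zero [simp]: "pm_sum h 0 = 0"
  by (simp add: pm_sum_def)

lemma pm_sum_single: "h i 0 = 0 \<Longrightarrow> pm_sum h (Poly_Mapping.single i a) = h i a"
  by (cases "a = 0") (simp_all add: pm_sum_def)

lemma pm_sum_add:
  assumes "\<And>i. h i 0 = 0" and "\<And>i a b. h i (a + b) = h i a + h i b"
  shows "pm_sum h (p + p') = pm_sum h p + pm_sum h p'"
  unfolding pm_sum_def using assms by (rule setsum_keys_plus_distrib)

lemma pm_sum_fun_add: "pm_sum (\<lambda>i a. h i a + h' i a) p = pm_sum h p + pm_sum h' p"
  by (simp add: pm_sum_def sum.distrib)

lemma lookup_pm_scale: "s c 0 = 0 \<Longrightarrow> Poly_Mapping.lookup (pm_scale s c p) i = s c (Poly_Mapping.lookup p i)"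
  by (simp add: pm_scale_def Poly_Mapping.map.rep_eq when_def)

lemma pm_scale_single: "s c 0 = 0 \<Longrightarrow> pm_scale s c (Poly_Mapping.single i a) = Poly_Mapping.single i (s c a)"
  by (simp add: pm_scale_def)

lemma pm_sum_scale:
  assumes "s c 0 = 0" and "\<And>i. h i 0 = 0" and "\<And>i a. h i (s c a) = S (h i a)" and "S 0 = 0"
    and "\<And>x y. S (x + y) = S x + S y"
  shows "pm_sum h (pm_scale s c p) = S (pm_sum h p)"
proof -
  have K: "Poly_Mapping.keys (pm_scale s c p) \<subseteq> Poly_Mapping.keys p"
    using assms(1) by (auto simp: in_keys_iff lookup_pm_scale)
  have "pm_sum h (pm_scale s c p) = (\<Sum>i\<in>Poly_Mapping.keys p. h i (Poly_Mapping.lookup (pm_scale s c p) i))"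
    unfolding pm_sum_def
    by (rule sum.mono_neutral_left) (use K assms(2) in \<open>auto simp: in_keys_iff\<close>)
  also have "\<dots> = (\<Sum>i\<in>Poly_Mapping.keys p. S (h i (Poly_Mapping.lookup p i)))"
    by (simp add: lookup_pm_scale[of s c] assms)
  also have "\<dots> = S (pm_sum h p)"
    unfolding pm_sum_def
    by (rule sym, induction rule: infinite_finite_induct) (simp_all add: assms)
  finally show ?thesis .
qed

lemma pm_induct [case_names zero single add]:
  assumes "P 0" and "\<And>i a. P (Poly_Mapping.single i (a :: 'a::ab_group_add))" and "\<And>p q. P p \<Longrightarrow> P q \<Longrightarrow> P (p + q)"
  shows "P p"
proof (induction p rule: Poly_Mapping.update_induct)
  case (update p i a)
  have "Poly_Mapping.update i a p = p + Poly_Mapping.single i a"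
    using update(1) by (intro poly_mapping_eqI)
      (auto simp: lookup_update lookup_add lookup_single in_keys_iff when_def)
  then show ?case using assms update by simp
qed (rule assms)

lemma module_pm_scale: "module (pm_scale (*) :: complex \<Rightarrow> ('i \<Rightarrow>\<^sub>0 complex) \<Rightarrow> _)"
  by unfold_locales (auto intro!: poly_mapping_eqI simp: lookup_pm_scale lookup_add algebra_simps)

lemma bilin_ext_pm_sum: "bilin_ext h p r = pm_sum (\<lambda>i a. pm_sum (\<lambda>j b. h i a j b) r) p"
  by (simp add: bilin_ext_def pm_sum_def)

lemma bilin_ext_add:
  assumes "\<And>i j b. h i 0 j b = 0" "\<And>i a j. h i a j 0 = 0"
    and "\<And>i a a' j b. h i (a + a') j b = h i a j b + h i a' j b"
    and "\<And>i a j b b'. h i a j (b + b') = h i a j b + h i a j b'"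
  shows "bilin_ext h (p + p') r = bilin_ext h p r + bilin_ext h p' r"
    and "bilin_ext h p (r + r') = bilin_ext h p r + bilin_ext h p r'"
proof -
  show "bilin_ext h (p + p') r = bilin_ext h p r + bilin_ext h p' r"
    unfolding bilin_ext_pm_sum
  proof (rule pm_sum_add)
    show "pm_sum (h i 0) r = 0" for i by (simp add: assms(1) pm_sum_def)
    show "pm_sum (h i (a + b)) r = pm_sum (h i a) r + pm_sum (h i b) r" for i a b
      by (simp add: assms(3) pm_sum_def sum.distrib)
  qed
  have *: "pm_sum (h i a) (r + r') = pm_sum (h i a) r + pm_sum (h i a) r'" for i a
    by (rule pm_sum_add) (simp_all add: assms)
  show "bilin_ext h p (r + r') = bilin_ext h p r + bilin_ext h p r'"
    unfolding bilin_ext_pm_sum * pm_sum_fun_add ..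
qed

section \<open>Linear combinations, the identity field and partial fractions\<close>

context cspace
begin

definition idf :: "int \<Rightarrow> 'w \<Rightarrow> 'w" where
  "idf k w = (if k = 0 then w else 0)"

lemma vfield_idf: "vfield idf"
  by (auto simp: vfield_def homog_map_def idf_def lower_truncated_def intro: exI[of _ 0])

lemma vfield_comb: "vfield a \<Longrightarrow> vfield b \<Longrightarrow> vfield (\<lambda>k w. x *s a k w + y *s b k w)"
  unfolding vfield_def homog_map_def
  by (auto simp: lower_truncated_add algebra_simps)

lemma vfield_0: "vfield (\<lambda>k w. 0)"
  by (auto simp: vfield_def homog_map_def lower_truncated_def)

lemma ope_comb_left:
  assumes "ope rs a c C" "ope ss b c D" "vfield c"
  shows "ope (rs @ ss) (\<lambda>k w. x *s a k w + y *s b k w) c (\<lambda>i k w. x *s C i k w + y *s D i k w)"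
  unfolding ope_def
proof (intro allI)
  fix N w
  have "c k (x *s u + y *s v) = x *s c k u + y *s c k v" for k u v
    using vfield_homog[OF assms(3)] by (simp add: homog_map_def)
  then have "opG (\<lambda>k w. x *s a k w + y *s b k w) c N w = (\<lambda>i. x *s opG a c N w i + y *s opG b c N w i)"
    by (simp add: opG_eq)
  moreover have "opF (\<lambda>k w. x *s a k w + y *s b k w) c N w = (\<lambda>i. x *s opF a c N w i + y *s opF b c N w i)"
    by (simp add: opF_eq)
  ultimately show "expansions (rs @ ss) (opF (\<lambda>k w. x *s a k w + y *s b k w) c N w)
      (opG (\<lambda>k w. x *s a k w + y *s b k w) c N w) (\<lambda>i. x *s C i (N - i) w + y *s D i (N - i) w)"
    using expansions_comb assms(1,2) unfolding ope_def by simp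
qed

lemma ope_comb_right:
  assumes "ope rs c a C" "ope ss c b D" "vfield c"
  shows "ope (rs @ ss) c (\<lambda>k w. x *s a k w + y *s b k w) (\<lambda>i k w. x *s C i k w + y *s D i k w)"
  unfolding ope_def
proof (intro allI)
  fix N w
  have "c k (x *s u + y *s v) = x *s c k u + y *s c k v" for k u v
    using vfield_homog[OF assms(3)] by (simp add: homog_map_def)
  then have "opF c (\<lambda>k w. x *s a k w + y *s b k w) N w = (\<lambda>i. x *s opF c a N w i + y *s opF c b N w i)"
    by (simp add: opF_eq)
  moreover have "opG c (\<lambda>k w. x *s a k w + y *s b k w) N w = (\<lambda>i. x *s opG c a N w i + y *s opG c b N w i)"
    by (simp add: opG_eq)
  ultimately show "expansions (rs @ ss) (opF c (\<lambda>k w. x *s a k w + y *s b k w) N w)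
      (opG c (\<lambda>k w. x *s a k w + y *s b k w) N w) (\<lambda>i. x *s C i (N - i) w + y *s D i (N - i) w)"
    using expansions_comb assms(1,2) unfolding ope_def by simp
qed

lemma qlocal_comb_right:
  assumes "vfield a" "vfield b" "vfield c" "qlocal c a" "qlocal c b"
  shows "qlocal c (\<lambda>k w. x *s a k w + y *s b k w)"
proof -
  obtain rs ss where "ope rs c a (vprod c a)" "ope ss c b (vprod c b)"
    using ope_vprod assms by blast
  from ope_comb_right[OF this assms(3)] show ?thesis by (rule ope_qlocal)
qed

lemma qlocal_comb_left:
  assumes "vfield a" "vfield b" "vfield c" "qlocal a c" "qlocal b c"
  shows "qlocal (\<lambda>k w. x *s a k w + y *s b k w) c"
  using assms qlocal_comb_right qlocal_sym by blast

lemma vprod_comb_left: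
  assumes "vfield a" "vfield b" "vfield c" "qlocal a c" "qlocal b c"
  shows "vprod (\<lambda>k w. x *s a k w + y *s b k w) c = (\<lambda>i k w. x *s vprod a c i k w + y *s vprod b c i k w)"
proof -
  obtain rs ss where "ope rs a c (vprod a c)" "ope ss b c (vprod b c)"
    using ope_vprod assms by blast
  from ope_unique[OF ope_comb_left[OF this assms(3)]] show ?thesis by simp
qed

lemma vprod_comb_right:
  assumes "vfield a" "vfield b" "vfield c" "qlocal c a" "qlocal c b"
  shows "vprod c (\<lambda>k w. x *s a k w + y *s b k w) = (\<lambda>i k w. x *s vprod c a i k w + y *s vprod c b i k w)"
proof -
  obtain rs ss where "ope rs c a (vprod c a)" "ope ss c b (vprod c b)"
    using ope_vprod assms by blast
  from ope_unique[OF ope_comb_right[OF this assms(3)]] show ?thesis by simp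
qed

lemma expansions_monomial:
  "expansions [] (\<lambda>i. if i = n then w else 0) (\<lambda>i. if i = n then w else 0) (\<lambda>i. ibinom n i *s w)"
proof -
  let ?H = "\<lambda>i. if i = n then w else 0"
  have "tay ?H = (\<lambda>i. ibinom n i *s w)"
    by (rule ext) (subst tay_eq_sum[of "{n}"], auto)
  then show ?thesis
    using expansions_finite[of ?H] by (force simp: upper_truncated_def lower_truncated_def)
qed

text \<open>This is a(x_2 + x_0) expanded in powers of x_0, the creation property. Negative powers
  of x_0 are absent because \<open>ibinom\<close> vanishes at negative lower index.\<close>

lemma ope_idf_right: "vfield a \<Longrightarrow> ope [] a idf (\<lambda>i k w. ibinom (i + k) i *s a (i + k) w)"
  unfolding ope_def
proof (intro allI)
  fix N w
  assume a: "vfield a"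
  have "opF a idf N w = (\<lambda>i. if i = N then a N w else 0)"
    by (auto simp: opF_eq idf_def vfield_zero[OF a])
  moreover have "opG a idf N w = (\<lambda>i. if i = N then a N w else 0)"
    by (auto simp: opG_eq idf_def)
  ultimately show "expansions [] (opF a idf N w) (opG a idf N w) (\<lambda>i. ibinom (i + (N - i)) i *s a (i + (N - i)) w)"
    using expansions_monomial[of N "a N w"] by simp
qed

lemma ope_idf_left: "vfield a \<Longrightarrow> ope [] idf a (\<lambda>i k w. if i = 0 then a k w else 0)"
  unfolding ope_def
proof (intro allI)
  fix N w
  assume a: "vfield a"
  have "opF idf a N w = (\<lambda>i. if i = 0 then a N w else 0)"
    by (auto simp: opF_eq idf_def)
  moreover have "opG idf a N w = (\<lambda>i. if i = 0 then a N w else 0)"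
    by (auto simp: opG_eq idf_def vfield_zero[OF a])
  moreover have "(\<lambda>i. ibinom 0 i *s a N w) = (\<lambda>i. if i = 0 then a (N - i) w else 0)"
    by (auto simp: ibinom_zero_left)
  ultimately show "expansions [] (opF idf a N w) (opG idf a N w) (\<lambda>i. if i = 0 then a (N - i) w else 0)"
    using expansions_monomial[of 0 "a N w"] by simp
qed

lemma vprod_idf_left: "vfield a \<Longrightarrow> vprod idf a = (\<lambda>i k w. if i = 0 then a k w else 0)"
  using ope_unique[OF ope_idf_left] by simp

lemma vprod_idf_right: "vfield a \<Longrightarrow> vprod a idf = (\<lambda>i k w. ibinom (i + k) i *s a (i + k) w)"
  using ope_unique[OF ope_idf_right] by simp

lemma geometric_truncated:
  "upper_truncated (\<lambda>i. if i < 0 then f i else (0 :: 'w))"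
  "lower_truncated (\<lambda>i. if i < 0 then (0 :: 'w) else f i)"
  by (auto simp: upper_truncated_def lower_truncated_def intro: exI[of _ 0])

lemma powi_diff_1: "(\<rho> :: complex) \<noteq> 0 \<Longrightarrow> \<rho> powi (i - 1) = inverse \<rho> * \<rho> powi i"
  by (simp add: power_int_diff field_simps)

text \<open>The two sequences expand w/(\<rho> z - 1) at infinity and at 0. The only pole is
  1/\<rho>; it lies at z = 1 precisely for \<rho> = 1, where the function is w/y.\<close>

lemma expansions_geometric:
  assumes "\<rho> \<noteq> 0"
  shows "\<exists>C. expansions [inverse \<rho>] (\<lambda>i. if i < 0 then \<rho> powi i *s w else 0)
      (\<lambda>i. if i < 0 then 0 else (- (\<rho> powi i)) *s w) C
    \<and> (\<forall>i<0. C i = (if \<rho> = 1 \<and> i = -1 then w else 0))"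
proof -
  let ?F = "\<lambda>i. if i < 0 then \<rho> powi i *s w else 0"
  let ?G = "\<lambda>i. if i < 0 then 0 else (- (\<rho> powi i)) *s w"
  have F: "lin (inverse \<rho>) ?F = (\<lambda>i. if i = 0 then inverse \<rho> *s w else 0)"
    using assms by (auto simp: lin_def fun_eq_iff powi_diff_1)
  have G: "lin (inverse \<rho>) ?G = (\<lambda>i. if i = 0 then inverse \<rho> *s w else 0)"
    using assms by (auto simp: lin_def fun_eq_iff powi_diff_1)
  show ?thesis
  proof (cases "\<rho> = 1")
    case True
    let ?C = "\<lambda>i. if i = -1 then w else (0 :: 'w)"
    have C: "lin (inverse \<rho> - 1) ?C = (\<lambda>i. ibinom 0 i *s inverse \<rho> *s w)"
      using True by (auto simp: lin_def fun_eq_iff ibinom_zero_left)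
    have "lower_truncated ?C" by (auto simp: lower_truncated_def intro: exI[of _ "-1"])
    then have "expansions [inverse \<rho>] ?F ?G ?C"
      by (intro expansions_strip_Cons geometric_truncated) (simp only: F G C, rule expansions_monomial)
    then show ?thesis using True by (intro exI[of _ ?C]) simp
  next
    case False
    obtain C where C: "expansions [inverse \<rho>] ?F ?G C"
      using expansions_exists[OF geometric_truncated, of "[inverse \<rho>]" "\<lambda>i. \<rho> powi i *s w" "\<lambda>i. (- (\<rho> powi i)) *s w"] F G
      by (auto simp: lins_Cons)
    have "1 \<notin> set [inverse \<rho>]" using False by auto
    then have "C i = 0" if "i < 0" for i
      using that by (rule expansions_below(2)[OF C])
    with C show ?thesis using False by (intro exI[of _ C]) simp
  qed
qed

text \<open>The same for w/(\<rho> z - 1)^2, reduced to the simple pole by one linear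
  factor.\<close>

lemma expansions_geometric2:
  assumes "\<rho> \<noteq> 0"
  shows "\<exists>C. expansions [inverse \<rho>, inverse \<rho>] (\<lambda>i. if i < 0 then (of_int (- i - 1) * \<rho> powi i) *s w else 0)
      (\<lambda>i. if i < 0 then 0 else (- (of_int (- i - 1) * \<rho> powi i)) *s w) C
    \<and> (\<forall>i<0. C i = (if \<rho> = 1 \<and> i = -2 then w else 0))"
proof -
  let ?F = "\<lambda>i. if i < 0 then (of_int (- i - 1) * \<rho> powi i) *s w else 0"
  let ?G = "\<lambda>i. if i < 0 then 0 else (- (of_int (- i - 1) * \<rho> powi i)) *s w"
  obtain C1 where C1: "expansions [inverse \<rho>] (\<lambda>i. if i < 0 then \<rho> powi i *s (inverse \<rho> *s w) else 0)
      (\<lambda>i. if i < 0 then 0 else (- (\<rho> powi i)) *s (inverse \<rho> *s w)) C1"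
    "\<forall>i<0. C1 i = (if \<rho> = 1 \<and> i = -1 then inverse \<rho> *s w else 0)"
    using expansions_geometric[OF assms, of "inverse \<rho> *s w"] by blast
  have sc: "of_int (- (i - 1) - 1) * \<rho> powi (i - 1) - inverse \<rho> * (of_int (- i - 1) * \<rho> powi i)
      = \<rho> powi i * inverse \<rho>" for i
    unfolding powi_diff_1[OF assms] by (simp add: algebra_simps)
  have F: "lin (inverse \<rho>) ?F i = (if i < 0 then \<rho> powi i *s (inverse \<rho> *s w) else 0)" for i
  proof -
    consider "i < 0" | "i = 0" | "i > 0" by linarith
    then show ?thesis
    proof cases
      case 1
      then have "lin (inverse \<rho>) ?F i = (of_int (- (i - 1) - 1) * \<rho> powi (i - 1)
          - inverse \<rho> * (of_int (- i - 1) * \<rho> powi i)) *s w"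
        by (simp only: lin_def scale_left_diff_distrib scale_scale) simp
      then show ?thesis unfolding sc using 1 by simp
    qed (simp_all add: lin_def)
  qed
  have G: "lin (inverse \<rho>) ?G i = (if i < 0 then 0 else (- (\<rho> powi i)) *s (inverse \<rho> *s w))" for i
  proof -
    consider "i < 0" | "i = 0" | "i > 0" by linarith
    then show ?thesis
    proof cases
      case 3
      then have "lin (inverse \<rho>) ?G i = - ((of_int (- (i - 1) - 1) * \<rho> powi (i - 1)
          - inverse \<rho> * (of_int (- i - 1) * \<rho> powi i)) *s w)"
        by (simp only: lin_def scale_left_diff_distrib scale_scale) simp
      then show ?thesis unfolding sc using 3 by simp
    qed (simp_all add: lin_def)
  qed
  have F: "lin (inverse \<rho>) ?F = (\<lambda>i. if i < 0 then \<rho> powi i *s (inverse \<rho> *s w) else 0)"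
    and G: "lin (inverse \<rho>) ?G = (\<lambda>i. if i < 0 then 0 else (- (\<rho> powi i)) *s (inverse \<rho> *s w))"
    by (rule ext, rule F, rule ext, rule G)
  show ?thesis
  proof (cases "\<rho> = 1")
    case True
    have "lower_truncated C1" using C1(1) by (simp add: expansions_def)
    then have lt: "lower_truncated (\<lambda>i. C1 (i + 1))" by (simp add: lower_truncated_shift)
    have C1': "lin (inverse \<rho> - 1) (\<lambda>i. C1 (i + 1)) = C1" using True by (simp add: lin_def)
    have "expansions [inverse \<rho>, inverse \<rho>] ?F ?G (\<lambda>i. C1 (i + 1))"
      by (rule expansions_strip_Cons, unfold F G C1')
         (rule C1(1) geometric_truncated lt)+
    moreover have "C1 (i + 1) = (if \<rho> = 1 \<and> i = - 2 then w else 0)" if "i < 0" for i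
    proof (cases "i = -1")
      case True
      have "expansions [1, 1] ?F ?G (\<lambda>i. C1 (i + 1))"
        using \<open>expansions [inverse \<rho>, inverse \<rho>] ?F ?G (\<lambda>i. C1 (i + 1))\<close> \<open>\<rho> = 1\<close> by simp
      \<comment> \<open>\<open>C1\<close> is known only at negative indices, so \<open>C1 0\<close>,
        the residue of the double pole, has to come from the residue theorem. It is 0 because the
        factor -i - 1 vanishes at i = -1 and \<open>?G\<close> has no negative terms.\<close>
      moreover have "jacobi_defect ?F ?G (\<lambda>i. C1 (i + 1)) (-1) (-1) = 0"
        using calculation by (rule expansions_jacobi_defect) simp
      moreover have "pairing (jker1 (-1) (-1)) ?F = (\<Sum>m\<in>{-1}. jker1 (-1) (-1) m *s ?F m)"
        "pairing (jker2 (-1) (-1)) ?G = (\<Sum>m\<in>{-1}. jker2 (-1) (-1) m *s ?G m)"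
        "pairing (jker3 (-1) (-1)) (\<lambda>i. C1 (i + 1)) = (\<Sum>m\<in>{-1}. jker3 (-1) (-1) m *s C1 (m + 1))"
        by (rule pairing_eq_sum; auto simp: jker1_def jker2_def jker3_def ibinom_zero_left split: if_splits)+
      ultimately have "C1 0 = 0"
        by (simp add: jacobi_defect_def jker3_def jker2_def)
      then show ?thesis using True by simp
    next
      case False
      then show ?thesis using C1(2) that True by auto
    qed
    ultimately show ?thesis by blast
  next
    case False
    have "lins [inverse \<rho>, inverse \<rho>] ?F = lins [inverse \<rho>, inverse \<rho>] ?G"
      using C1(1) F G by (simp add: expansions_def lins_Cons lin_commute)
    from expansions_exists[OF geometric_truncated this]
    obtain C where C: "expansions [inverse \<rho>, inverse \<rho>] ?F ?G C" ..
    have "1 \<notin> set [inverse \<rho>, inverse \<rho>]" using False by auto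
    then have "C i = 0" if "i < 0" for i
      using that by (rule expansions_below(2)[OF C])
    with C show ?thesis using False by (intro exI[of _ C]) simp
  qed
qed

text \<open>The commutator is a sum of delta functions at 1/\<rho> and 1/\<sigma> and a derivative
  of one at 1/\<rho>, each being the difference of two expansions of a partial fraction. Subtracting
  the partial fractions from F and G leaves the same sequence \<open>H\<close>. It is truncated on
  both sides, hence regular at 1. The roots are those of the three fractions, concatenated.\<close>

lemma expansions_commutator:
  assumes \<rho>: "\<rho> \<noteq> 0" "\<sigma> \<noteq> 0" and t: "upper_truncated F" "lower_truncated G"
    and comm: "\<And>i. F i - G i = \<rho> powi i *s u + \<sigma> powi i *s v + (of_int (- i - 1) * \<rho> powi i) *s z"
  shows "\<exists>C. expansions [inverse \<rho>, inverse \<sigma>, inverse \<rho>, inverse \<rho>] F G C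
    \<and> C (-1) = (if \<rho> = 1 then u else 0) + (if \<sigma> = 1 then v else 0)
    \<and> C (-2) = (if \<rho> = 1 then z else 0) \<and> (\<forall>i< -2. C i = 0)"
proof -
  let ?FG = "\<lambda>f i. if i < (0::int) then f i else (0::'w)" and ?GG = "\<lambda>f i. if i < (0::int) then 0 else (f i :: 'w)"
  obtain C1 where C1: "expansions [inverse \<rho>] (?FG (\<lambda>i. \<rho> powi i *s u)) (?GG (\<lambda>i. (- (\<rho> powi i)) *s u)) C1"
    "\<forall>i<0. C1 i = (if \<rho> = 1 \<and> i = -1 then u else 0)" using expansions_geometric[OF \<rho>(1)] by blast
  obtain C2 where C2: "expansions [inverse \<sigma>] (?FG (\<lambda>i. \<sigma> powi i *s v)) (?GG (\<lambda>i. (- (\<sigma> powi i)) *s v)) C2"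
    "\<forall>i<0. C2 i = (if \<sigma> = 1 \<and> i = -1 then v else 0)" using expansions_geometric[OF \<rho>(2)] by blast
  obtain C3 where C3: "expansions [inverse \<rho>, inverse \<rho>] (?FG (\<lambda>i. (of_int (- i - 1) * \<rho> powi i) *s z))
      (?GG (\<lambda>i. (- (of_int (- i - 1) * \<rho> powi i)) *s z)) C3"
    "\<forall>i<0. C3 i = (if \<rho> = 1 \<and> i = -2 then z else 0)" using expansions_geometric2[OF \<rho>(1)] by blast
  have E: "expansions [inverse \<rho>, inverse \<sigma>, inverse \<rho>, inverse \<rho>] (?FG (\<lambda>i. F i - G i)) (?GG (\<lambda>i. - (F i - G i)))
      (\<lambda>i. C1 i + C2 i + C3 i)" (is "expansions ?rs ?F0 ?G0 ?C0")
  proof -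
    have 1: "(\<lambda>i. 1 *s (1 *s ?FG (\<lambda>i. \<rho> powi i *s u) i + 1 *s ?FG (\<lambda>i. \<sigma> powi i *s v) i)
        + 1 *s ?FG (\<lambda>i. (of_int (- i - 1) * \<rho> powi i) *s z) i) = ?F0" by (auto simp: comm)
    have 2: "(\<lambda>i. 1 *s (1 *s ?GG (\<lambda>i. (- (\<rho> powi i)) *s u) i + 1 *s ?GG (\<lambda>i. (- (\<sigma> powi i)) *s v) i)
        + 1 *s ?GG (\<lambda>i. (- (of_int (- i - 1) * \<rho> powi i)) *s z) i) = ?G0" unfolding comm by auto
    show ?thesis
      using expansions_comb[OF expansions_comb[OF C1(1) C2(1), of 1 1] C3(1), of 1 1] unfolding 1 2 by simp
  qed
  define H where "H i = F i - ?F0 i" for i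
  have H': "H i = G i - ?G0 i" for i by (simp add: H_def)
  have HF: "H = (\<lambda>i. F i - ?F0 i)" and HG: "H = (\<lambda>i. G i - ?G0 i)"
    by (rule ext, rule H_def, rule ext, rule H')
  have Ht: "upper_truncated H" "lower_truncated H"
    by (subst HF, rule upper_truncated_diff[OF t(1) geometric_truncated(1)],
        subst HG, rule lower_truncated_diff[OF t(2) geometric_truncated(2)])
  from expansions_comb[OF E expansions_finite[OF Ht], of 1 1]
  have "expansions ?rs (\<lambda>i. ?F0 i + H i) (\<lambda>i. ?G0 i + H i) (\<lambda>i. ?C0 i + tay H i)" by simp
  moreover have "(\<lambda>i. ?F0 i + H i) = F" by (auto simp: H_def)
  moreover have "(\<lambda>i. ?G0 i + H i) = G" by (auto simp: H')
  ultimately have "expansions ?rs F G (\<lambda>i. ?C0 i + tay H i)" by simp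
  then show ?thesis using C1(2) C2(2) C3(2) by (intro exI[of _ "\<lambda>i. ?C0 i + tay H i"]) (auto simp: tay_neg)
qed

end

lemma star_mult_single:
  "star_mult (Poly_Mapping.single (m, n) a) (Poly_Mapping.single (r, s) b)
     = (if m + n = s then Poly_Mapping.single (m + r, n) (a * b) else 0)"
  unfolding star_mult_def by (subst bilin_ext_single) auto

lemma star_mult_add:
  "star_mult (p + p') r = star_mult p r + star_mult p' r"
  "star_mult p (r + r') = star_mult p r + star_mult p r'"
  unfolding star_mult_def
  by (rule bilin_ext_add; auto simp: algebra_simps single_add split: if_splits)+

lemma star_bracket_add:
  "star_bracket (p + p') r = star_bracket p r + star_bracket p' r"
  "star_bracket p (r + r') = star_bracket p r + star_bracket p r'"
  by (simp_all add: star_bracket_def star_mult_add algebra_simps)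

lemma star_bracket_zero: "star_bracket 0 r = 0" "star_bracket p 0 = 0"
  by (simp_all add: star_bracket_def star_mult_def bilin_ext_def)

lemma pm_scale_zero: "pm_scale s c 0 = 0"
  by (rule poly_mapping_eqI) (simp add: pm_scale_def Poly_Mapping.map.rep_eq)

section \<open>The fields of A_* and their singular terms\<close>

locale quantum_torus_module =
  fixes scA :: "complex \<Rightarrow> 'a::ring \<Rightarrow> 'a"
    and form :: "'a \<Rightarrow> 'a \<Rightarrow> complex"
    and q l :: complex
    and scW :: "complex \<Rightarrow> 'w::ab_group_add \<Rightarrow> 'w"
    and actW :: "'a qtorus \<Rightarrow> 'w \<Rightarrow> 'w"
  assumes algebra: "assoc_algebra scA"
    and form: "symmetric_invariant_form scA form"
    and q0: "q \<noteq> 0"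
    and q_root: "\<forall>n::nat. n > 0 \<longrightarrow> q ^ n \<noteq> 1"
    and act: "lie_module (qtorus_scale scA) (qtorus_bracket scA form q) scW actW"
    and restricted: "restricted_module actW"
    and c0: "\<forall>w. actW qtorus_c0 w = scW l w"
    and c1: "\<forall>w. actW qtorus_c1 w = 0"
begin

sublocale W: cspace scW
  using act unfolding lie_module_def Vector_Spaces.linear_iff cspace_def by blast

sublocale A: vector_space scA
  using algebra by (simp add: assoc_algebra_def)

lemma form_add: "form (a + b) c = form a c + form b c" "form a (b + c) = form a b + form a c"
  and form_scale: "form (scA x a) b = x * form a b" "form a (scA x b) = x * form a b"
  using form unfolding symmetric_invariant_form_def Vector_Spaces.linear_iff by auto

lemma form_zero: "form 0 b = 0" "form b 0 = 0"
  using form_scale(1)[of 0 0 b] form_scale(2)[of b 0 0] by simp_all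

lemma star_form_single:
  "star_form form (Poly_Mapping.single (m, n) a) (Poly_Mapping.single (r, s) b)
     = (if m + r = 0 \<and> n + m = s then form a b else 0)"
  unfolding star_form_def by (subst bilin_ext_single) (auto simp: form_zero)

lemma star_form_add:
  "star_form form (p + p') r = star_form form p r + star_form form p' r"
  "star_form form p (r + r') = star_form form p r + star_form form p r'"
  unfolding star_form_def
  by (rule bilin_ext_add; auto simp: form_zero form_add split: if_splits)+

lemma star_form_zero: "star_form form 0 r = 0" "star_form form p 0 = 0"
  by (simp_all add: star_form_def bilin_ext_def)

lemma actW_left: "actW (x + y) w = actW x w + actW y w" "actW (qtorus_scale scA c x) w = scW c (actW x w)"
  and actW_right: "actW x (w + w') = actW x w + actW x w'" "actW x (scW c w) = scW c (actW x w)"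
  and actW_bracket: "actW (qtorus_bracket scA form q x y) w = actW x (actW y w) - actW y (actW x w)"
  using act unfolding lie_module_def Vector_Spaces.linear_iff by blast+

text \<open>The term with c_1, which would add a scalar to the simple pole, disappears because c_1
  acts as zero.\<close>

lemma actW_mono_bracket:
  "actW (qtorus_mono a M m) (actW (qtorus_mono b R r) w) - actW (qtorus_mono b R r) (actW (qtorus_mono a M m) w)
   = scW (q powi (m * R)) (actW (qtorus_mono (a * b) (M + R) (m + r)) w)
     - scW (q powi (M * r)) (actW (qtorus_mono (b * a) (M + R) (m + r)) w)
     + (if M + R = 0 \<and> m + r = 0 then scW (form a b * q powi (m * R) * of_int M * l) w else 0)"
proof -
  define x where "x = (if M + R = 0 \<and> m + r = 0 then form a b * q powi (m * R) * of_int M else 0)"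
  define y where "y = (if M + R = 0 \<and> m + r = 0 then form a b * q powi (m * R) * of_int m else 0)"
  let ?m = "\<lambda>a. qtorus_mono a (M + R) (m + r)"
  have "qtorus_bracket scA form q (qtorus_mono a M m) (qtorus_mono b R r)
     = (Poly_Mapping.single (M + R, m + r) (scA (q powi (m * R)) (a * b))
          - Poly_Mapping.single (M + R, m + r) (scA (q powi (M * r)) (b * a)), x, y)"
    unfolding qtorus_bracket_def qtorus_mono_def case_prod_conv
    by (subst bilin_ext_single) (auto simp: form_zero x_def y_def zero_prod_def)
  also have "\<dots> = qtorus_scale scA (q powi (m * R)) (?m (a * b)) + qtorus_scale scA (- (q powi (M * r))) (?m (b * a))
      + (qtorus_scale scA x qtorus_c0 + qtorus_scale scA y qtorus_c1)"
    by (simp add: qtorus_scale_def qtorus_mono_def pm_scale_single qtorus_c0_def qtorus_c1_def pm_scale_zero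
      single_uminus)
  finally have "actW (qtorus_mono a M m) (actW (qtorus_mono b R r) w) - actW (qtorus_mono b R r) (actW (qtorus_mono a M m) w)
     = scW (q powi (m * R)) (actW (?m (a * b)) w) - scW (q powi (M * r)) (actW (?m (b * a)) w) + scW (x * l) w"
    using c0 c1 by (simp add: actW_bracket[symmetric] actW_left)
  then show ?thesis by (simp add: x_def)
qed

definition Xf :: "'a \<Rightarrow> int \<Rightarrow> int \<Rightarrow> int \<Rightarrow> 'w \<Rightarrow> 'w" where
  "Xf a m n k w = Xbar_series scW q actW a m n k w"

lemma Xf_eq: "Xf a m n k w = scW (q powi (n + n * k)) (actW (qtorus_mono a (- k - 1) m) w)"
  using q0 by (simp add: Xf_def Xbar_series_def X_series_def power_int_add power_int_mult)

lemma Xf_add: "Xf (a + b) m n k w = Xf a m n k w + Xf b m n k w"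
proof -
  have "qtorus_mono (a + b) M m = qtorus_mono a M m + qtorus_mono b M m" for M
    by (simp add: qtorus_mono_def single_add)
  then show ?thesis by (simp add: Xf_eq actW_left W.scale_right_distrib)
qed

lemma Xf_scale: "Xf (scA c a) m n k w = scW c (Xf a m n k w)"
proof -
  have "qtorus_mono (scA c a) M m = qtorus_scale scA c (qtorus_mono a M m)" for M
    by (simp add: qtorus_mono_def qtorus_scale_def pm_scale_single)
  then show ?thesis by (simp add: Xf_eq actW_left mult.commute)
qed

lemma Xf_zero: "Xf 0 m n k w = 0"
  using Xf_scale[of 0 0 m n k w] by simp

lemma vfield_Xf: "W.vfield (Xf a m n)"
  unfolding W.vfield_def
proof (intro conjI allI)
  show "homog_map scW scW (Xf a m n k)" for k
    by (simp add: homog_map_def Xf_eq actW_right W.scale_right_distrib mult.commute)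
  fix w
  obtain N where "\<forall>k<N. X_series actW a m k w = 0"
    using restricted unfolding restricted_module_def lower_truncated_def by blast
  then have "\<forall>k<N. Xf a m n k w = 0" by (simp add: Xf_def Xbar_series_def)
  then show "lower_truncated (\<lambda>k. Xf a m n k w)" unfolding lower_truncated_def by blast
qed

definition \<theta> :: "(int \<times> int \<Rightarrow>\<^sub>0 'a) \<Rightarrow> int \<Rightarrow> 'w \<Rightarrow> 'w" where
  "\<theta> u k w = pm_sum (\<lambda>(m, n) a. Xf a m n k w) u"

lemma \<theta>_zero: "\<theta> 0 = (\<lambda>k w. 0)"
  by (rule ext)+ (simp add: \<theta>_def)

lemma \<theta>_add: "\<theta> (u + v) = (\<lambda>k w. \<theta> u k w + \<theta> v k w)"
  by (rule ext)+ (simp add: \<theta>_def pm_sum_add Xf_add Xf_zero case_prod_unfold)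

lemma \<theta>_single: "\<theta> (Poly_Mapping.single (m, n) a) = Xf a m n"
  by (rule ext)+ (simp add: \<theta>_def pm_sum_single Xf_zero)

lemma \<theta>_scale: "\<theta> (pm_scale scA c u) = (\<lambda>k w. scW c (\<theta> u k w))"
  unfolding \<theta>_def
  by (rule ext)+ (rule pm_sum_scale; simp add: Xf_zero Xf_scale W.scale_right_distrib case_prod_unfold)

lemma vfield_\<theta>: "W.vfield (\<theta> u)"
proof (induction u rule: pm_induct)
  case zero
  show ?case by (simp add: \<theta>_zero W.vfield_0)
next
  case (single i a)
  show ?case by (cases i) (simp add: \<theta>_single vfield_Xf)
next
  case (add p p')
  then show ?case using W.vfield_comb[of "\<theta> p" "\<theta> p'" 1 1] by (simp add: \<theta>_add)
qed

lemma q_powi_eq_1: "q powi n = 1 \<longleftrightarrow> n = 0"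
proof
  assume n: "q powi n = 1"
  show "n = 0"
  proof (rule ccontr)
    assume "n \<noteq> 0"
    then have "nat \<bar>n\<bar> > 0" by simp
    moreover have "q ^ nat \<bar>n\<bar> = 1"
      using n by (cases "n \<ge> 0") (auto simp: power_int_def power_inverse)
    ultimately show False using q_root by blast
  qed
qed simp

text \<open>The operator product of an affine Lie algebra at level l: the bracket at x_0^(-1), l
  times the form at x_0^(-2), and nothing more singular.\<close>

definition singular_terms :: "(int \<times> int \<Rightarrow>\<^sub>0 'a) \<Rightarrow> (int \<times> int \<Rightarrow>\<^sub>0 'a) \<Rightarrow> bool" where
  "singular_terms u v \<longleftrightarrow> W.qlocal (\<theta> u) (\<theta> v) \<and> W.vprod (\<theta> u) (\<theta> v) (- 1) = \<theta> (star_bracket u v)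
     \<and> W.vprod (\<theta> u) (\<theta> v) (- 2) = (\<lambda>k w. if k = 0 then scW (l * star_form form u v) w else 0)
     \<and> (\<forall>i< - 2. W.vprod (\<theta> u) (\<theta> v) i = (\<lambda>k w. 0))"

text \<open>The products ab and ba contribute one delta function each, at z = 1/\<rho> and z =
  1/\<sigma>. As q is not a root of unity, these points equal 1 exactly under the two Kronecker
  conditions in the commutator of A_*. The central term carries the factor -i - 1 and thus gives the
  double pole.\<close>

lemma singular_terms_single:
  "singular_terms (Poly_Mapping.single (m, n) a) (Poly_Mapping.single (r, s) b)"
proof -
  let ?u = "Poly_Mapping.single (m, n) a" and ?v = "Poly_Mapping.single (r, s) b"
  \<comment> \<open>\<open>\<rho>\<close> and \<open>\<sigma>\<close> collect the powers of q whose
    exponent is linear in i; \<open>\<alpha>\<close> and \<open>\<beta>\<close> below collect the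
    rest, which depends on N only.\<close>
  define \<rho> where "\<rho> = q powi (n + m - s)"
  define \<sigma> where "\<sigma> = q powi (n - s - r)"
  have nz: "\<rho> \<noteq> 0" "\<sigma> \<noteq> 0" using q0 by (simp_all add: \<rho>_def \<sigma>_def)
  have one: "\<rho> = 1 \<longleftrightarrow> m + n = s" "\<sigma> = 1 \<longleftrightarrow> r + s = n"
    by (auto simp: \<rho>_def \<sigma>_def q_powi_eq_1)
  let ?rs = "[inverse \<rho>, inverse \<sigma>, inverse \<rho>, inverse \<rho>]"
  define \<alpha> where "\<alpha> N = q powi (n + s + s * N - m * N - m)" for N
  define \<beta> where "\<beta> N = q powi (n + s + s * N - r)" for N
  define A where "A N w = scW (\<alpha> N) (actW (qtorus_mono (a * b) (- N - 2) (m + r)) w)" for N w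
  define B where "B N w = - scW (\<beta> N) (actW (qtorus_mono (b * a) (- N - 2) (m + r)) w)" for N w
  define Z where "Z N w = (if N = -2 \<and> m + r = 0 then scW (\<alpha> N * form a b * l) w else 0)" for N w
  let ?F = "W.opF (Xf a m n) (Xf b r s)" and ?G = "W.opG (Xf a m n) (Xf b r s)"
  have comm: "?F N w i - ?G N w i = scW (\<rho> powi i) (A N w) + scW (\<sigma> powi i) (B N w)
      + scW (of_int (- i - 1) * \<rho> powi i) (Z N w)" for N w i
  proof -
    let ?M = "- i - 1" and ?R = "- (N - i) - 1"
    let ?\<kappa> = "q powi (n + n * i) * q powi (s + s * (N - i))"
    have MR: "?M + ?R = - N - 2" "?M + ?R = 0 \<longleftrightarrow> N = -2" by auto
    have e1: "?\<kappa> * q powi (m * ?R) = \<rho> powi i * \<alpha> N"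
      unfolding \<rho>_def \<alpha>_def using q0
      by (simp add: power_int_add[symmetric] power_int_mult[symmetric] algebra_simps)
    have e2: "?\<kappa> * q powi (?M * r) = \<sigma> powi i * \<beta> N"
      unfolding \<sigma>_def \<beta>_def using q0
      by (simp add: power_int_add[symmetric] power_int_mult[symmetric] algebra_simps)
    have "?F N w i - ?G N w i = scW ?\<kappa> (actW (qtorus_mono a ?M m) (actW (qtorus_mono b ?R r) w)
        - actW (qtorus_mono b ?R r) (actW (qtorus_mono a ?M m) w))"
      by (simp add: W.opF_def W.opG_def Xf_eq actW_right W.scale_right_diff_distrib mult.commute)
    also have "\<dots> = scW (?\<kappa> * q powi (m * ?R)) (actW (qtorus_mono (a * b) (- N - 2) (m + r)) w)
        - scW (?\<kappa> * q powi (?M * r)) (actW (qtorus_mono (b * a) (- N - 2) (m + r)) w)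
        + (if N = -2 \<and> m + r = 0 then scW ((?\<kappa> * q powi (m * ?R)) * (form a b * of_int ?M * l)) w else 0)"
      unfolding actW_mono_bracket MR
      by (simp add: W.scale_right_distrib W.scale_right_diff_distrib mult_ac)
    also have "\<dots> = scW (\<rho> powi i) (A N w) + scW (\<sigma> powi i) (B N w)
      + scW (of_int (- i - 1) * \<rho> powi i) (Z N w)"
      unfolding e1 e2 A_def B_def Z_def by (simp add: mult_ac)
    finally show ?thesis .
  qed
  have ex: "\<exists>C. W.expansions ?rs (?F N w) (?G N w) C
    \<and> C (-1) = (if \<rho> = 1 then A N w else 0) + (if \<sigma> = 1 then B N w else 0)
    \<and> C (-2) = (if \<rho> = 1 then Z N w else 0) \<and> (\<forall>i< -2. C i = 0)" for N w
    by (rule W.expansions_commutator[OF nz W.opF_truncated W.opG_truncated comm]) (rule vfield_Xf)+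
  have v: "W.vprod (Xf a m n) (Xf b r s) (-1) (N + 1) w = (if \<rho> = 1 then A N w else 0) + (if \<sigma> = 1 then B N w else 0)"
    "W.vprod (Xf a m n) (Xf b r s) (-2) (N + 2) w = (if \<rho> = 1 then Z N w else 0)"
    "\<And>i. i < -2 \<Longrightarrow> W.vprod (Xf a m n) (Xf b r s) i (N - i) w = 0" for N w
  proof -
    obtain C where C: "W.expansions ?rs (?F N w) (?G N w) C"
      "C (-1) = (if \<rho> = 1 then A N w else 0) + (if \<sigma> = 1 then B N w else 0)"
      "C (-2) = (if \<rho> = 1 then Z N w else 0)" "\<forall>i< -2. C i = 0" using ex by blast
    have "C i = W.vprod (Xf a m n) (Xf b r s) i (N - i) w" for i
      using W.expansions_vprod[OF C(1)] by simp
    from this[of "-1"] this[of "-2"] this C(2-)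
    show "W.vprod (Xf a m n) (Xf b r s) (-1) (N + 1) w = (if \<rho> = 1 then A N w else 0) + (if \<sigma> = 1 then B N w else 0)"
      "W.vprod (Xf a m n) (Xf b r s) (-2) (N + 2) w = (if \<rho> = 1 then Z N w else 0)"
      "\<And>i. i < -2 \<Longrightarrow> W.vprod (Xf a m n) (Xf b r s) i (N - i) w = 0"
      by simp_all
  qed
  have "W.lins ?rs (?F N w) = W.lins ?rs (?G N w)" for N w
    using ex[of N w] by (auto simp: W.expansions_def)
  then have loc: "W.qlocal (Xf a m n) (Xf b r s)" unfolding W.qlocal_def by blast
  have br: "\<theta> (star_bracket ?u ?v) k w
      = (if m + n = s then Xf (a * b) (m + r) n k w else 0) - (if r + s = n then Xf (b * a) (r + m) s k w else 0)" for k w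
  proof -
    have "\<theta> (p - p') k w = \<theta> p k w - \<theta> p' k w" for p p'
      using \<theta>_add[of "p - p'" p'] by (simp add: fun_eq_iff)
    then show ?thesis
      by (simp add: star_bracket_def star_mult_single \<theta>_single \<theta>_zero)
  qed
  have 1: "W.vprod (Xf a m n) (Xf b r s) (-1) = \<theta> (star_bracket ?u ?v)"
  proof (rule ext)+
    fix k w
    \<comment> \<open>At the coincidence the remaining exponent of q becomes n + n k, that of the
      field with second index n. This explains t_1^n in the product of C_*.\<close>
    have "A (k - 1) w = Xf (a * b) (m + r) n k w" if "m + n = s"
    proof -
      have "n + s + s * (k - 1) - m * (k - 1) - m = n + n * k"
        unfolding that[symmetric] by (simp add: algebra_simps)
      moreover have "- (k - 1) - 2 = - k - 1" by simp
      ultimately show ?thesis by (simp only: A_def Xf_eq \<alpha>_def)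
    qed
    moreover have "B (k - 1) w = - Xf (b * a) (r + m) s k w" if "r + s = n"
    proof -
      have "n + s + s * (k - 1) - r = s + s * k"
        unfolding that[symmetric] by (simp add: algebra_simps)
      moreover have "- (k - 1) - 2 = - k - 1" "r + m = m + r" by simp_all
      ultimately show ?thesis by (simp only: B_def Xf_eq \<beta>_def)
    qed
    ultimately show "W.vprod (Xf a m n) (Xf b r s) (-1) k w = \<theta> (star_bracket ?u ?v) k w"
      using v(1)[of "k - 1" w] by (simp add: br one)
  qed
  have 2: "W.vprod (Xf a m n) (Xf b r s) (-2) = (\<lambda>k w. if k = 0 then scW (l * star_form form ?u ?v) w else 0)"
  proof (rule ext)+
    fix k w
    have "Z (k - 2) w = (if k = 0 then scW (l * star_form form ?u ?v) w else 0)" if "m + n = s"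
    proof -
      have "n + s + s * (- 2) - m * (- 2) - m = 0" unfolding that[symmetric] by (simp add: algebra_simps)
      then have "\<alpha> (- 2) = 1" by (simp add: \<alpha>_def)
      then show ?thesis using that by (auto simp: Z_def star_form_single mult_ac)
    qed
    then show "W.vprod (Xf a m n) (Xf b r s) (-2) k w = (if k = 0 then scW (l * star_form form ?u ?v) w else 0)"
      using v(2)[of "k - 2" w] by (auto simp: one star_form_single)
  qed
  have 3: "W.vprod (Xf a m n) (Xf b r s) i = (\<lambda>k w. 0)" if "i < -2" for i
  proof (rule ext)+
    fix k w show "W.vprod (Xf a m n) (Xf b r s) i k w = 0" using v(3)[OF that, of "k + i" w] by simp
  qed
  show ?thesis unfolding singular_terms_def \<theta>_single using loc 1 2 3 by blast
qed

lemma singular_terms_add_left: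
  assumes "singular_terms u v" "singular_terms u' v"
  shows "singular_terms (u + u') v"
proof -
  have "W.vprod (\<theta> (u + u')) (\<theta> v) = (\<lambda>i k w. W.vprod (\<theta> u) (\<theta> v) i k w + W.vprod (\<theta> u') (\<theta> v) i k w)"
    using W.vprod_comb_left[of "\<theta> u" "\<theta> u'" "\<theta> v" 1 1] assms by (simp add: \<theta>_add vfield_\<theta> singular_terms_def)
  moreover have "W.qlocal (\<theta> (u + u')) (\<theta> v)"
    using W.qlocal_comb_left[of "\<theta> u" "\<theta> u'" "\<theta> v" 1 1] assms by (simp add: \<theta>_add vfield_\<theta> singular_terms_def)
  ultimately show ?thesis
    using assms by (auto simp: singular_terms_def star_bracket_add star_form_add \<theta>_add fun_eq_iff
      distrib_left W.scale_left_distrib)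
qed

lemma singular_terms_add_right:
  assumes "singular_terms v u" "singular_terms v u'"
  shows "singular_terms v (u + u')"
proof -
  have "W.vprod (\<theta> v) (\<theta> (u + u')) = (\<lambda>i k w. W.vprod (\<theta> v) (\<theta> u) i k w + W.vprod (\<theta> v) (\<theta> u') i k w)"
    using W.vprod_comb_right[of "\<theta> u" "\<theta> u'" "\<theta> v" 1 1] assms by (simp add: \<theta>_add vfield_\<theta> singular_terms_def)
  moreover have "W.qlocal (\<theta> v) (\<theta> (u + u'))"
    using W.qlocal_comb_right[of "\<theta> u" "\<theta> u'" "\<theta> v" 1 1] assms by (simp add: \<theta>_add vfield_\<theta> singular_terms_def)
  ultimately show ?thesis
    using assms by (auto simp: singular_terms_def star_bracket_add star_form_add \<theta>_add fun_eq_iff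
      distrib_left W.scale_left_distrib)
qed

lemma singular_terms_zero: "singular_terms 0 v" "singular_terms v 0"
proof -
  have "W.qlocal (\<lambda>k w. 0) (\<theta> v)"
    unfolding W.qlocal_def by (intro exI[of _ "[]"]) (simp add: W.opF_eq W.opG_eq W.vfield_zero[OF vfield_\<theta>])
  then show "singular_terms 0 v" "singular_terms v 0"
    using W.vprod_zero[OF vfield_\<theta>[of v]] W.qlocal_sym
    by (auto simp: singular_terms_def \<theta>_zero star_bracket_zero star_form_zero fun_eq_iff)
qed

lemma singular_terms: "singular_terms u v"
proof (induction u rule: pm_induct)
  case (single i a)
  show ?case
  proof (induction v rule: pm_induct)
    case (single j b)
    show ?case by (cases i; cases j) (simp add: singular_terms_single)
  qed (simp_all add: singular_terms_zero singular_terms_add_right)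
qed (simp_all add: singular_terms_zero singular_terms_add_left)

text \<open>These will contain the images of all vectors of V. Membership ensures mutual
  quasi-locality, without which \<open>vprod\<close> is unspecified; hence the assumption
  \<open>generated c\<close> in the rules below.\<close>

inductive generated :: "(int \<Rightarrow> 'w \<Rightarrow> 'w) \<Rightarrow> bool" where
  idf: "generated W.idf"
| vprod: "generated c \<Longrightarrow> generated (W.vprod (\<theta> u) c i)"
| comb: "generated c \<Longrightarrow> generated d \<Longrightarrow> generated (\<lambda>k w. scW x (c k w) + scW y (d k w))"

lemma qlocal_\<theta>: "W.qlocal (\<theta> u) (\<theta> v)"
  using singular_terms by (simp add: singular_terms_def)

lemma generated_field: "generated c \<Longrightarrow> W.vfield c \<and> (\<forall>u. W.qlocal (\<theta> u) c)"
proof (induction rule: generated.induct)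
  case idf
  then show ?case using W.vfield_idf W.ope_qlocal[OF W.ope_idf_right[OF vfield_\<theta>]] by blast
next
  case (vprod c u i)
  then show ?case
    using W.vfield_vprod[OF vfield_\<theta>] W.qlocal_sym W.qlocal_vprod[OF vfield_\<theta> _ vfield_\<theta> _ qlocal_\<theta>] by blast
next
  case (comb c d x y)
  then show ?case using W.vfield_comb W.qlocal_comb_right vfield_\<theta> by blast
qed

lemmas vfield_generated = conjunct1[OF generated_field]
  and qlocal_\<theta>_generated = spec[OF conjunct2[OF generated_field]]

lemma qlocal_generated: "generated c \<Longrightarrow> generated d \<Longrightarrow> W.qlocal c d"
proof (induction rule: generated.induct)
  case idf
  then show ?case using W.ope_qlocal[OF W.ope_idf_left] vfield_generated by blast
next
  case (vprod c u i)
  then show ?case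
    using W.qlocal_vprod[OF vfield_\<theta>] vfield_generated qlocal_\<theta>_generated by blast
next
  case (comb c c' x y)
  then show ?case using W.qlocal_comb_left vfield_generated by blast
qed

lemma generated_scale: "generated c \<Longrightarrow> generated (\<lambda>k w. scW x (c k w))"
  using generated.comb[of c c x 0] by simp

lemma generated_add: "generated c \<Longrightarrow> generated d \<Longrightarrow> generated (\<lambda>k w. c k w + d k w)"
  using generated.comb[of c d 1 1] by simp

lemma generated_0: "generated (\<lambda>k w. 0)"
  using generated_scale[OF generated.idf, of 0] by simp

section \<open>The action of the affine Lie algebra on generated fields\<close>

definition actE :: "(int \<times> int \<Rightarrow>\<^sub>0 'a) affine \<Rightarrow> (int \<Rightarrow> 'w \<Rightarrow> 'w) \<Rightarrow> int \<Rightarrow> 'w \<Rightarrow> 'w" where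
  "actE x c k w = pm_sum (\<lambda>n u. W.vprod (\<theta> u) c (- n - 1) k w) (fst x) + scW (snd x * l) (c k w)"

lemma vprod_\<theta>:
  assumes "generated c"
  shows "W.vprod (\<theta> 0) c i k w = 0" and "W.vprod (\<theta> (u + v)) c i k w = W.vprod (\<theta> u) c i k w + W.vprod (\<theta> v) c i k w"
    and "W.vprod (\<theta> (pm_scale scA x u)) c i k w = scW x (W.vprod (\<theta> u) c i k w)"
proof -
  note c = vfield_generated[OF assms] qlocal_\<theta>_generated[OF assms]
  show "W.vprod (\<theta> 0) c i k w = 0" using W.vprod_zero(2)[OF c(1)] by (simp add: \<theta>_zero)
  show "W.vprod (\<theta> (u + v)) c i k w = W.vprod (\<theta> u) c i k w + W.vprod (\<theta> v) c i k w"
    using W.vprod_comb_left[where x = 1 and y = 1, OF vfield_\<theta>[of u] vfield_\<theta>[of v] c(1) c(2) c(2)] by (simp add: \<theta>_add)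
  show "W.vprod (\<theta> (pm_scale scA x u)) c i k w = scW x (W.vprod (\<theta> u) c i k w)"
    using W.vprod_comb_left[where x = x and y = 0, OF vfield_\<theta>[of u] vfield_\<theta>[of u] c(1) c(2) c(2)] by (simp add: \<theta>_scale)
qed

lemma actE_mono: "generated c \<Longrightarrow> actE (affine_mono u n) c = W.vprod (\<theta> u) c (- n - 1)"
  by (rule ext)+ (simp add: actE_def affine_mono_def pm_sum_single vprod_\<theta>)

lemma actE_central: "actE (0, \<alpha>) c = (\<lambda>k w. scW (\<alpha> * l) (c k w))"
  by (rule ext)+ (simp add: actE_def)

lemma actE_add: "generated c \<Longrightarrow> actE (x + y) c = (\<lambda>k w. actE x c k w + actE y c k w)"
  by (rule ext)+ (simp add: actE_def pm_sum_add vprod_\<theta> W.scale_left_distrib distrib_right algebra_simps)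

lemma actE_scale:
  assumes "generated c"
  shows "actE (affine_scale (pm_scale scA) z x) c = (\<lambda>k w. scW z (actE x c k w))"
proof (rule ext)+
  fix k w
  have "pm_sum (\<lambda>n u. W.vprod (\<theta> u) c (- n - 1) k w) (pm_scale (pm_scale scA) z (fst x))
      = scW z (pm_sum (\<lambda>n u. W.vprod (\<theta> u) c (- n - 1) k w) (fst x))"
    by (rule pm_sum_scale) (simp_all add: pm_scale_zero vprod_\<theta>[OF assms] W.scale_right_distrib)
  then show "actE (affine_scale (pm_scale scA) z x) c k w = scW z (actE x c k w)"
    by (simp add: actE_def affine_scale_def case_prod_unfold W.scale_right_distrib mult_ac)
qed

lemma affine_decompose [case_names zero mono central add]:
  assumes "P 0" and "\<And>u n. P (affine_mono u n)" and "\<And>\<alpha>. P (0, \<alpha>)" and "\<And>x y. P x \<Longrightarrow> P y \<Longrightarrow> P (x + y)"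
  shows "P (x :: (int \<times> int \<Rightarrow>\<^sub>0 'a) affine)"
proof -
  obtain p \<alpha> where x: "x = (p, \<alpha>)" by (cases x)
  have "P (p, 0)"
  proof (induction p rule: pm_induct)
    case zero
    then show ?case using assms(1) by (simp add: zero_prod_def)
  next
    case (single i a)
    then show ?case using assms(2)[of a i] by (simp add: affine_mono_def)
  next
    case (add p p')
    then show ?case using assms(4)[of "(p, 0)" "(p', 0)"] by simp
  qed
  from assms(4)[OF this assms(3)[of \<alpha>]] show ?thesis by (simp add: x)
qed

lemma actE_zero: "actE 0 c = (\<lambda>k w. 0)"
  by (rule ext)+ (simp add: actE_def)

lemma generated_actE: "generated c \<Longrightarrow> generated (actE x c)"
proof (induction x rule: affine_decompose)
  case zero
  then show ?case by (simp add: actE_zero generated_0)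
next
  case (mono u n)
  then show ?case by (simp add: actE_mono generated.vprod)
next
  case (central \<alpha>)
  then show ?case by (simp add: actE_central generated_scale)
next
  case (add x y)
  then show ?case by (simp add: actE_add generated_add)
qed

lemma actE_comb:
  assumes c: "generated c" "generated d"
  shows "actE x (\<lambda>k w. scW s (c k w) + scW t (d k w)) = (\<lambda>k w. scW s (actE x c k w) + scW t (actE x d k w))"
proof (induction x rule: affine_decompose)
  case zero
  show ?case by (simp add: actE_zero)
next
  case (mono u n)
  show ?case
    using W.vprod_comb_right[where x = s and y = t, OF vfield_generated[OF c(1)] vfield_generated[OF c(2)]
        vfield_\<theta>[of u] qlocal_\<theta>_generated[OF c(1)] qlocal_\<theta>_generated[OF c(2)]]
    by (simp add: actE_mono c generated.comb)
next
  case (central \<alpha>)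
  show ?case by (simp add: actE_central W.scale_right_distrib mult_ac)
next
  case (add x y)
  then show ?case by (simp add: actE_add c generated.comb W.scale_right_distrib add_ac)
qed

lemma actE_scale_right: "generated c \<Longrightarrow> actE x (\<lambda>k w. scW s (c k w)) = (\<lambda>k w. scW s (actE x c k w))"
  using actE_comb[of c c x s 0] by simp

abbreviation bracket :: "(int \<times> int \<Rightarrow>\<^sub>0 'a) affine \<Rightarrow> _ \<Rightarrow> _" where
  "bracket \<equiv> affine_bracket star_bracket (star_form form)"

lemma bracket_add: "bracket (x + y) z = bracket x z + bracket y z" "bracket z (x + y) = bracket z x + bracket z y"
proof -
  define h where "h = (\<lambda>m (a :: int \<times> int \<Rightarrow>\<^sub>0 'a) n b. (Poly_Mapping.single (m + n) (star_bracket a b),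
    if m + n = 0 then of_int m * star_form form a b else 0))"
  have b: "bracket x y = bilin_ext h (fst x) (fst y)" for x y
    by (simp add: affine_bracket_def h_def case_prod_unfold)
  have "h i 0 j b = 0" "h i a j 0 = 0" "h i (a + a') j b = h i a j b + h i a' j b"
    "h i a j (b + b') = h i a j b + h i a j b'" for i j a a' b b'
    by (simp_all add: h_def star_bracket_zero star_form_zero zero_prod_def star_bracket_add star_form_add
      single_add distrib_left)
  then show "bracket (x + y) z = bracket x z + bracket y z" "bracket z (x + y) = bracket z x + bracket z y"
    unfolding b by (simp_all add: bilin_ext_add)
qed

lemma bracket_mono: "bracket (affine_mono u m) (affine_mono v n)
    = (Poly_Mapping.single (m + n) (star_bracket u v), if m + n = 0 then of_int m * star_form form u v else 0)"
  unfolding affine_bracket_def affine_mono_def case_prod_conv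
  by (subst bilin_ext_single) (simp_all add: star_bracket_zero star_form_zero zero_prod_def)

lemma bracket_central: "bracket (0, \<alpha>) x = 0" "bracket x (0, \<alpha>) = 0"
  by (simp_all add: affine_bracket_def bilin_ext_def case_prod_unfold)

text \<open>The residue in x_0 of the Jacobi identity for \<theta> u, \<theta> v and c. By
  \<open>vprod_jacobi\<close> the poles are only at 0 and 1, so no multiplier is involved, and the
  singular terms of \<theta> u and \<theta> v supply the bracket and the form.\<close>

lemma actE_bracket_mono:
  assumes c: "generated c"
  shows "actE (bracket (affine_mono u m) (affine_mono v n)) c k w
    = actE (affine_mono u m) (actE (affine_mono v n) c) k w - actE (affine_mono v n) (actE (affine_mono u m) c) k w"
proof -
  note c' = vfield_generated[OF c] qlocal_\<theta>_generated[OF c]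
  \<comment> \<open>The modes m and n are the coefficients of exponents -m - 1 and -n - 1.\<close>
  define N where "N = - m - n - 2"
  let ?F = "\<lambda>i. W.vprod (\<theta> u) (W.vprod (\<theta> v) c (N - i)) i k w"
  let ?G = "\<lambda>i. W.vprod (\<theta> v) (W.vprod (\<theta> u) c i) (N - i) k w"
  let ?C = "\<lambda>i. W.vprod (W.vprod (\<theta> u) (\<theta> v) i) c (N - i) k w"
  obtain rs where rs: "set rs \<subseteq> {0, 1}" "W.expansions rs ?F ?G ?C"
    using W.vprod_jacobi[OF vfield_\<theta> vfield_\<theta> c'(1) qlocal_\<theta> c'(2) c'(2)] by blast
  have p: "W.vprod (\<theta> u) (\<theta> v) (- 1) = \<theta> (star_bracket u v)"
    "W.vprod (\<theta> u) (\<theta> v) (- 2) = (\<lambda>k w. if k = 0 then scW (l * star_form form u v) w else 0)"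
    "\<And>i. i < - 2 \<Longrightarrow> W.vprod (\<theta> u) (\<theta> v) i = (\<lambda>k w. 0)"
    using singular_terms[of u v] by (auto simp: singular_terms_def)
  have j: "W.jacobi_defect ?F ?G ?C (- 1) (- m - 1) = 0"
    by (rule W.expansions_jacobi_defect[OF rs(2,1)])
  have z: "?C i = 0" if "i < -2" for i
    using p(3)[OF that] W.vprod_zero(2)[OF c'(1)] by simp
  \<comment> \<open>Regular terms are removed by the kernel. The two singular ones get the
    coefficients m choose 0 and m choose 1; the latter is the factor in the central term of the
    affine bracket.\<close>
  have "W.pairing (jker3 (- 1) (- m - 1)) ?C = (\<Sum>i\<in>{-1, -2}. scW (jker3 (- 1) (- m - 1) i) (?C i))"
  proof (rule W.pairing_eq_sum)
    have "i \<in> {-1, -2}" if "jker3 (- 1) (- m - 1) i \<noteq> 0" "?C i \<noteq> 0" for i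
    proof -
      have "\<not> i < - 2" using z that(2) by blast
      moreover have "\<not> - 1 < i" using that(1) by (auto simp: jker3_def)
      ultimately have "i = -1 \<or> i = -2" by linarith
      then show ?thesis by simp
    qed
    then show "{i. jker3 (- 1) (- m - 1) i \<noteq> 0 \<and> ?C i \<noteq> 0} \<subseteq> {-1, -2}" by blast
  qed simp
  also have "\<dots> = ?C (-1) + scW (of_int m) (?C (-2))"
    by (simp add: jker3_def ibinom_def)
  finally have 1: "?F (- m - 1) - ?G (- m - 1) = ?C (-1) + scW (of_int m) (?C (-2))"
    using j W.jacobi_defect_minus_1[of ?F ?G ?C "- m - 1"] by simp
  have "?C (-2) = (if m + n = 0 then scW (l * star_form form u v) (c k w) else 0)"
  proof -
    let ?x = "l * star_form form u v"
    have e: "W.vprod (\<theta> u) (\<theta> v) (- 2) = (\<lambda>k w. scW ?x (W.idf k w) + scW 0 (W.idf k w))"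
      unfolding p(2) by (auto simp: W.idf_def fun_eq_iff)
    have "W.qlocal W.idf c" using qlocal_generated[OF generated.idf c] .
    then have "?C (-2) = scW ?x (W.vprod W.idf c (N + 2) k w) + scW 0 (W.vprod W.idf c (N + 2) k w)"
      unfolding e using W.vprod_comb_left[where x = ?x and y = 0, OF W.vfield_idf W.vfield_idf c'(1)] by simp
    then show ?thesis using W.vprod_idf_left[OF c'(1)] by (auto simp: N_def)
  qed
  moreover have "?C (-1) = W.vprod (\<theta> (star_bracket u v)) c (- (m + n) - 1) k w"
  proof -
    have "N - (- 1) = - (m + n) - 1" by (simp add: N_def)
    then show ?thesis by (simp only: p(1))
  qed
  moreover have "?F (- m - 1) = actE (affine_mono u m) (actE (affine_mono v n) c) k w"
    "?G (- m - 1) = actE (affine_mono v n) (actE (affine_mono u m) c) k w"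
    using c by (simp_all add: actE_mono generated.vprod N_def)
  moreover have "actE (bracket (affine_mono u m) (affine_mono v n)) c k w
      = W.vprod (\<theta> (star_bracket u v)) c (- (m + n) - 1) k w
        + (if m + n = 0 then scW (of_int m) (scW (l * star_form form u v) (c k w)) else 0)"
    unfolding bracket_mono actE_def by (simp add: pm_sum_single vprod_\<theta>[OF c] mult_ac)
  ultimately show ?thesis using 1 by simp
qed

lemma actE_bracket:
  "generated c \<Longrightarrow> actE (bracket x y) c = (\<lambda>k w. actE x (actE y c) k w - actE y (actE x c) k w)"
proof -
  assume c: "generated c"
  have "actE (bracket x y) c k w = actE x (actE y c) k w - actE y (actE x c) k w" for k w
  proof (induction x rule: affine_decompose)
    case zero
    have "actE y (\<lambda>k w. 0) = (\<lambda>k w. 0)" using actE_scale_right[OF c, of y 0] by simp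
    then show ?case using bracket_central(1)[of 0 y] by (simp add: zero_prod_def actE_zero[unfolded zero_prod_def])
  next
    case (mono u m)
    show ?case
    proof (induction y rule: affine_decompose)
      case zero
      have "actE (affine_mono u m) (\<lambda>k w. 0) = (\<lambda>k w. 0)" using actE_scale_right[OF c, of _ 0] by simp
      then show ?case using bracket_central(2)[of "affine_mono u m" 0] by (simp add: zero_prod_def actE_zero[unfolded zero_prod_def])
    next
      case (mono v n)
      show ?case by (rule actE_bracket_mono[OF c])
    next
      case (central \<alpha>)
      show ?case by (simp add: bracket_central actE_zero actE_central actE_scale_right[OF c])
    next
      case (add x y)
      have "actE (affine_mono u m) (\<lambda>k w. actE x c k w + actE y c k w)
        = (\<lambda>k w. actE (affine_mono u m) (actE x c) k w + actE (affine_mono u m) (actE y c) k w)"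
        using actE_comb[OF generated_actE[OF c] generated_actE[OF c], of "affine_mono u m" 1 x 1 y] by simp
      then show ?case using add by (simp add: bracket_add actE_add c generated_actE algebra_simps)
    qed
  next
    case (central \<alpha>)
    show ?case by (simp add: bracket_central actE_zero actE_central actE_scale_right[OF c])
  next
    case (add x x')
    have "actE y (\<lambda>k w. actE x c k w + actE x' c k w)
      = (\<lambda>k w. actE y (actE x c) k w + actE y (actE x' c) k w)"
      using actE_comb[OF generated_actE[OF c] generated_actE[OF c], of y 1 x 1 x'] by simp
    then show ?case using add by (simp add: bracket_add actE_add c generated_actE algebra_simps)
  qed
  then show ?thesis by blast
qed

section \<open>The map out of the induced module\<close>

definition scalar :: "complex \<Rightarrow> int \<Rightarrow> 'w \<Rightarrow> 'w" where
  "scalar z k w = scW z (W.idf k w)"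

definition word :: "(int \<times> int \<Rightarrow>\<^sub>0 'a) affine list \<Rightarrow> complex \<Rightarrow> int \<Rightarrow> 'w \<Rightarrow> 'w" where
  "word xs z = foldr actE xs (scalar z)"

text \<open>The analogue of \<open>induced_map\<close> with values in fields.\<close>

definition \<Theta> :: "(((int \<times> int \<Rightarrow>\<^sub>0 'a) affine list \<times> complex) \<Rightarrow>\<^sub>0 complex) \<Rightarrow> int \<Rightarrow> 'w \<Rightarrow> 'w" where
  "\<Theta> p k w = pm_sum (\<lambda>(xs, z) c. scW c (word xs z k w)) p"

lemma generated_scalar: "generated (scalar z)"
  unfolding scalar_def[abs_def] by (rule generated_scale) (rule generated.idf)

lemma generated_foldr: "generated c \<Longrightarrow> generated (foldr actE xs c)"
  by (induction xs) (simp_all add: generated_actE)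

lemma generated_word: "generated (word xs z)"
  by (simp add: word_def generated_foldr generated_scalar)

lemma foldr_comb:
  "generated c \<Longrightarrow> generated d \<Longrightarrow> foldr actE xs (\<lambda>k w. scW s (c k w) + scW t (d k w))
    = (\<lambda>k w. scW s (foldr actE xs c k w) + scW t (foldr actE xs d k w))"
  by (induction xs) (simp_all add: actE_comb generated_foldr)

lemma \<Theta>_add: "\<Theta> (p + p') = (\<lambda>k w. \<Theta> p k w + \<Theta> p' k w)"
  by (rule ext)+ (simp add: \<Theta>_def pm_sum_add case_prod_unfold W.scale_left_distrib)

lemma \<Theta>_zero: "\<Theta> 0 = (\<lambda>k w. 0)"
  by (rule ext)+ (simp add: \<Theta>_def)

lemma \<Theta>_scale: "\<Theta> (pm_scale (*) x p) = (\<lambda>k w. scW x (\<Theta> p k w))"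
  unfolding \<Theta>_def by (rule ext)+ (rule pm_sum_scale; simp add: case_prod_unfold W.scale_right_distrib)

lemma \<Theta>_word: "\<Theta> (word_tensor xs z) = word xs z"
  by (rule ext)+ (simp add: \<Theta>_def word_tensor_def pm_sum_single)

lemma \<Theta>_diff: "\<Theta> (p - p') = (\<lambda>k w. \<Theta> p k w - \<Theta> p' k w)"
  using \<Theta>_add[of "p - p'" p'] by (simp add: fun_eq_iff)

lemma \<Theta>_single: "\<Theta> (Poly_Mapping.single (xs, z) c) = (\<lambda>k w. scW c (word xs z k w))"
  by (rule ext)+ (simp add: \<Theta>_def pm_sum_single)

lemma generated_\<Theta>: "generated (\<Theta> p)"
proof (induction p rule: pm_induct)
  case zero
  then show ?case by (simp add: \<Theta>_zero generated_0)
next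
  case (single i c)
  then show ?case by (cases i) (simp add: \<Theta>_single generated_scale generated_word)
next
  case (add p p')
  then show ?case by (simp add: \<Theta>_add generated_add)
qed

text \<open>Nonnegative modes are coefficients of negative powers of x_0, and the product of a field
  with the identity field has none.\<close>

lemma actE_scalar:
  assumes "x \<in> affine_nonneg"
  shows "actE x (scalar z) = scalar (level_action l x z)"
proof (rule ext)+
  fix k w
  obtain p \<alpha> where x: "x = (p, \<alpha>)" "Poly_Mapping.keys p \<subseteq> {0..}" using assms by (auto simp: affine_nonneg_def)
  have "W.vprod (\<theta> u) (scalar z) (- n - 1) k w = 0" if "0 \<le> n" for n u
  proof -
    have "scalar z = (\<lambda>k w. scW z (W.idf k w) + scW 0 (W.idf k w))" by (auto simp: scalar_def fun_eq_iff)
    moreover have "W.qlocal (\<theta> u) W.idf" using qlocal_\<theta>_generated[OF generated.idf] .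
    ultimately have "W.vprod (\<theta> u) (scalar z) = (\<lambda>i k w. scW z (W.vprod (\<theta> u) W.idf i k w) + scW 0 (W.vprod (\<theta> u) W.idf i k w))"
      using W.vprod_comb_right[where x = z and y = 0, OF W.vfield_idf W.vfield_idf vfield_\<theta>[of u]] by simp
    then show ?thesis using W.vprod_idf_right[OF vfield_\<theta>] that by simp
  qed
  then have "pm_sum (\<lambda>n u. W.vprod (\<theta> u) (scalar z) (- n - 1) k w) p = 0"
    unfolding pm_sum_def using x(2) by (intro sum.neutral) auto
  then show "actE x (scalar z) k w = scalar (level_action l x z) k w"
    by (simp add: actE_def x level_action_def scalar_def)
qed

text \<open>The six families of generators are treated in the order of their definition. Beyond
  linearity of the products, the third uses \<open>actE_bracket\<close> and the sixth
  \<open>actE_scalar\<close>. Consequently \<open>\<Theta>\<close> descends to the quotient, that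
  is, to V.\<close>

lemma \<Theta>_relations:
  assumes "p \<in> induced_relations (affine_scale (pm_scale scA)) bracket affine_nonneg (*) (level_action l)"
  shows "\<Theta> p = (\<lambda>k w. 0)"
proof -
  interpret M: module "pm_scale (*) :: complex \<Rightarrow> (((int \<times> int \<Rightarrow>\<^sub>0 'a) affine list \<times> complex) \<Rightarrow>\<^sub>0 complex) \<Rightarrow> _"
    by (rule module_pm_scale)
  let ?K = "{p. \<Theta> p = (\<lambda>k w. 0)}"
  have sub: "M.subspace ?K" by (rule M.subspaceI) (simp_all add: \<Theta>_zero \<Theta>_add \<Theta>_scale)
  have app: "word (xs @ ys) z = foldr actE xs (word ys z)" for xs ys z by (simp add: word_def)
  have cons: "word (x # ys) z = actE x (word ys z)" for x ys z by (simp add: word_def)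
  have lin: "foldr actE xs (\<lambda>k w. c k w + d k w) = (\<lambda>k w. foldr actE xs c k w + foldr actE xs d k w)"
    "foldr actE xs (\<lambda>k w. scW s (c k w)) = (\<lambda>k w. scW s (foldr actE xs c k w))"
    "foldr actE xs (\<lambda>k w. c k w - d k w) = (\<lambda>k w. foldr actE xs c k w - foldr actE xs d k w)"
    if "generated c" "generated d" for xs c d s
    using foldr_comb[OF that, of xs 1 1] foldr_comb[OF that, of xs s 0] foldr_comb[OF that, of xs 1 "-1"]
    by simp_all
  have 1: "word_tensor (xs @ (x + y) # ys) m - word_tensor (xs @ x # ys) m - word_tensor (xs @ y # ys) m \<in> ?K" for xs x y ys m
    by (simp add: \<Theta>_diff \<Theta>_word app cons actE_add generated_word lin generated_actE)
  have 2: "word_tensor (xs @ affine_scale (pm_scale scA) c x # ys) m - pm_scale (*) c (word_tensor (xs @ x # ys) m) \<in> ?K" for xs c x ys m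
    using lin(2)[OF generated_actE generated_actE, OF generated_word generated_word]
    by (simp add: \<Theta>_diff \<Theta>_scale \<Theta>_word app cons actE_scale generated_word)
  have 3: "word_tensor (xs @ x # y # ys) m - word_tensor (xs @ y # x # ys) m - word_tensor (xs @ bracket x y # ys) m \<in> ?K" for xs x y ys m
    by (simp add: \<Theta>_diff \<Theta>_word app cons actE_bracket generated_word lin generated_actE)
  have sc: "scalar (m + m') = (\<lambda>k w. scalar m k w + scalar m' k w)" "scalar (c * m) = (\<lambda>k w. scW c (scalar m k w))" for m m' c
    by (auto simp: scalar_def W.scale_left_distrib fun_eq_iff)
  have 4: "word_tensor xs (m + m') - word_tensor xs m - word_tensor xs m' \<in> ?K" for xs m m'
    by (simp add: \<Theta>_diff \<Theta>_word word_def sc lin generated_scalar)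
  have 5: "word_tensor xs (c * m) - pm_scale (*) c (word_tensor xs m) \<in> ?K" for xs c m
    using lin(2)[OF generated_scalar generated_scalar]
    by (simp add: \<Theta>_diff \<Theta>_scale \<Theta>_word word_def sc)
  have fs: "foldr actE bs (scalar m) = scalar (foldr (level_action l) bs m)" if "set bs \<subseteq> affine_nonneg" for bs m
    using that by (induction bs) (simp_all add: actE_scalar)
  have 6: "word_tensor (xs @ bs) m - word_tensor xs (foldr (level_action l) bs m) \<in> ?K" if "set bs \<subseteq> affine_nonneg" for xs bs m
    using fs[OF that] by (simp add: \<Theta>_diff \<Theta>_word word_def)
  have "induced_relations (affine_scale (pm_scale scA)) bracket affine_nonneg (*) (level_action l) \<subseteq> ?K"
    unfolding induced_relations_def 
    by (rule M.span_minimal[OF _ sub], intro Un_least subsetI; elim CollectE exE conjE; hypsubst;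
        (rule 1 2 3 4 5 | (rule 6, assumption)))
  then show ?thesis using assms by blast
qed

end

section \<open>The quasi module structure\<close>

locale quasi_module_setting = quantum_torus_module scA form q l scW actW
  for scA :: "complex \<Rightarrow> 'a::ring \<Rightarrow> 'a" and form q l
    and scW :: "complex \<Rightarrow> 'w::ab_group_add \<Rightarrow> 'w" and actW +
  fixes scV :: "complex \<Rightarrow> 'v::ab_group_add \<Rightarrow> 'v"
    and actV :: "(int \<times> int \<Rightarrow>\<^sub>0 'a) affine \<Rightarrow> 'v \<Rightarrow> 'v"
    and Y :: "'v \<Rightarrow> int \<Rightarrow> 'v \<Rightarrow> 'v"
    and vac :: 'v
  assumes va: "affine_vertex_algebra (pm_scale scA) star_bracket (star_form form) l scV actV Y vac"
begin

definition gen :: "(int \<times> int \<Rightarrow>\<^sub>0 'a) \<Rightarrow> 'v" where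
  "gen u = actV (affine_mono u (- 1)) vac"

lemma lie_module_V: "lie_module (affine_scale (pm_scale scA)) bracket scV actV"
  and VA: "vertex_algebra scV Y vac"
  and Y_gen: "Y (gen u) k v = actV (affine_mono u (- k - 1)) v"
  using va by (simp_all add: affine_vertex_algebra_def is_induced_module_def gen_def)

sublocale V: cspace scV
  using lie_module_V unfolding lie_module_def Vector_Spaces.linear_iff cspace_def by blast

lemma actV_left: "actV (x + y) v = actV x v + actV y v"
  and actV_right: "actV x (v + v') = actV x v + actV x v'" "actV x (scV c v) = scV c (actV x v)"
  and actV_bracket: "actV (bracket x y) v = actV x (actV y v) - actV y (actV x v)"
  using lie_module_V unfolding lie_module_def Vector_Spaces.linear_iff by blast+

lemma actV_zero: "actV 0 v = 0" "actV x 0 = 0"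
  using actV_left[of 0 0 v] actV_right(1)[of x 0 0] by simp_all

abbreviation ind :: "(((int \<times> int \<Rightarrow>\<^sub>0 'a) affine list \<times> complex) \<Rightarrow>\<^sub>0 complex) \<Rightarrow> 'v" where
  "ind \<equiv> induced_map scV actV (\<lambda>z. scV z vac)"

lemma ind_eq: "ind p = pm_sum (\<lambda>(xs, z) c. scV c (foldr actV xs (scV z vac))) p"
  by (simp add: induced_map_def pm_sum_def case_prod_unfold)

lemma ind_add: "ind (p + p') = ind p + ind p'"
  by (simp add: ind_eq pm_sum_add case_prod_unfold V.scale_left_distrib)

lemma ind_zero: "ind 0 = 0"
  by (simp add: ind_eq)

lemma ind_diff: "ind (p - p') = ind p - ind p'"
  using ind_add[of "p - p'" p'] by (simp add: algebra_simps)

lemma ind_scale: "ind (pm_scale (*) x p) = scV x (ind p)"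
  unfolding ind_eq by (rule pm_sum_scale; simp add: case_prod_unfold V.scale_right_distrib)

lemma ind_single: "ind (Poly_Mapping.single (xs, z) c) = scV c (foldr actV xs (scV z vac))"
  by (simp add: ind_eq pm_sum_single)

lemma ind_surj: "\<exists>p. ind p = v"
proof -
  have "v \<in> range ind" using va by (simp add: affine_vertex_algebra_def is_induced_module_def)
  then show ?thesis by auto
qed

lemma ind_kernel: "ind p = 0 \<longleftrightarrow>
    p \<in> induced_relations (affine_scale (pm_scale scA)) bracket affine_nonneg (*) (level_action l)"
proof -
  have "{p. ind p = 0} = induced_relations (affine_scale (pm_scale scA)) bracket affine_nonneg (*) (level_action l)"
    using va by (simp add: affine_vertex_algebra_def is_induced_module_def)
  then show ?thesis by auto
qed

definition \<phi> :: "'v \<Rightarrow> int \<Rightarrow> 'w \<Rightarrow> 'w" where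
  "\<phi> v = \<Theta> (SOME p. ind p = v)"

text \<open>Two preimages of a vector under \<open>ind\<close> differ by an induced relation, which
  \<open>\<Theta>\<close> kills; so the choice in \<open>\<phi>\<close> is immaterial.\<close>

lemma \<phi>_ind: "\<phi> (ind p) = \<Theta> p"
proof -
  let ?p = "SOME p'. ind p' = ind p"
  have "ind ?p = ind p" by (rule someI[of _ p]) simp
  then have "\<Theta> (?p - p) = (\<lambda>k w. 0)"
    by (intro \<Theta>_relations) (simp add: ind_kernel[symmetric] ind_diff)
  then show ?thesis by (simp add: \<phi>_def \<Theta>_diff fun_eq_iff)
qed

lemma \<phi>_add: "\<phi> (u + v) = (\<lambda>k w. \<phi> u k w + \<phi> v k w)"
proof -
  obtain p p' where p: "ind p = u" "ind p' = v" using ind_surj by blast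
  show ?thesis unfolding p[symmetric] ind_add[symmetric] \<phi>_ind by (rule \<Theta>_add)
qed

lemma \<phi>_scale: "\<phi> (scV c v) = (\<lambda>k w. scW c (\<phi> v k w))"
proof -
  obtain p where p: "ind p = v" using ind_surj by blast
  show ?thesis unfolding p[symmetric] ind_scale[symmetric] \<phi>_ind by (rule \<Theta>_scale)
qed

lemma \<phi>_vac: "\<phi> vac = W.idf"
proof -
  have vac: "ind (Poly_Mapping.single ([], 1) 1) = vac" by (simp add: ind_single)
  have "\<phi> vac = \<Theta> (Poly_Mapping.single ([], 1) 1)"
    using \<phi>_ind[of "Poly_Mapping.single ([], 1) 1"] by (simp only: vac)
  then show ?thesis by (simp add: \<Theta>_single word_def scalar_def fun_eq_iff)
qed

lemma generated_\<phi>: "generated (\<phi> v)"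
  by (simp add: \<phi>_def generated_\<Theta>)

lemma \<phi>_actV: "\<phi> (actV x v) = actE x (\<phi> v)"
proof -
  have "\<phi> (actV x (ind p)) = actE x (\<Theta> p)" for p
  proof (induction p rule: pm_induct)
    case zero
    have "actE x (\<lambda>k w. 0) = (\<lambda>k w. 0)" using actE_scale_right[OF generated_0, of x 0] by simp
    then show ?case using \<phi>_ind[of 0] by (simp add: ind_zero actV_zero \<Theta>_zero)
  next
    case (single i c)
    obtain xs z where i: "i = (xs, z)" by (cases i)
    have "actV x (ind (Poly_Mapping.single i c)) = ind (Poly_Mapping.single (x # xs, z) c)"
      by (simp add: i ind_single actV_right)
    then have "\<phi> (actV x (ind (Poly_Mapping.single i c))) = \<Theta> (Poly_Mapping.single (x # xs, z) c)"
      by (simp add: \<phi>_ind)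
    then show ?case
      by (simp add: i \<Theta>_single actE_scale_right[OF generated_word] word_def[of "x # xs"] word_def[of xs])
         (simp add: word_def[symmetric] actE_scale_right[OF generated_word])
  next
    case (add p p')
    have "actE x (\<lambda>k w. \<Theta> p k w + \<Theta> p' k w) = (\<lambda>k w. actE x (\<Theta> p) k w + actE x (\<Theta> p') k w)"
      using actE_comb[OF generated_\<Theta>[of p] generated_\<Theta>[of p'], of x 1 1] by simp
    then show ?case using add by (simp add: ind_add actV_right \<phi>_add \<Theta>_add)
  qed
  moreover obtain p where "ind p = v" using ind_surj by blast
  ultimately show ?thesis using \<phi>_ind[of p] by auto
qed

lemma \<phi>_gen: "\<phi> (gen u) = \<theta> u"
  unfolding gen_def \<phi>_actV \<phi>_vac actE_mono[OF generated.idf] W.vprod_idf_right[OF vfield_\<theta>]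
  by (simp add: fun_eq_iff)

lemma \<phi>_Y_gen: "\<phi> (Y (gen u) i v) = W.vprod (\<theta> u) (\<phi> v) i"
  by (simp add: Y_gen \<phi>_actV actE_mono[OF generated_\<phi>])

text \<open>On the vacuum this is balancedness over the subalgebra for a one-letter word. Being
  central, the element then moves past the letters of any word.\<close>

lemma actV_central: "actV (0, \<alpha>) v = scV (\<alpha> * l) v"
proof -
  have word: "actV (0, \<alpha>) (foldr actV xs (scV z vac)) = scV (\<alpha> * l) (foldr actV xs (scV z vac))" for xs z
  proof (induction xs)
    case Nil
    interpret M: module "pm_scale (*) :: complex \<Rightarrow> (((int \<times> int \<Rightarrow>\<^sub>0 'a) affine list \<times> complex) \<Rightarrow>\<^sub>0 complex) \<Rightarrow> _"
      by (rule module_pm_scale)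
    let ?x = "(0, \<alpha>) :: (int \<times> int \<Rightarrow>\<^sub>0 'a) affine"
    have "set [?x] \<subseteq> affine_nonneg" by (auto simp: affine_nonneg_def)
    then have "word_tensor ([] @ [?x]) z - word_tensor [] (foldr (level_action l) [?x] z)
        \<in> induced_relations (affine_scale (pm_scale scA)) bracket affine_nonneg (*) (level_action l)"
      unfolding induced_relations_def by (intro M.span_base UnI2) blast
    then have "ind (word_tensor [?x] z - word_tensor [] (level_action l ?x z)) = 0"
      by (simp add: ind_kernel)
    then show ?case by (simp add: ind_diff word_tensor_def ind_single level_action_def)
  next
    case (Cons x xs)
    have "actV (0, \<alpha>) (actV x v) = actV x (actV (0, \<alpha>) v)" for v
      using actV_bracket[of "(0, \<alpha>)" x v] by (simp add: bracket_central actV_zero)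
    then show ?case using Cons by (simp add: actV_right)
  qed
  have "actV (0, \<alpha>) (ind p) = scV (\<alpha> * l) (ind p)" for p
  proof (induction p rule: pm_induct)
    case (single i c)
    then show ?case by (cases i) (simp add: ind_single actV_right word mult.commute)
  qed (simp_all add: ind_zero actV_zero ind_add actV_right V.scale_right_distrib)
  moreover obtain p where "ind p = v" using ind_surj by blast
  ultimately show ?thesis by auto
qed

text \<open>The affine algebra is spanned by monomials, which act as modes of generators, and by k,
  which acts as a scalar. Hence V is spanned by iterated modes of generators applied to the
  vacuum.\<close>

lemma V_induct [case_names vac add scale gen]:
  assumes "P vac" and add: "\<And>u v. P u \<Longrightarrow> P v \<Longrightarrow> P (u + v)" and scale: "\<And>c v. P v \<Longrightarrow> P (scV c v)"
    and gen: "\<And>u i v. P v \<Longrightarrow> P (Y (gen u) i v)"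
  shows "P v"
proof -
  have 0: "P 0" using scale[OF assms(1), of 0] by simp
  have act: "P (actV x v)" if "P v" for x v
  proof (induction x rule: affine_decompose)
    case (mono u n)
    then show ?case using gen[OF that, of u "- n - 1"] by (simp add: Y_gen)
  qed (simp_all add: actV_zero 0 actV_central scale that actV_left add)
  have word: "P (foldr actV xs (scV z vac))" for xs z
    by (induction xs) (simp_all add: assms(1) scale act)
  have "P (ind p)" for p
  proof (induction p rule: pm_induct)
    case (single i c)
    then show ?case by (cases i) (simp add: ind_single scale word)
  qed (simp_all add: ind_zero 0 ind_add add)
  moreover obtain p where "ind p = v" using ind_surj by blast
  ultimately show ?thesis by auto
qed

section \<open>Compatibility with products, existence and uniqueness\<close>

lemma Y_linear: "Y (u + v) k w = Y u k w + Y v k w" "Y (scV c u) k w = scV c (Y u k w)"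
    "Y u k (v + w) = Y u k v + Y u k w" "Y u k (scV c v) = scV c (Y u k v)"
  and Y_truncated: "lower_truncated (\<lambda>k. Y u k v)"
  and Y_vac: "Y vac k v = (if k = 0 then v else 0)"
  and Y_jacobi: "jacobi_identity scV Y Y 1 u v"
  using VA unfolding vertex_algebra_def linear_field_map_def Vector_Spaces.linear_iff by blast+

lemma Y_zero: "Y 0 k v = 0"
  using Y_linear(1)[of 0 0 k v] by simp

lemma vfield_Y: "V.vfield (Y u)"
  by (simp add: V.vfield_def homog_map_def Y_linear Y_truncated)

text \<open>In V the multiplier is 1, so all defects vanish and
  \<open>jacobi_defect_expansions\<close> applies, with a power of z - 1 as denominator.\<close>

lemma Y_expansions:
  "\<exists>rs. V.expansions rs (\<lambda>i. Y u i (Y v (n - i) c)) (\<lambda>i. Y v (n - i) (Y u i c)) (\<lambda>i. Y (Y u i v) (n - i) c)"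
proof -
  obtain I where I: "\<forall>m<I. Y u m v = 0" using Y_truncated[of u v] by (auto simp: lower_truncated_def)
  have I': "Y (Y u m v) k w = 0" if "m < I" for m k w using I that by (simp add: Y_zero)
  have js: "V.jacobi_series Y Y u v w i j k = 0" for w i j k
    using V.jacobi_identity_iff[where YW = Y and Y = Y and u = u and v = v and f = 1, OF vfield_Y vfield_Y I'] Y_jacobi
    by (simp add: V.pmul_1)
  let ?F = "V.opF (Y u) (Y v) n c" and ?G = "V.opG (Y u) (Y v) n c" and ?C = "\<lambda>m. Y (Y u m v) (n - m) c"
  have "V.expansions (replicate (nat (- I)) 1) ?F ?G ?C"
  proof (rule V.jacobi_defect_expansions)
    show "upper_truncated ?F" "lower_truncated ?G"
      by (rule V.opF_truncated V.opG_truncated; rule vfield_Y)+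
    show "lower_truncated ?C" using I' unfolding lower_truncated_def by blast
    show "V.jacobi_defect ?F ?G ?C i j = 0" for i j
      using js[of c i j "n - 1 - i - j"] by (simp add: V.jacobi_series_def)
    show "?C i = 0" if "i < - int (nat (- I))" for i
      using I'[of i] that by (cases "I < 0") auto
  qed
  then show ?thesis unfolding V.opF_eq V.opG_eq by blast
qed

lemma homog_\<phi>: "homog_map scV scW (\<lambda>v. \<phi> v k w)"
  by (simp add: homog_map_def \<phi>_add \<phi>_scale)

text \<open>For u of the form \<open>Y (gen u) m v\<close>, applying \<open>\<phi>\<close> to the
  expansions in V and using the induction hypothesis gives the same first two expansions as
  \<open>vprod_jacobi\<close> does for the fields. The third expansion is determined by
  them.\<close>

lemma \<phi>_Y: "\<phi> (Y u i v) = W.vprod (\<phi> u) (\<phi> v) i"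
proof -
  have "\<forall>i v. \<phi> (Y u i v) = W.vprod (\<phi> u) (\<phi> v) i"
  proof (induction u rule: V_induct)
    case vac
    have "\<phi> 0 = (\<lambda>k w. 0)" using \<phi>_scale[of 0 0] by simp
    then show ?case
      by (auto simp: Y_vac \<phi>_vac W.vprod_idf_left[OF vfield_generated[OF generated_\<phi>]] fun_eq_iff)
  next
    case (add u v)
    show ?case
    proof (intro allI)
      fix i x
      show "\<phi> (Y (u + v) i x) = W.vprod (\<phi> (u + v)) (\<phi> x) i"
        using W.vprod_comb_left[where x = 1 and y = 1 and a = "\<phi> u" and b = "\<phi> v" and c = "\<phi> x"] add
        by (simp add: Y_linear \<phi>_add generated_\<phi> vfield_generated qlocal_generated)
    qed
  next
    case (scale c u)
    show ?case
    proof (intro allI)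
      fix i x
      show "\<phi> (Y (scV c u) i x) = W.vprod (\<phi> (scV c u)) (\<phi> x) i"
        using W.vprod_comb_left[where x = c and y = 0 and a = "\<phi> u" and b = "\<phi> u" and c = "\<phi> x"] scale
        by (simp add: Y_linear \<phi>_scale generated_\<phi> vfield_generated qlocal_generated)
    qed
  next
    case (gen u m v)
    show ?case
    proof (intro allI, rule ext, rule ext)
      fix j x k w
      define n where "n = m + j"
      obtain rs where rs: "V.expansions rs (\<lambda>i. Y (gen u) i (Y v (n - i) x)) (\<lambda>i. Y v (n - i) (Y (gen u) i x))
          (\<lambda>i. Y (Y (gen u) i v) (n - i) x)" using Y_expansions by blast
      have 1: "W.expansions rs (\<lambda>i. W.vprod (\<theta> u) (W.vprod (\<phi> v) (\<phi> x) (n - i)) i k w)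
          (\<lambda>i. W.vprod (\<phi> v) (W.vprod (\<theta> u) (\<phi> x) i) (n - i) k w) (\<lambda>i. \<phi> (Y (Y (gen u) i v) (n - i) x) k w)"
        using expansions_map[OF V.cspace_scale W.cspace_scale homog_\<phi>[of k w] rs] gen
        by (simp add: \<phi>_Y_gen)
      obtain ss where 2: "W.expansions ss (\<lambda>i. W.vprod (\<theta> u) (W.vprod (\<phi> v) (\<phi> x) (n - i)) i k w)
          (\<lambda>i. W.vprod (\<phi> v) (W.vprod (\<theta> u) (\<phi> x) i) (n - i) k w)
          (\<lambda>i. W.vprod (W.vprod (\<theta> u) (\<phi> v) i) (\<phi> x) (n - i) k w)"
        using W.vprod_jacobi[OF vfield_\<theta> vfield_generated[OF generated_\<phi>] vfield_generated[OF generated_\<phi>]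
          qlocal_\<theta>_generated[OF generated_\<phi>] qlocal_\<theta>_generated[OF generated_\<phi>]
          qlocal_generated[OF generated_\<phi> generated_\<phi>]] by blast
      from fun_cong[OF W.expansions_unique(1)[OF 1 2], of m]
      show "\<phi> (Y (Y (gen u) m v) j x) k w = W.vprod (\<phi> (Y (gen u) m v)) (\<phi> x) j k w"
        by (simp add: n_def \<phi>_Y_gen)
    qed
  qed
  then show ?thesis by blast
qed

lemma quasi_module_\<phi>: "quasi_module scV Y vac scW \<phi>"
  unfolding quasi_module_def
proof (intro conjI allI)
  show "linear_field_map scV scW \<phi>"
    unfolding linear_field_map_def Vector_Spaces.linear_iff
    using vfield_generated[OF generated_\<phi>]
    by (auto simp: \<phi>_add \<phi>_scale W.vfield_def homog_map_def V.vector_space_axioms W.vector_space_axioms)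
  show "\<phi> vac k w = (if k = 0 then w else 0)" for w k
    by (simp add: \<phi>_vac W.idf_def)
  show "\<exists>f. f \<noteq> 0 \<and> jacobi_identity scW Y \<phi> f u v" for u v
  proof -
    have f: "W.vfield (\<phi> u)" for u by (rule vfield_generated[OF generated_\<phi>])
    obtain rs where "W.ope rs (\<phi> u) (\<phi> v) (W.vprod (\<phi> u) (\<phi> v))"
      using W.ope_vprod[OF f f qlocal_generated[OF generated_\<phi> generated_\<phi>]] by blast
    then have "W.ope rs (\<phi> u) (\<phi> v) (\<lambda>i. \<phi> (Y u i v))" by (simp add: \<phi>_Y)
    from W.ope_jacobi_identity[where YW = \<phi> and Y = Y and u = u and v = v, OF f f this] show ?thesis using linear_product_nonzero by blast
  qed
qed

text \<open>By linearity the structures agree on all generators. If they agree on v, then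
  \<open>jacobi_identity_iterate_unique\<close> makes them agree on all
  \<open>Y (gen u) i v\<close>, so the induction principle for V applies.\<close>

lemma \<phi>_unique:
  assumes YW: "quasi_module scV Y vac scW YW"
    and X: "\<And>a m n k w. YW (gen (Poly_Mapping.single (m, n) a)) k w = Xf a m n k w"
  shows "YW = \<phi>"
proof -
  have lin: "YW (u + v) k w = YW u k w + YW v k w" "YW (scV c u) k w = scW c (YW u k w)"
      "YW u k (w + w') = YW u k w + YW u k w'" "YW u k (scW c w) = scW c (YW u k w)"
    and tr: "lower_truncated (\<lambda>k. YW u k w)" for u v k c w w'
    using YW unfolding quasi_module_def linear_field_map_def Vector_Spaces.linear_iff by blast+
  have f: "W.vfield (YW u)" for u by (simp add: W.vfield_def homog_map_def lin tr)
  have z: "YW 0 k w = 0" for k w using lin(1)[of 0 0 k w] by simp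
  have g: "YW (gen u) = \<theta> u" for u
  proof (induction u rule: pm_induct)
    case zero
    have "gen 0 = 0" by (simp add: gen_def affine_mono_def actV_zero flip: zero_prod_def)
    then show ?case by (simp add: fun_eq_iff z \<theta>_zero)
  next
    case (single i a)
    then show ?case by (cases i) (simp add: X \<theta>_single fun_eq_iff)
  next
    case (add p p')
    have "affine_mono (p + p') (- 1) = affine_mono p (- 1) + affine_mono p' (- 1)"
      by (simp add: affine_mono_def single_add)
    then have "gen (p + p') = gen p + gen p'" by (simp add: gen_def actV_left)
    then show ?case using add by (simp add: fun_eq_iff lin \<theta>_add)
  qed
  have "YW v = \<phi> v" for v
  proof (induction v rule: V_induct)
    case vac
    have "YW vac k w = (if k = 0 then w else 0)" for k w using YW by (simp add: quasi_module_def)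
    then show ?case by (simp add: \<phi>_vac W.idf_def fun_eq_iff)
  next
    case (add u v)
    then show ?case by (simp add: fun_eq_iff lin \<phi>_add)
  next
    case (scale c v)
    then show ?case by (simp add: fun_eq_iff lin \<phi>_scale)
  next
    case (gen u i v)
    obtain f1 where f1: "f1 \<noteq> 0" "jacobi_identity scW Y YW f1 (gen u) v"
      using YW unfolding quasi_module_def by blast
    obtain f2 where f2: "f2 \<noteq> 0" "jacobi_identity scW Y \<phi> f2 (gen u) v"
      using quasi_module_\<phi> unfolding quasi_module_def by blast
    obtain I where I: "\<forall>m<I. Y (gen u) m v = 0" using Y_truncated[of "gen u" v] by (auto simp: lower_truncated_def)
    have z\<phi>: "\<phi> 0 k w = 0" for k w using \<phi>_scale[of 0 0] by simp
    show ?case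
    proof (rule W.jacobi_identity_iterate_unique[where YW = YW and YW' = \<phi> and Y = Y and u = "gen u" and v = v and I = I and f = f1 and g = f2])
      show "W.vfield (YW v)" "W.vfield (\<phi> v)" for v
        by (rule f, rule vfield_generated[OF generated_\<phi>])
      show "YW (gen u) = \<phi> (gen u)" by (simp add: g \<phi>_gen)
      show "YW (Y (gen u) m v) k w = 0" "\<phi> (Y (gen u) m v) k w = 0" if "m < I" for m k w
        using I that by (simp_all add: z z\<phi>)
    qed (use gen f1 f2 in simp_all)
  qed
  then show ?thesis by blast
qed

end

theorem proposition7p12:
  fixes scA :: "complex \<Rightarrow> 'a::ring \<Rightarrow> 'a"
    and form :: "'a \<Rightarrow> 'a \<Rightarrow> complex"
    and q l :: complex
    and scW :: "complex \<Rightarrow> 'w::ab_group_add \<Rightarrow> 'w"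
    and actW :: "'a qtorus \<Rightarrow> 'w \<Rightarrow> 'w"
    and scV :: "complex \<Rightarrow> 'v::ab_group_add \<Rightarrow> 'v"
    and actV :: "(int \<times> int \<Rightarrow>\<^sub>0 'a) affine \<Rightarrow> 'v \<Rightarrow> 'v"
    and Y :: "'v \<Rightarrow> int \<Rightarrow> 'v \<Rightarrow> 'v"
    and vac :: 'v
  assumes "assoc_algebra scA"
    and "symmetric_invariant_form scA form"
    and "q \<noteq> 0"
    and "\<forall>n::nat. n > 0 \<longrightarrow> q ^ n \<noteq> 1"
    and "affine_vertex_algebra (pm_scale scA) star_bracket (star_form form) l scV actV Y vac"
    and "lie_module (qtorus_scale scA) (qtorus_bracket scA form q) scW actW"
    and "restricted_module actW"
    and "\<forall>w. actW qtorus_c0 w = scW l w"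
    and "\<forall>w. actW qtorus_c1 w = 0"
  shows "\<exists>!YW :: 'v \<Rightarrow> int \<Rightarrow> 'w \<Rightarrow> 'w.
    quasi_module scV Y vac scW YW \<and>
    (\<forall>a m n k w. YW (actV (affine_mono (Poly_Mapping.single (m, n) a) (-1)) vac) k w
       = Xbar_series scW q actW a m n k w)"
proof -
  interpret quasi_module_setting scA form q l scW actW scV actV Y vac
    by unfold_locales (use assms in blast)+
  show ?thesis
  proof (rule ex1I[of _ \<phi>])
    show "quasi_module scV Y vac scW \<phi> \<and>
      (\<forall>a m n k w. \<phi> (actV (affine_mono (Poly_Mapping.single (m, n) a) (-1)) vac) k w
         = Xbar_series scW q actW a m n k w)"
      using quasi_module_\<phi> by (simp add: gen_def[symmetric] \<phi>_gen \<theta>_single Xf_def)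
  next
    fix YW
    assume "quasi_module scV Y vac scW YW \<and>
      (\<forall>a m n k w. YW (actV (affine_mono (Poly_Mapping.single (m, n) a) (-1)) vac) k w
         = Xbar_series scW q actW a m n k w)"
    then show "YW = \<phi>" by (intro \<phi>_unique) (simp_all add: gen_def Xf_def)
  qed
qed

end
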